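(* Let $\mathfrak{g}=\mathrm{span}(p^0,L_1,L_2,L_3)$ with $p^0=\partial_t$, $L_i=\epsilon_{ijk}x^j\partial_k$ in Cartesian coordinates $(t,x^1,x^2,x^3)$, $r=\|\mathbf{x}\|$, and consider the deformation of type $\mathfrak{B}_{12}$ with $\kappa_1=\kappa_2=0$, i.e. the twist $\mathcal{F}_V=\exp\bigl(-\tfrac{i\lambda}{2}(V_1\otimes V_2-V_2\otimes V_1)\bigr)$ with $$V_1=c_1^0\,\partial_t,\qquad V_2=c_2^0(r)\,\partial_t+f_2(r)\,x^i\partial_i,$$ where $c_1^0$ is a constant, $c_2^0,f_2$ are functions of $r$ and $f_2$ is not the zero function. This deformation is invariant under the classical black hole symmetries (those generated by $\mathfrak{g}$), and, with the embedding $t_i^\star=t_i$ (so $\mathfrak{g}_\star=\mathfrak{g}$), $(U\mathfrak{g}_\star,\star,\Delta_\star,S_\star,\epsilon_\star)$ is a $\star$-Hopf algebra (a $\star$-Hopf subalgebra of $\mathcal{H}^\star_\Xi=(U\Xi_\star,\star,\Delta_\star,S_\star,\epsilon_\star)$).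
   Context: Repeated spatial indices are summed over $1,2,3$; $\epsilon_{ijk}$ is the Levi-Civita symbol; $\partial_i=\partial/\partial x^i$; $\|\cdot\|$ is the Euclidean norm. $\mathfrak{g}$ is the Lie algebra of the symmetry group $\mathbb{R}\times SO(3)$ of a non-rotating black hole. Type $\mathfrak{B}_{12}$ in general is $V_1=c_1^0\partial_t+\kappa_1d^iL_i$, $V_2=c_2^0(r)\partial_t+\kappa_2d^iL_i+f_2(r)x^i\partial_i$ with $c_1^0,\kappa_1,\kappa_2,d^i$ constants and $f_2$ not the zero function. $\Xi$ is the Lie algebra of vector fields on the spacetime manifold, $U\Xi$ its universal enveloping algebra with the usual Hopf structure ($\Delta(u)=u\otimes1+1\otimes u$, $\epsilon(u)=0$, $S(u)=-u$ for $u\in\Xi$). Everything is over formal power series in $\lambda$. $U\Xi$ acts on $U\Xi$ by the adjoint action, written $\xi(u)$; for $V,u\in\Xi$, $V(u)=[V,u]$. Notation (sums over $\alpha$ understood): $\mathcal{F}=f^\alpha\otimes f_\alpha$, $\mathcal{F}^{-1}=\bar f^\alpha\otimes\bar f_\alpha$, $\mathcal{F}_{21}=f_\alpha\otimes f^\alpha$, $R=\mathcal{F}_{21}\mathcal{F}^{-1}$, $R^{-1}=\bar R^\alpha\otimes\bar R_\alpha$, $\chi=f^\alpha S(f_\alpha)$, $X_\xi=\bar f^\alpha\xi\chi S^{-1}(\bar f_\alpha)$. The $\star$-Hopf algebra $\mathcal{H}^\star_\Xi$ has $U\Xi_\star=U\Xi$ as a vector space, product $\xi\star\eta=\bar f^\alpha(\xi)\bar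 f_\alpha(\eta)$, and on generators $u\in\Xi$: $\Delta_\star(u)=u\otimes1+X_{\bar R^\alpha}\otimes\bar R_\alpha(u)$, $\epsilon_\star(u)=0$, $S_\star^{-1}(u)=-\bar R^\alpha(u)\star X_{\bar R_\alpha}$, with $\Delta_\star$ extended as a $\star$-algebra homomorphism and $S_\star$ as a $\star$-anti-homomorphism. $U\mathfrak{g}_\star$ is the subalgebra of $(U\Xi_\star,\star)$ generated by $\mathfrak{g}_\star$ and $1$; it is a $\star$-Hopf subalgebra if $\Delta_\star(U\mathfrak{g}_\star)\subseteq U\mathfrak{g}_\star\otimes U\mathfrak{g}_\star$ and $S_\star(U\mathfrak{g}_\star)\subseteq U\mathfrak{g}_\star$. *)

theory Defs
  imports
    "HOL-Analysis.Analysis"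
    "HOL-Library.Poly_Mapping"
    "HOL-Library.Product_Plus"
    "HOL-Computational_Algebra.Formal_Power_Series"
begin

section \<open>Complex vector spaces, algebras and Lie algebras\<close>

class complex_space = ab_group_add +
  fixes scaleC :: "complex \<Rightarrow> 'a \<Rightarrow> 'a"  (infixr \<open>*\<^sub>C\<close> 75)
  assumes scaleC_add_right: "c *\<^sub>C (x + y) = c *\<^sub>C x + c *\<^sub>C y"
    and scaleC_add_left: "(c + d) *\<^sub>C x = c *\<^sub>C x + d *\<^sub>C x"
    and scaleC_scaleC: "c *\<^sub>C d *\<^sub>C x = (c * d) *\<^sub>C x"
    and scaleC_one: "1 *\<^sub>C x = x"

class complex_algebra_1 = ring_1 + complex_space +
  assumes mult_scaleC_left: "(c *\<^sub>C x) * y = c *\<^sub>C (x * y)"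
    and mult_scaleC_right: "x * (c *\<^sub>C y) = c *\<^sub>C (x * y)"

class complex_lie_algebra = complex_space +
  fixes lie :: "'a \<Rightarrow> 'a \<Rightarrow> 'a"
  assumes lie_add_left: "lie (u + v) w = lie u w + lie v w"
    and lie_add_right: "lie u (v + w) = lie u v + lie u w"
    and lie_scaleC_left: "lie (c *\<^sub>C u) v = c *\<^sub>C lie u v"
    and lie_scaleC_right: "lie u (c *\<^sub>C v) = c *\<^sub>C lie u v"
    and lie_self: "lie u u = 0"
    and lie_jacobi: "lie u (lie v w) + lie v (lie w u) + lie w (lie u v) = 0"

interpretation complex_space: vector_space "scaleC :: complex \<Rightarrow> 'a::complex_space \<Rightarrow> 'a"
  by standard (simp_all add: scaleC_add_right scaleC_add_left scaleC_scaleC scaleC_one)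

definition complex_linear :: "('a::complex_space \<Rightarrow> 'b::complex_space) \<Rightarrow> bool" where
  "complex_linear f \<longleftrightarrow>
     (\<forall>x y. f (x + y) = f x + f y) \<and> (\<forall>c x. f (c *\<^sub>C x) = c *\<^sub>C f x)"


section \<open>Quotients of monoid algebras\<close>

inductive_set ideal_generated :: "'r::ring_1 set \<Rightarrow> 'r set" for G where
  zero: "0 \<in> ideal_generated G"
| step: "g \<in> G \<Longrightarrow> x \<in> ideal_generated G \<Longrightarrow> a * g * b + x \<in> ideal_generated G"

lemma ideal_generated_add:
  assumes "x \<in> ideal_generated G" "y \<in> ideal_generated G"
  shows "x + y \<in> ideal_generated G"
  using assms by induction (auto simp: add.assoc intro: ideal_generated.intros)

lemma ideal_generated_mult_left:
  assumes "x \<in> ideal_generated G"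
  shows "c * x \<in> ideal_generated G"
  using assms
proof induction
  case (step g x a b)
  then show ?case
    using ideal_generated.step[of g G "c * x" "c * a" b] by (simp add: algebra_simps)
qed (simp add: ideal_generated.zero)

lemma ideal_generated_mult_right:
  assumes "x \<in> ideal_generated G"
  shows "x * c \<in> ideal_generated G"
  using assms
proof induction
  case (step g x a b)
  then show ?case
    using ideal_generated.step[of g G "x * c" a "b * c"] by (simp add: algebra_simps)
qed (simp add: ideal_generated.zero)

lemma ideal_generated_uminus:
  assumes "x \<in> ideal_generated G"
  shows "- x \<in> ideal_generated G"
  using ideal_generated_mult_left[OF assms, of "- 1"] by simp

lemma ideal_generated_diff:
  assumes "x \<in> ideal_generated G" "y \<in> ideal_generated G"
  shows "x - y \<in> ideal_generated G"
  using ideal_generated_add[OF assms(1) ideal_generated_uminus[OF assms(2)]] by simp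

lemma ideal_generated_equivp: "equivp (\<lambda>p q. p - q \<in> ideal_generated G)"
proof (rule equivpI)
  show "reflp (\<lambda>p q. p - q \<in> ideal_generated G)"
    by (simp add: reflp_def ideal_generated.zero)
  show "symp (\<lambda>p q. p - q \<in> ideal_generated G)"
  proof (rule sympI)
    fix p q :: 'a
    assume "p - q \<in> ideal_generated G"
    from ideal_generated_uminus[OF this] show "q - p \<in> ideal_generated G" by simp
  qed
  show "transp (\<lambda>p q. p - q \<in> ideal_generated G)"
  proof (rule transpI)
    fix p q r :: 'a
    assume "p - q \<in> ideal_generated G" "q - r \<in> ideal_generated G"
    from ideal_generated_add[OF this] show "p - r \<in> ideal_generated G" by simp
  qed
qed

lemma ideal_generated_cong_add:
  assumes "p - p' \<in> ideal_generated G" "q - q' \<in> ideal_generated G"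
  shows "(p + q) - (p' + q') \<in> ideal_generated G"
  using ideal_generated_add[OF assms] by (simp add: algebra_simps)

lemma ideal_generated_cong_uminus:
  assumes "p - p' \<in> ideal_generated G"
  shows "(- p) - (- p') \<in> ideal_generated G"
  using ideal_generated_uminus[OF assms] by (simp add: algebra_simps)

lemma ideal_generated_cong_diff:
  assumes "p - p' \<in> ideal_generated G" "q - q' \<in> ideal_generated G"
  shows "(p - q) - (p' - q') \<in> ideal_generated G"
  using ideal_generated_diff[OF assms] by (simp add: algebra_simps)

lemma ideal_generated_cong_mult:
  assumes "p - p' \<in> ideal_generated G" "q - q' \<in> ideal_generated G"
  shows "p * q - p' * q' \<in> ideal_generated G"
proof -
  have "p * q - p' * q' = (p - p') * q + p' * (q - q')"
    by (simp add: algebra_simps)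
  then show ?thesis
    using ideal_generated_add[OF ideal_generated_mult_right[OF assms(1)]
        ideal_generated_mult_left[OF assms(2)]] by simp
qed

lemma ideal_generated_kernel:
  assumes "x \<in> ideal_generated G"
    and "f 0 = 0" and "\<And>p q. f (p + q) = f p + f q"
    and "\<And>a g b. g \<in> G \<Longrightarrow> f (a * g * b) = 0"
  shows "f x = (0::'b::ab_group_add)"
  using assms(1) by induction (simp_all add: assms(2-4))

lemma poly_mapping_induct [case_names single sum]:
  assumes single: "\<And>k c. P (Poly_Mapping.single k c)"
    and sum: "\<And>p q. P p \<Longrightarrow> P q \<Longrightarrow> P (p + q)"
  shows "P (f :: 'm \<Rightarrow>\<^sub>0 complex)"
proof (induction f rule: update_induct)
  case const
  then show ?case using single[of undefined 0] by simp
next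
  case (update f a b)
  have "Poly_Mapping.update a b f = Poly_Mapping.single a b + f"
    using update(1)
    by (intro poly_mapping_eqI) (auto simp: lookup_update lookup_add lookup_single when_def in_keys_iff)
  then show ?case using sum[OF single update(3)] by simp
qed

lemma single_zero_mult_commute:
  "Poly_Mapping.single 0 (c::complex) * p = p * Poly_Mapping.single (0::'m::monoid_add) c"
  by (induction p rule: poly_mapping_induct)
     (simp_all add: mult_single mult.commute distrib_left distrib_right)

lemma single_zero_left_commute:
  "p * (Poly_Mapping.single (0::'m::monoid_add) (c::complex) * q) = Poly_Mapping.single 0 c * (p * q)"
  by (metis mult.assoc single_zero_mult_commute)


section \<open>Universal enveloping algebra\<close>

text \<open>
  The free monoid is written additively, so that finitely supported functions on it, with the
  convolution product of \<^theory>\<open>HOL-Library.Poly_Mapping\<close>, form the free algebra.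
\<close>

datatype 'a free_monoid = Word (letters: "'a list")

instantiation free_monoid :: (type) monoid_add
begin
definition zero_free_monoid :: "'a free_monoid" where "0 = Word []"
definition plus_free_monoid :: "'a free_monoid \<Rightarrow> 'a free_monoid \<Rightarrow> 'a free_monoid"
  where "v + w = Word (letters v @ letters w)"
instance by standard (simp_all add: zero_free_monoid_def plus_free_monoid_def)
end

definition enveloping_relations :: "('x::complex_lie_algebra free_monoid \<Rightarrow>\<^sub>0 complex) set" where
  "enveloping_relations =
     {Poly_Mapping.single (Word [u + v]) 1 - Poly_Mapping.single (Word [u]) 1
        - Poly_Mapping.single (Word [v]) 1 |u v. True}
   \<union> {Poly_Mapping.single (Word [c *\<^sub>C u]) 1 - Poly_Mapping.single (Word [u]) c |c u. True}
   \<union> {Poly_Mapping.single (Word [u, v]) 1 - Poly_Mapping.single (Word [v, u]) 1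
        - Poly_Mapping.single (Word [lie u v]) 1 |u v. True}"

quotient_type (overloaded) 'x uea = "'x::complex_lie_algebra free_monoid \<Rightarrow>\<^sub>0 complex"
  / "\<lambda>p q. p - q \<in> ideal_generated enveloping_relations"
  by (rule ideal_generated_equivp)

lemma lookup_times_zero_free_monoid:
  fixes p q :: "'a free_monoid \<Rightarrow>\<^sub>0 complex"
  shows "Poly_Mapping.lookup (p * q) 0 = Poly_Mapping.lookup p 0 * Poly_Mapping.lookup q 0"
proof (induction p rule: poly_mapping_induct)
  case (single v c)
  show ?case
  proof (induction q rule: poly_mapping_induct)
    case (single w d)
    have "v + w = 0 \<longleftrightarrow> v = 0 \<and> w = 0"
      by (cases v; cases w) (simp add: zero_free_monoid_def plus_free_monoid_def)
    then show ?case
      by (auto simp: mult_single lookup_single when_def)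
  qed (simp add: distrib_left lookup_add)
qed (simp add: distrib_right lookup_add)

lemma one_notin_enveloping_ideal:
  "(1 :: 'x::complex_lie_algebra free_monoid \<Rightarrow>\<^sub>0 complex) \<notin> ideal_generated enveloping_relations"
proof
  assume "(1 :: 'x free_monoid \<Rightarrow>\<^sub>0 complex) \<in> ideal_generated enveloping_relations"
  then have "Poly_Mapping.lookup (1 :: 'x free_monoid \<Rightarrow>\<^sub>0 complex) 0 = 0"
  proof (rule ideal_generated_kernel)
    fix a g b :: "'x free_monoid \<Rightarrow>\<^sub>0 complex"
    assume "g \<in> enveloping_relations"
    then have "Poly_Mapping.lookup g 0 = 0"
      by (auto simp: enveloping_relations_def lookup_minus lookup_single zero_free_monoid_def)
    then show "Poly_Mapping.lookup (a * g * b) 0 = 0"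
      by (simp add: lookup_times_zero_free_monoid)
  qed (simp_all add: lookup_add)
  then show False by (simp add: lookup_one)
qed

instantiation uea :: (complex_lie_algebra) complex_algebra_1
begin

lift_definition zero_uea :: "'a uea" is 0 .
lift_definition one_uea :: "'a uea" is 1 .
lift_definition plus_uea :: "'a uea \<Rightarrow> 'a uea \<Rightarrow> 'a uea" is "(+)"
  by (rule ideal_generated_cong_add)
lift_definition uminus_uea :: "'a uea \<Rightarrow> 'a uea" is uminus
  by (rule ideal_generated_cong_uminus)
lift_definition minus_uea :: "'a uea \<Rightarrow> 'a uea \<Rightarrow> 'a uea" is "(-)"
  by (rule ideal_generated_cong_diff)
lift_definition times_uea :: "'a uea \<Rightarrow> 'a uea \<Rightarrow> 'a uea" is "(*)"
  by (rule ideal_generated_cong_mult)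
lift_definition scaleC_uea :: "complex \<Rightarrow> 'a uea \<Rightarrow> 'a uea" is
  "\<lambda>c p. Poly_Mapping.single 0 c * p"
  by (metis ideal_generated_mult_left right_diff_distrib)

instance
proof
  fix a b c :: "'a uea" and k l :: complex
  show "a + b + c = a + (b + c)"
    by transfer (simp add: add.assoc ideal_generated.zero)
  show "a + b = b + a"
    by transfer (simp add: add.commute ideal_generated.zero)
  show "0 + a = a"
    by transfer (simp add: ideal_generated.zero)
  show "- a + a = 0"
    by transfer (simp add: ideal_generated.zero)
  show "a - b = a + - b"
    by transfer (simp add: ideal_generated.zero)
  show "a * b * c = a * (b * c)"
    by transfer (simp add: mult.assoc ideal_generated.zero)
  show "1 * a = a"
    by transfer (simp add: ideal_generated.zero)
  show "a * 1 = a"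
    by transfer (simp add: ideal_generated.zero)
  show "(a + b) * c = a * c + b * c"
    by transfer (simp add: distrib_right ideal_generated.zero)
  show "a * (b + c) = a * b + a * c"
    by transfer (simp add: distrib_left ideal_generated.zero)
  show "(0 :: 'a uea) \<noteq> 1"
    by transfer (use one_notin_enveloping_ideal ideal_generated_uminus in fastforce)
  show "k *\<^sub>C (a + b) = k *\<^sub>C a + k *\<^sub>C b"
    by transfer (simp add: distrib_left ideal_generated.zero)
  show "(k + l) *\<^sub>C a = k *\<^sub>C a + l *\<^sub>C a"
    by transfer (simp add: single_add distrib_right ideal_generated.zero)
  show "k *\<^sub>C l *\<^sub>C a = (k * l) *\<^sub>C a"
    by transfer (simp add: mult.assoc[symmetric] mult_single ideal_generated.zero)
  show "1 *\<^sub>C a = a"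
    by transfer (simp add: ideal_generated.zero)
  show "(k *\<^sub>C a) * b = k *\<^sub>C (a * b)"
    by transfer (simp add: mult.assoc ideal_generated.zero)
  show "a * (k *\<^sub>C b) = k *\<^sub>C (a * b)"
    by transfer
       (simp add: single_zero_left_commute ideal_generated.zero)
qed

end

lift_definition gen :: "'x::complex_lie_algebra \<Rightarrow> 'x uea" is
  "\<lambda>u. Poly_Mapping.single (Word [u]) 1" .


section \<open>Tensor product of algebras\<close>

text \<open>
  The multiplicative monoid of an algebra, written additively.  The monoid algebra of the product
  of two such monoids is the free vector space on the pairs, with the product
  \<open>(a, b) (c, d) = (a c, b d)\<close>.  As the bilinearity relations are stable under multiplication by
  pairs, the ideal they generate is their linear span.
\<close>

datatype 'a mult_monoid = Mult (unMult: 'a)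

instantiation mult_monoid :: (monoid_mult) monoid_add
begin
definition zero_mult_monoid :: "'a mult_monoid" where "0 = Mult 1"
definition plus_mult_monoid :: "'a mult_monoid \<Rightarrow> 'a mult_monoid \<Rightarrow> 'a mult_monoid"
  where "a + b = Mult (unMult a * unMult b)"
instance by standard (simp_all add: zero_mult_monoid_def plus_mult_monoid_def mult.assoc)
end

abbreviation pure :: "'a \<Rightarrow> 'b \<Rightarrow> complex \<Rightarrow> ('a mult_monoid \<times> 'b mult_monoid \<Rightarrow>\<^sub>0 complex)" where
  "pure a b c \<equiv> Poly_Mapping.single (Mult a, Mult b) c"

definition tensor_relations ::
  "('a::complex_algebra_1 mult_monoid \<times> 'b::complex_algebra_1 mult_monoid \<Rightarrow>\<^sub>0 complex) set" where
  "tensor_relations =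
     {pure (a + a') b 1 - pure a b 1 - pure a' b 1 |a a' b. True}
   \<union> {pure a (b + b') 1 - pure a b 1 - pure a b' 1 |a b b'. True}
   \<union> {pure (c *\<^sub>C a) b 1 - pure a b c |c a b. True}
   \<union> {pure a (c *\<^sub>C b) 1 - pure a b c |c a b. True}"

quotient_type (overloaded) ('a, 'b) tensor =
  "'a::complex_algebra_1 mult_monoid \<times> 'b::complex_algebra_1 mult_monoid \<Rightarrow>\<^sub>0 complex"
  / "\<lambda>p q. p - q \<in> ideal_generated tensor_relations"
  by (rule ideal_generated_equivp)

lemma ex_normalised_functional:
  "\<exists>f :: 'a::complex_algebra_1 \<Rightarrow> complex.
     f 1 = 1 \<and> (\<forall>x y. f (x + y) = f x + f y) \<and> (\<forall>c x. f (c *\<^sub>C x) = c * f x)"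
proof -
  interpret C: vector_space "(*) :: complex \<Rightarrow> complex \<Rightarrow> complex"
    by standard (simp_all add: algebra_simps)
  interpret P: vector_space_pair "scaleC :: complex \<Rightarrow> 'a \<Rightarrow> 'a" "(*) :: complex \<Rightarrow> complex \<Rightarrow> complex" ..
  have "\<not> complex_space.dependent {1::'a}"
    by simp
  then obtain f where "Vector_Spaces.linear scaleC (*) f" "f (1::'a) = 1"
    using P.linear_independent_extend[of "{1::'a}" "\<lambda>_. 1"] by auto
  then show ?thesis
    by (metis P.linear_add P.linear_scale)
qed

definition lin_ext :: "('m \<Rightarrow> complex) \<Rightarrow> ('m \<Rightarrow>\<^sub>0 complex) \<Rightarrow> complex" where
  "lin_ext h p = (\<Sum>m\<in>Poly_Mapping.keys p. Poly_Mapping.lookup p m * h m)"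

lemma lin_ext_superset:
  assumes "finite K" "Poly_Mapping.keys p \<subseteq> K"
  shows "lin_ext h p = (\<Sum>m\<in>K. Poly_Mapping.lookup p m * h m)"
  unfolding lin_ext_def using assms
  by (intro sum.mono_neutral_left) (auto simp: in_keys_iff)

lemma lin_ext_add: "lin_ext h (p + q) = lin_ext h p + lin_ext h q"
proof -
  let ?K = "Poly_Mapping.keys p \<union> Poly_Mapping.keys q"
  have "Poly_Mapping.keys (p + q) \<subseteq> ?K"
    by (rule Poly_Mapping.keys_add)
  then show ?thesis
    by (simp add: lin_ext_superset[of ?K] lookup_add distrib_right sum.distrib)
qed

lemma lin_ext_zero: "lin_ext h 0 = 0"
  by (simp add: lin_ext_def)

lemma lin_ext_diff: "lin_ext h (p - q) = lin_ext h p - lin_ext h q"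
  using lin_ext_add[of h "p - q" q] by simp

lemma lin_ext_single: "lin_ext h (Poly_Mapping.single m c) = c * h m"
  by (simp add: lin_ext_def)

lemma one_notin_tensor_ideal:
  "(1 :: 'a::complex_algebra_1 mult_monoid \<times> 'b::complex_algebra_1 mult_monoid \<Rightarrow>\<^sub>0 complex)
     \<notin> ideal_generated tensor_relations"
proof
  assume one: "(1 :: 'a mult_monoid \<times> 'b mult_monoid \<Rightarrow>\<^sub>0 complex) \<in> ideal_generated tensor_relations"
  obtain f :: "'a \<Rightarrow> complex" where f: "f 1 = 1"
    "\<And>x y. f (x + y) = f x + f y" "\<And>c x. f (c *\<^sub>C x) = c * f x"
    using ex_normalised_functional by metis
  obtain g :: "'b \<Rightarrow> complex" where g: "g 1 = 1"
    "\<And>x y. g (x + y) = g x + g y" "\<And>c x. g (c *\<^sub>C x) = c * g x"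
    using ex_normalised_functional by metis
  define h where "h = (\<lambda>(x, y). f (unMult x) * g (unMult y))"
  from one have "lin_ext h (1 :: 'a mult_monoid \<times> 'b mult_monoid \<Rightarrow>\<^sub>0 complex) = 0"
  proof (rule ideal_generated_kernel)
    fix a r b :: "'a mult_monoid \<times> 'b mult_monoid \<Rightarrow>\<^sub>0 complex"
    assume r: "r \<in> tensor_relations"
    show "lin_ext h (a * r * b) = 0"
    proof (induction a rule: poly_mapping_induct)
      case (single x c)
      show ?case
      proof (induction b rule: poly_mapping_induct)
        case (single y d)
        show ?case
          using r unfolding tensor_relations_def
          by (cases x; cases y; elim UnE CollectE exE conjE; hypsubst)
             (simp_all add: left_diff_distrib right_diff_distrib mult_single lin_ext_diff
                lin_ext_single h_def plus_mult_monoid_def mult_scaleC_left mult_scaleC_right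
                distrib_left distrib_right f g)
      qed (simp add: distrib_left lin_ext_add)
    qed (simp add: distrib_right lin_ext_add)
  qed (simp_all add: lin_ext_add lin_ext_zero)
  moreover have "lin_ext h (1 :: 'a mult_monoid \<times> 'b mult_monoid \<Rightarrow>\<^sub>0 complex) = 1"
    by (simp add: single_one[symmetric] lin_ext_single h_def zero_prod_def zero_mult_monoid_def
        f g del: single_one)
  ultimately show False by simp
qed

instantiation tensor :: (complex_algebra_1, complex_algebra_1) complex_algebra_1
begin

lift_definition zero_tensor :: "('a, 'b) tensor" is 0 .
lift_definition one_tensor :: "('a, 'b) tensor" is 1 .
lift_definition plus_tensor :: "('a, 'b) tensor \<Rightarrow> ('a, 'b) tensor \<Rightarrow> ('a, 'b) tensor" is "(+)"
  by (rule ideal_generated_cong_add)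
lift_definition uminus_tensor :: "('a, 'b) tensor \<Rightarrow> ('a, 'b) tensor" is uminus
  by (rule ideal_generated_cong_uminus)
lift_definition minus_tensor :: "('a, 'b) tensor \<Rightarrow> ('a, 'b) tensor \<Rightarrow> ('a, 'b) tensor" is "(-)"
  by (rule ideal_generated_cong_diff)
lift_definition times_tensor :: "('a, 'b) tensor \<Rightarrow> ('a, 'b) tensor \<Rightarrow> ('a, 'b) tensor" is "(*)"
  by (rule ideal_generated_cong_mult)
lift_definition scaleC_tensor :: "complex \<Rightarrow> ('a, 'b) tensor \<Rightarrow> ('a, 'b) tensor" is
  "\<lambda>c p. Poly_Mapping.single 0 c * p"
  by (metis ideal_generated_mult_left right_diff_distrib)

instance
proof
  fix a b c :: "('a, 'b) tensor" and k l :: complex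
  show "a + b + c = a + (b + c)"
    by transfer (simp add: add.assoc ideal_generated.zero)
  show "a + b = b + a"
    by transfer (simp add: add.commute ideal_generated.zero)
  show "0 + a = a"
    by transfer (simp add: ideal_generated.zero)
  show "- a + a = 0"
    by transfer (simp add: ideal_generated.zero)
  show "a - b = a + - b"
    by transfer (simp add: ideal_generated.zero)
  show "a * b * c = a * (b * c)"
    by transfer (simp add: mult.assoc ideal_generated.zero)
  show "1 * a = a"
    by transfer (simp add: ideal_generated.zero)
  show "a * 1 = a"
    by transfer (simp add: ideal_generated.zero)
  show "(a + b) * c = a * c + b * c"
    by transfer (simp add: distrib_right ideal_generated.zero)
  show "a * (b + c) = a * b + a * c"
    by transfer (simp add: distrib_left ideal_generated.zero)
  show "(0 :: ('a, 'b) tensor) \<noteq> 1"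
    by transfer (use one_notin_tensor_ideal ideal_generated_uminus in fastforce)
  show "k *\<^sub>C (a + b) = k *\<^sub>C a + k *\<^sub>C b"
    by transfer (simp add: distrib_left ideal_generated.zero)
  show "(k + l) *\<^sub>C a = k *\<^sub>C a + l *\<^sub>C a"
    by transfer (simp add: single_add distrib_right ideal_generated.zero)
  show "k *\<^sub>C l *\<^sub>C a = (k * l) *\<^sub>C a"
    by transfer (simp add: mult.assoc[symmetric] mult_single ideal_generated.zero)
  show "1 *\<^sub>C a = a"
    by transfer (simp add: ideal_generated.zero)
  show "(k *\<^sub>C a) * b = k *\<^sub>C (a * b)"
    by transfer (simp add: mult.assoc ideal_generated.zero)
  show "a * (k *\<^sub>C b) = k *\<^sub>C (a * b)"
    by transfer
       (simp add: single_zero_left_commute ideal_generated.zero)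
qed

end

lift_definition tens ::
  "'a::complex_algebra_1 \<Rightarrow> 'b::complex_algebra_1 \<Rightarrow> ('a, 'b) tensor"  (infixl \<open>\<otimes>\<close> 72)
  is "\<lambda>a b. pure a b 1" .

text \<open>
  The linear map induced by a bilinear map \<open>B\<close>.  A sum \<open>B f\<^sup>\<alpha> f\<^sub>\<alpha>\<close> over the legs of a tensor
  \<open>t = f\<^sup>\<alpha> \<otimes> f\<^sub>\<alpha>\<close> is rendered as \<open>tensor_lift B t\<close>.
\<close>

definition tensor_lift ::
  "('a::complex_algebra_1 \<Rightarrow> 'b::complex_algebra_1 \<Rightarrow> 'c::complex_space) \<Rightarrow> ('a, 'b) tensor \<Rightarrow> 'c" where
  "tensor_lift B = (THE g. complex_linear g \<and> (\<forall>a b. g (a \<otimes> b) = B a b))"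


section \<open>The classical Hopf structure of the enveloping algebra\<close>

definition coproduct :: "'x::complex_lie_algebra uea \<Rightarrow> ('x uea, 'x uea) tensor" where
  "coproduct = (THE D. complex_linear D \<and> D 1 = 1 \<and> (\<forall>a b. D (a * b) = D a * D b)
     \<and> (\<forall>u. D (gen u) = gen u \<otimes> 1 + 1 \<otimes> gen u))"

definition antipode :: "'x::complex_lie_algebra uea \<Rightarrow> 'x uea" where
  "antipode = (THE S. complex_linear S \<and> S 1 = 1 \<and> (\<forall>a b. S (a * b) = S b * S a)
     \<and> (\<forall>u. S (gen u) = - gen u))"

text \<open>The adjoint action \<open>\<xi>(x) = \<xi>\<^sub>1 x S(\<xi>\<^sub>2)\<close>; for \<open>V\<close> in the Lie algebra, \<open>V(x) = V x - x V\<close>.\<close>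

definition adj :: "'x::complex_lie_algebra uea \<Rightarrow> 'x uea \<Rightarrow> 'x uea" where
  "adj \<xi> x = tensor_lift (\<lambda>a b. a * x * antipode b) (coproduct \<xi>)"


section \<open>Formal power series in the deformation parameter\<close>

text \<open>
  The type \<^typ>\<open>'a fps\<close> is the module of formal power series in \<open>\<lambda>\<close> with coefficients in \<^typ>\<open>'a\<close>;
  tensor products over the scalar ring \<^typ>\<open>complex fps\<close> are completed, i.e. series of tensors.
\<close>

instantiation fps :: (complex_space) complex_space
begin
definition scaleC_fps :: "complex \<Rightarrow> 'a fps \<Rightarrow> 'a fps" where
  "c *\<^sub>C f = Abs_fps (\<lambda>n. c *\<^sub>C fps_nth f n)"
instance
  by standard (simp_all add: scaleC_fps_def fps_eq_iff scaleC_add_right scaleC_add_left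
      scaleC_scaleC scaleC_one)
end

definition fps_scale :: "complex fps \<Rightarrow> 'a::complex_space fps \<Rightarrow> 'a fps"  (infixr \<open>\<bullet>\<^sub>\<lambda>\<close> 75) where
  "c \<bullet>\<^sub>\<lambda> f = Abs_fps (\<lambda>n. \<Sum>i\<le>n. fps_nth c i *\<^sub>C fps_nth f (n - i))"

definition lambda_linear :: "('a::complex_space fps \<Rightarrow> 'b::complex_space fps) \<Rightarrow> bool" where
  "lambda_linear f \<longleftrightarrow> (\<forall>x y. f (x + y) = f x + f y) \<and> (\<forall>c x. f (c \<bullet>\<^sub>\<lambda> x) = c \<bullet>\<^sub>\<lambda> f x)"

definition fps_map :: "('a \<Rightarrow> 'b) \<Rightarrow> 'a fps \<Rightarrow> 'b fps" where
  "fps_map \<phi> f = Abs_fps (\<lambda>n. \<phi> (fps_nth f n))"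

text \<open>\<open>fps_ext \<phi> (\<Sum>n. \<lambda>\<^sup>n a\<^sub>n) = (\<Sum>n. \<lambda>\<^sup>n \<phi> a\<^sub>n)\<close> for \<open>\<phi>\<close> with values in power series.\<close>

definition fps_ext :: "('a \<Rightarrow> 'b::comm_monoid_add fps) \<Rightarrow> 'a fps \<Rightarrow> 'b fps" where
  "fps_ext \<phi> f = Abs_fps (\<lambda>k. \<Sum>n\<le>k. fps_nth (\<phi> (fps_nth f n)) (k - n))"

definition fps_tens ::
  "'a::complex_algebra_1 fps \<Rightarrow> 'b::complex_algebra_1 fps \<Rightarrow> ('a, 'b) tensor fps"
  (infixl \<open>\<otimes>\<^sub>\<lambda>\<close> 72) where
  "f \<otimes>\<^sub>\<lambda> g = Abs_fps (\<lambda>n. \<Sum>i\<le>n. fps_nth f i \<otimes> fps_nth g (n - i))"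

definition ring_inverse :: "'r::ring_1 \<Rightarrow> 'r" where
  "ring_inverse x = (THE y. x * y = 1 \<and> y * x = 1)"


section \<open>The twist and the deformed Hopf algebra\<close>

type_synonym 'x twist = "('x uea, 'x uea) tensor fps"

definition twist :: "'x::complex_lie_algebra \<Rightarrow> 'x \<Rightarrow> 'x twist" where
  "twist V1 V2 = Abs_fps (\<lambda>n. ((- \<i> / 2) ^ n / fact n) *\<^sub>C (gen V1 \<otimes> gen V2 - gen V2 \<otimes> gen V1) ^ n)"

definition flip :: "('a::complex_algebra_1, 'b::complex_algebra_1) tensor \<Rightarrow> ('b, 'a) tensor" where
  "flip = tensor_lift (\<lambda>a b. b \<otimes> a)"

definition R_matrix :: "'x::complex_lie_algebra twist \<Rightarrow> 'x twist" where
  "R_matrix F = fps_map flip F * ring_inverse F"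

definition chi :: "'x::complex_lie_algebra twist \<Rightarrow> 'x uea fps" where
  "chi F = fps_map (tensor_lift (\<lambda>a b. a * antipode b)) F"

definition X_map :: "'x::complex_lie_algebra twist \<Rightarrow> 'x uea fps \<Rightarrow> 'x uea fps" where
  "X_map F \<xi> = fps_ext (tensor_lift (\<lambda>a b.
     fps_const a * \<xi> * chi F * fps_const (inv antipode b))) (ring_inverse F)"

definition star :: "'x::complex_lie_algebra twist \<Rightarrow> 'x uea fps \<Rightarrow> 'x uea fps \<Rightarrow> 'x uea fps" where
  "star F \<xi> \<eta> = fps_ext (tensor_lift (\<lambda>a b. fps_map (adj a) \<xi> * fps_map (adj b) \<eta>)) (ring_inverse F)"

text \<open>The product \<open>(a \<otimes> b) \<star> (c \<otimes> d) = (a \<star> c) \<otimes> (b \<star> d)\<close>.\<close>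

definition tensor_star :: "'x::complex_lie_algebra twist \<Rightarrow>
    ('x uea, 'x uea) tensor fps \<Rightarrow> ('x uea, 'x uea) tensor fps \<Rightarrow> ('x uea, 'x uea) tensor fps" where
  "tensor_star F s t = fps_ext (\<lambda>s'. fps_ext (\<lambda>t'.
     tensor_lift (\<lambda>a b. tensor_lift (\<lambda>c d.
       star F (fps_const a) (fps_const c) \<otimes>\<^sub>\<lambda> star F (fps_const b) (fps_const d)) t') s') t) s"

text \<open>
  The structure maps are the unique \<open>\<lambda>\<close>-linear (hence \<open>\<lambda>\<close>-adically continuous) extensions of the
  values prescribed on the Lie algebra.
\<close>

definition star_coproduct ::
  "'x::complex_lie_algebra twist \<Rightarrow> 'x uea fps \<Rightarrow> ('x uea, 'x uea) tensor fps" where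
  "star_coproduct F = (THE D. lambda_linear D \<and> D 1 = 1
     \<and> (\<forall>a b. D (star F a b) = tensor_star F (D a) (D b))
     \<and> (\<forall>u. D (fps_const (gen u)) = fps_const (gen u) \<otimes>\<^sub>\<lambda> 1
          + fps_ext (tensor_lift (\<lambda>a b. X_map F (fps_const a) \<otimes>\<^sub>\<lambda> fps_const (adj b (gen u))))
              (ring_inverse (R_matrix F))))"

definition star_counit :: "'x::complex_lie_algebra twist \<Rightarrow> 'x uea fps \<Rightarrow> complex fps" where
  "star_counit F = (THE e. (\<forall>a b. e (a + b) = e a + e b) \<and> (\<forall>c a. e (c \<bullet>\<^sub>\<lambda> a) = c * e a)
     \<and> e 1 = 1 \<and> (\<forall>a b. e (star F a b) = e a * e b) \<and> (\<forall>u. e (fps_const (gen u)) = 0))"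

definition star_antipode :: "'x::complex_lie_algebra twist \<Rightarrow> 'x uea fps \<Rightarrow> 'x uea fps" where
  "star_antipode F = (THE S. lambda_linear S \<and> bij S \<and> S 1 = 1
     \<and> (\<forall>a b. S (star F a b) = star F (S b) (S a))
     \<and> (\<forall>u. inv S (fps_const (gen u)) =
          - fps_ext (tensor_lift (\<lambda>a b. star F (fps_const (adj a (gen u))) (X_map F (fps_const b))))
              (ring_inverse (R_matrix F))))"

inductive_set star_subalgebra_generated ::
  "'x::complex_lie_algebra twist \<Rightarrow> 'x uea fps set \<Rightarrow> 'x uea fps set" for F G where
  one: "1 \<in> star_subalgebra_generated F G"
| gen: "a \<in> G \<Longrightarrow> a \<in> star_subalgebra_generated F G"
| add: "a \<in> star_subalgebra_generated F G \<Longrightarrow> b \<in> star_subalgebra_generated F G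
    \<Longrightarrow> a + b \<in> star_subalgebra_generated F G"
| scale: "a \<in> star_subalgebra_generated F G \<Longrightarrow> c \<bullet>\<^sub>\<lambda> a \<in> star_subalgebra_generated F G"
| star: "a \<in> star_subalgebra_generated F G \<Longrightarrow> b \<in> star_subalgebra_generated F G
    \<Longrightarrow> star F a b \<in> star_subalgebra_generated F G"

definition enveloping_star :: "'x::complex_lie_algebra twist \<Rightarrow> 'x set \<Rightarrow> 'x uea fps set" where
  "enveloping_star F \<gg> = star_subalgebra_generated F ((\<lambda>u. fps_const (gen u)) ` \<gg>)"

text \<open>The image of \<open>A \<otimes> A\<close>, i.e. finite sums of \<open>a \<otimes> b\<close>, without completion.\<close>

inductive_set tensor_square ::
  "'a::complex_algebra_1 fps set \<Rightarrow> ('a, 'a) tensor fps set" for A where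
  zero: "0 \<in> tensor_square A"
| step: "a \<in> A \<Longrightarrow> b \<in> A \<Longrightarrow> t \<in> tensor_square A \<Longrightarrow> c \<bullet>\<^sub>\<lambda> (a \<otimes>\<^sub>\<lambda> b) + t \<in> tensor_square A"

definition star_subalgebra :: "'x::complex_lie_algebra twist \<Rightarrow> 'x uea fps set \<Rightarrow> bool" where
  "star_subalgebra F A \<longleftrightarrow> 1 \<in> A \<and> (\<forall>a\<in>A. \<forall>b\<in>A. a + b \<in> A) \<and> (\<forall>c. \<forall>a\<in>A. c \<bullet>\<^sub>\<lambda> a \<in> A)
     \<and> (\<forall>a\<in>A. \<forall>b\<in>A. star F a b \<in> A)"

definition star_hopf_subalgebra :: "'x::complex_lie_algebra twist \<Rightarrow> 'x uea fps set \<Rightarrow> bool" where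
  "star_hopf_subalgebra F A \<longleftrightarrow> star_subalgebra F A
     \<and> star_coproduct F ` A \<subseteq> tensor_square A \<and> star_antipode F ` A \<subseteq> A"

definition tensor_assoc ::
  "(('a::complex_algebra_1, 'b::complex_algebra_1) tensor, 'c::complex_algebra_1) tensor
    \<Rightarrow> ('a, ('b, 'c) tensor) tensor" where
  "tensor_assoc = tensor_lift (\<lambda>s c. tensor_lift (\<lambda>a b. a \<otimes> (b \<otimes> c)) s)"

text \<open>
  The Hopf algebra axioms for \<open>(A, \<star>, \<Delta>\<^sub>\<star>, S\<^sub>\<star>, \<epsilon>\<^sub>\<star>)\<close>: algebra, closure under the structure maps,
  multiplicativity of coproduct and counit, coassociativity, counit and antipode laws.
\<close>

definition star_hopf_algebra :: "'x::complex_lie_algebra twist \<Rightarrow> 'x uea fps set \<Rightarrow> bool" where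
  "star_hopf_algebra F A \<longleftrightarrow>
     star_hopf_subalgebra F A
   \<and> (\<forall>a\<in>A. \<forall>b\<in>A. \<forall>c\<in>A. star F (star F a b) c = star F a (star F b c))
   \<and> (\<forall>a\<in>A. star F 1 a = a \<and> star F a 1 = a)
   \<and> star_coproduct F 1 = 1
   \<and> (\<forall>a\<in>A. \<forall>b\<in>A. star_coproduct F (star F a b)
        = tensor_star F (star_coproduct F a) (star_coproduct F b))
   \<and> star_counit F 1 = 1
   \<and> (\<forall>a\<in>A. \<forall>b\<in>A. star_counit F (star F a b) = star_counit F a * star_counit F b)
   \<and> (\<forall>a\<in>A. fps_map tensor_assoc
          (fps_ext (tensor_lift (\<lambda>x y. star_coproduct F (fps_const x) \<otimes>\<^sub>\<lambda> fps_const y))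
             (star_coproduct F a))
        = fps_ext (tensor_lift (\<lambda>x y. fps_const x \<otimes>\<^sub>\<lambda> star_coproduct F (fps_const y)))
             (star_coproduct F a))
   \<and> (\<forall>a\<in>A. fps_ext (tensor_lift (\<lambda>x y. star_counit F (fps_const x) \<bullet>\<^sub>\<lambda> fps_const y))
               (star_coproduct F a) = a)
   \<and> (\<forall>a\<in>A. fps_ext (tensor_lift (\<lambda>x y. star_counit F (fps_const y) \<bullet>\<^sub>\<lambda> fps_const x))
               (star_coproduct F a) = a)
   \<and> (\<forall>a\<in>A. fps_ext (tensor_lift (\<lambda>x y. star F (star_antipode F (fps_const x)) (fps_const y)))
               (star_coproduct F a) = star_counit F a \<bullet>\<^sub>\<lambda> 1)
   \<and> (\<forall>a\<in>A. fps_ext (tensor_lift (\<lambda>x y. star F (fps_const x) (star_antipode F (fps_const y))))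
               (star_coproduct F a) = star_counit F a \<bullet>\<^sub>\<lambda> 1)"

text \<open>
  The symmetries leave the deformation invariant: they annihilate the vector fields that generate
  the twist, and the twist itself, \<open>\<Delta>(u) F = F \<Delta>(u)\<close>.
\<close>

definition invariant_deformation ::
  "'x::complex_lie_algebra \<Rightarrow> 'x \<Rightarrow> 'x set \<Rightarrow> bool" where
  "invariant_deformation V1 V2 \<gg> \<longleftrightarrow> (\<forall>u\<in>\<gg>. lie u V1 = 0 \<and> lie u V2 = 0
     \<and> fps_const (coproduct (gen u)) * twist V1 V2 = twist V1 V2 * fps_const (coproduct (gen u)))"


section \<open>Vector fields on the spacetime manifold\<close>

text \<open>
  Coordinates \<open>(t, x\<^sup>1, x\<^sup>2, x\<^sup>3)\<close> are indexed by \<open>0, 1, 2, 3 :: 4\<close>; vector fields are given by their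
  components, with complex values because the twist contains the imaginary unit.
\<close>

type_synonym vector_field = "real ^ 4 \<Rightarrow> complex ^ 4"

definition radius :: "real ^ 4 \<Rightarrow> real" where
  "radius p = sqrt (\<Sum>i\<in>{1, 2, 3}. (p $ i)\<^sup>2)"

definition partial :: "4 \<Rightarrow> (real ^ 4 \<Rightarrow> complex) \<Rightarrow> real ^ 4 \<Rightarrow> complex" where
  "partial i h p = frechet_derivative h (at p) (axis i 1)"

text \<open>On an open set: all iterated partial derivatives exist and are differentiable.\<close>

definition smooth_on :: "(real ^ 4) set \<Rightarrow> (real ^ 4 \<Rightarrow> complex) \<Rightarrow> bool" where
  "smooth_on M h \<longleftrightarrow> (\<forall>is. foldr partial is h differentiable_on M)"

text \<open>Vector fields on \<open>M\<close> are extended by \<open>0\<close>, so that equality on \<open>M\<close> is equality.\<close>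

definition on_region :: "(real ^ 4) set \<Rightarrow> vector_field \<Rightarrow> vector_field" where
  "on_region M X = (\<lambda>p. if p \<in> M then X p else 0)"

definition vector_fields :: "(real ^ 4) set \<Rightarrow> vector_field set" where
  "vector_fields M = {X. (\<forall>k. smooth_on M (\<lambda>p. X p $ k)) \<and> (\<forall>p. p \<notin> M \<longrightarrow> X p = 0)}"

definition vf_bracket :: "(real ^ 4) set \<Rightarrow> vector_field \<Rightarrow> vector_field \<Rightarrow> vector_field" where
  "vf_bracket M X Y = on_region M (\<lambda>p. \<chi> k. \<Sum>j\<in>UNIV.
     X p $ j * partial j (\<lambda>q. Y q $ k) p - Y p $ j * partial j (\<lambda>q. X q $ k) p)"

text \<open>
  A type cannot depend on the region \<open>M\<close>.  So the Lie algebra of vector fields on \<open>M\<close> is presented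
  by an abstract Lie algebra type with an isomorphism \<open>vf\<close> onto the vector fields on \<open>M\<close>.
\<close>

definition vector_field_isomorphism ::
  "(real ^ 4) set \<Rightarrow> ('x::complex_lie_algebra \<Rightarrow> vector_field) \<Rightarrow> bool" where
  "vector_field_isomorphism M vf \<longleftrightarrow> bij_betw vf UNIV (vector_fields M)
     \<and> (\<forall>u v. vf (u + v) = (\<lambda>p. vf u p + vf v p))
     \<and> (\<forall>c u. vf (c *\<^sub>C u) = (\<lambda>p. c *s vf u p))
     \<and> (\<forall>u v. vf (lie u v) = vf_bracket M (vf u) (vf v))"

definition coord_field :: "4 \<Rightarrow> vector_field"  (\<open>\<partial>\<close>) where
  "coord_field i = (\<lambda>p. axis i 1)"

definition levi_civita :: "4 \<Rightarrow> 4 \<Rightarrow> 4 \<Rightarrow> real" where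
  "levi_civita i j k =
     (if (i, j, k) \<in> {(1, 2, 3), (2, 3, 1), (3, 1, 2)} then 1
      else if (i, j, k) \<in> {(1, 3, 2), (3, 2, 1), (2, 1, 3)} then - 1 else 0)"

definition rotation_field :: "4 \<Rightarrow> vector_field" where
  "rotation_field i = (\<lambda>p. \<Sum>j\<in>{1, 2, 3}. \<Sum>k\<in>{1, 2, 3}.
     of_real (levi_civita i j k * p $ j) *s coord_field k p)"

end

theory Submission
  imports Defs
begin

text \<open>
  As \<open>V\<^sub>1\<close> and \<open>V\<^sub>2\<close> commute, \<open>\<F>\<close> is the exponential of a single element and every map built from it
  is the exponential of a linear operator, composed of multiplications by \<open>V\<^sub>1\<close> and \<open>V\<^sub>2\<close> on either
  side.  All these operators commute, so identities between the structure maps reduce to identities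
  between exponents.

  The map \<open>D = exp (\<i>\<lambda>/2 \<delta>)\<close>, \<open>\<delta> \<xi> = V\<^sub>1 \<xi> V\<^sub>2 - V\<^sub>2 \<xi> V\<^sub>1\<close>, is an isomorphism from the star algebra to
  the undeformed one, with inverse \<open>\<xi> \<mapsto> X\<^sub>\<xi>\<close>.  Transporting the twisted Hopf structure
  \<open>\<F> \<Delta> \<F>\<^sup>-\<^sup>1\<close>, \<open>S\<close>, \<open>\<epsilon>\<close> along \<open>D\<close> gives maps with the prescribed values on generators.  They are the
  only ones: a star product with a generator is the ordinary product modulo \<open>\<lambda>\<close>, so words of
  generators determine a \<open>\<lambda>\<close>-linear map to every order in \<open>\<lambda>\<close>.

  The symmetries commute with \<open>V\<^sub>1\<close> and \<open>V\<^sub>2\<close>, so all exponents vanish on what they generate, and there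
  the deformed structure is the classical one.
\<close>

section \<open>Linear maps and universal properties\<close>

text \<open>The structure maps are fixed by \<open>THE\<close> on all of U\<Xi>, even when they are
  evaluated only on the symmetries. That everything is classical on \<gg> therefore does not settle
  the theorem: existence and uniqueness have to be established for arbitrary vector fields, and this
  is what the closed forms \<open>cop\<close> and \<open>ant\<close> are for.

  The operator \<delta> comes from \<open>X_map\<close>. Commutativity of V1 and V2 gives \<chi> =
  1, so X_\<xi> is \<xi> sandwiched between the legs of the inverse twist, and the antipode on the
  second leg reverses the sign of the exponent. For the same reason the twisted antipode \<chi> S
  \<chi>^-1 is S itself, whereas the coproduct really is conjugated.

  On the analytic side the obstacle is that \<open>c2\<close> and \<open>f2\<close> are bare
  functions: differentiability is known only for the components of the field V2. The brackets are
  therefore computed by differentiating along integral curves of the symmetries, on which the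
  radius, and with it \<open>c2\<close> and \<open>f2\<close>, is constant; these functions are
  never differentiated.\<close>

lemma complex_linearI:
  assumes "\<And>x y. f (x + y) = f x + f y" "\<And>c x. f (c *\<^sub>C x) = c *\<^sub>C f x"
  shows "complex_linear f"
  using assms by (simp add: complex_linear_def)

lemma complex_linear_add: "complex_linear f \<Longrightarrow> f (x + y) = f x + f y"
  and complex_linear_scale: "complex_linear f \<Longrightarrow> f (c *\<^sub>C x) = c *\<^sub>C f x"
  by (simp_all add: complex_linear_def)

lemma complex_linear_zero: "complex_linear f \<Longrightarrow> f 0 = 0"
  using complex_linear_scale[of f 0 0] by simp

lemma complex_linear_minus: "complex_linear f \<Longrightarrow> f (- x) = - f x"
  using complex_linear_scale[of f "- 1" x] by simp

lemma complex_linear_diff: "complex_linear f \<Longrightarrow> f (x - y) = f x - f y"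
  using complex_linear_add[of f x "- y"] by (simp add: complex_linear_minus)

lemma complex_linear_sum: "complex_linear f \<Longrightarrow> f (\<Sum>i\<in>I. g i) = (\<Sum>i\<in>I. f (g i))"
  by (induction I rule: infinite_finite_induct)
     (simp_all add: complex_linear_zero complex_linear_add)

lemmas complex_linear_simps =
  complex_linear_add complex_linear_scale complex_linear_zero complex_linear_minus
  complex_linear_diff complex_linear_sum

lemma complex_linear_id: "complex_linear (\<lambda>x. x)"
  and complex_linear_0: "complex_linear (\<lambda>x. 0)"
  and complex_linear_compose: "complex_linear f \<Longrightarrow> complex_linear g \<Longrightarrow> complex_linear (\<lambda>x. f (g x))"
  and complex_linear_plus: "complex_linear g \<Longrightarrow> complex_linear h \<Longrightarrow> complex_linear (\<lambda>x. g x + h x)"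
  and complex_linear_uminus: "complex_linear g \<Longrightarrow> complex_linear (\<lambda>x. - g x)"
  and complex_linear_minus_fun: "complex_linear g \<Longrightarrow> complex_linear h \<Longrightarrow> complex_linear (\<lambda>x. g x - h x)"
  and complex_linear_scaleC: "complex_linear g \<Longrightarrow> complex_linear (\<lambda>x. c *\<^sub>C g x)"
  by (simp_all add: complex_linear_def scaleC_add_right scaleC_scaleC mult.commute
      complex_space.scale_right_diff_distrib)

lemma complex_linear_mult_left: "complex_linear g \<Longrightarrow> complex_linear (\<lambda>x. a * g x)"
  and complex_linear_mult_right: "complex_linear g \<Longrightarrow> complex_linear (\<lambda>x. g x * a)"
  for a :: "'a::complex_algebra_1"
  by (simp_all add: complex_linear_def distrib_left distrib_right mult_scaleC_left mult_scaleC_right)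

lemmas complex_linear_intros =
  complex_linear_id complex_linear_0 complex_linear_plus complex_linear_uminus
  complex_linear_minus_fun complex_linear_scaleC complex_linear_mult_left complex_linear_mult_right

section \<open>Bilinear maps and linear extension from a free vector space\<close>

definition complex_bilinear ::
  "('a::complex_space \<Rightarrow> 'b::complex_space \<Rightarrow> 'c::complex_space) \<Rightarrow> bool" where
  "complex_bilinear B \<longleftrightarrow> (\<forall>b. complex_linear (\<lambda>a. B a b)) \<and> (\<forall>a. complex_linear (B a))"

lemma complex_bilinearI:
  assumes "\<And>b. complex_linear (\<lambda>a. B a b)" "\<And>a. complex_linear (\<lambda>b. B a b)"
  shows "complex_bilinear B"
  using assms by (simp add: complex_bilinear_def)

lemma complex_bilinear_left: "complex_bilinear B \<Longrightarrow> complex_linear (\<lambda>a. B a b)"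
  and complex_bilinear_right: "complex_bilinear B \<Longrightarrow> complex_linear (\<lambda>b. B a b)"
  by (simp_all add: complex_bilinear_def)

lemma complex_bilinear_compose:
  "complex_linear g \<Longrightarrow> complex_bilinear B \<Longrightarrow> complex_bilinear (\<lambda>a b. g (B a b))"
  by (auto simp: complex_bilinear_def intro: complex_linear_compose)

text \<open>The linear extension of \<open>h\<close> from a basis, as \<open>lin_ext\<close> but
  with values in any complex space. It is the step common to the universal properties of the tensor
  product and of the enveloping algebra.\<close>

definition free_lift :: "('m \<Rightarrow> 'b::complex_space) \<Rightarrow> ('m \<Rightarrow>\<^sub>0 complex) \<Rightarrow> 'b" where
  "free_lift h p = (\<Sum>m\<in>Poly_Mapping.keys p. Poly_Mapping.lookup p m *\<^sub>C h m)"

lemma free_lift_superset: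
  assumes "finite K" "Poly_Mapping.keys p \<subseteq> K"
  shows "free_lift h p = (\<Sum>m\<in>K. Poly_Mapping.lookup p m *\<^sub>C h m)"
  unfolding free_lift_def using assms
  by (intro sum.mono_neutral_left) (auto simp: in_keys_iff)

lemma free_lift_add: "free_lift h (p + q) = free_lift h p + free_lift h q"
proof -
  let ?K = "Poly_Mapping.keys p \<union> Poly_Mapping.keys q"
  have "Poly_Mapping.keys (p + q) \<subseteq> ?K"
    by (rule Poly_Mapping.keys_add)
  then show ?thesis
    by (simp add: free_lift_superset[of ?K] lookup_add scaleC_add_left sum.distrib)
qed

lemma free_lift_zero: "free_lift h 0 = 0"
  by (simp add: free_lift_def)

lemma free_lift_diff: "free_lift h (p - q) = free_lift h p - free_lift h q"
  using free_lift_add[of h "p - q" q] by simp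

lemma free_lift_single: "free_lift h (Poly_Mapping.single m c) = c *\<^sub>C h m"
  by (simp add: free_lift_def)

subsection \<open>Tensor products\<close>

lemma tensor_relations_abs_eq:
  assumes "p - q \<in> tensor_relations"
  shows "abs_tensor p = abs_tensor q"
  using ideal_generated.step[OF assms ideal_generated.zero, of 1 1] by (simp add: tensor.abs_eq_iff)

lemma scaleC_tens: "c *\<^sub>C (a \<otimes> b) = (c *\<^sub>C a) \<otimes> b"
  and tens_scaleC_right: "a \<otimes> (c *\<^sub>C b) = (c *\<^sub>C a) \<otimes> b"
proof -
  have c: "c *\<^sub>C (a \<otimes> b) = abs_tensor (pure a b c)"
    by (simp add: tens.abs_eq scaleC_tensor.abs_eq mult_single zero_prod_def zero_mult_monoid_def
        plus_mult_monoid_def)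
  have "abs_tensor (pure (c *\<^sub>C a) b 1) = abs_tensor (pure a b c)"
    by (rule tensor_relations_abs_eq) (unfold tensor_relations_def, blast)
  then show 1: "c *\<^sub>C (a \<otimes> b) = (c *\<^sub>C a) \<otimes> b" unfolding c by (simp only: tens.abs_eq)
  have "abs_tensor (pure a (c *\<^sub>C b) 1) = abs_tensor (pure a b c)"
    by (rule tensor_relations_abs_eq) (unfold tensor_relations_def, blast)
  then show "a \<otimes> (c *\<^sub>C b) = (c *\<^sub>C a) \<otimes> b" unfolding 1[symmetric] c by (simp only: tens.abs_eq)
qed

lemma tens_add_left: "(a + a') \<otimes> b = a \<otimes> b + a' \<otimes> b"
  and tens_add_right: "a \<otimes> (b + b') = a \<otimes> b + a \<otimes> b'"
proof -
  have "abs_tensor (pure (a + a') b 1) = abs_tensor (pure a b 1 + pure a' b 1)"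
    by (rule tensor_relations_abs_eq) (unfold tensor_relations_def diff_diff_add[symmetric], blast)
  then show "(a + a') \<otimes> b = a \<otimes> b + a' \<otimes> b" by (simp only: tens.abs_eq plus_tensor.abs_eq)
  have "abs_tensor (pure a (b + b') 1) = abs_tensor (pure a b 1 + pure a b' 1)"
    by (rule tensor_relations_abs_eq) (unfold tensor_relations_def diff_diff_add[symmetric], blast)
  then show "a \<otimes> (b + b') = a \<otimes> b + a \<otimes> b'" by (simp only: tens.abs_eq plus_tensor.abs_eq)
qed

lemma complex_bilinear_tens: "complex_bilinear (\<otimes>)"
  by (intro complex_bilinearI complex_linearI)
     (simp_all add: tens_add_left tens_add_right scaleC_tens tens_scaleC_right)

lemma tens_mult: "(a \<otimes> b) * (c \<otimes> d) = (a * c) \<otimes> (b * d)"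
  by transfer (simp add: mult_single plus_mult_monoid_def ideal_generated.zero)

lemma one_tensor: "1 \<otimes> 1 = 1"
  by transfer (simp add: zero_prod_def[symmetric] zero_mult_monoid_def[symmetric] ideal_generated.zero)

lemma tensor_induct [case_names tens add]:
  assumes tens: "\<And>a b. P (a \<otimes> b)" and add: "\<And>s t. P s \<Longrightarrow> P t \<Longrightarrow> P (s + t)"
  shows "P t"
proof -
  have "P (abs_tensor p)" for p
  proof (induction p rule: poly_mapping_induct)
    case (single k c)
    have "abs_tensor (Poly_Mapping.single k c) = (c *\<^sub>C unMult (fst k)) \<otimes> unMult (snd k)"
      unfolding scaleC_tens[symmetric]
      by (cases k; cases "fst k"; cases "snd k")
        (auto simp: tens.abs_eq scaleC_tensor.abs_eq mult_single zero_prod_def zero_mult_monoid_def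
          plus_mult_monoid_def)
    then show ?case by (simp add: tens)
  next
    case (sum p q)
    then show ?case using add by (simp add: plus_tensor.abs_eq[symmetric])
  qed
  then show ?thesis by (induction t rule: tensor.abs_induct) auto
qed

lemma tensor_linear_eqI:
  assumes "complex_linear f" "complex_linear g" "\<And>a b. f (a \<otimes> b) = g (a \<otimes> b)"
  shows "f t = g t"
  by (induction t rule: tensor_induct) (simp_all add: assms complex_linear_add)

text \<open>The linear extension of \<open>B\<close> to the free space on pairs kills the whole
  ideal: a bilinearity relation multiplied by pairs on both sides is, up to a scalar, again a
  bilinearity relation, because multiplication in each leg is linear.\<close>

lemma ex_tensor_lift:
  assumes "complex_bilinear B"
  shows "\<exists>g. complex_linear g \<and> (\<forall>a b. g (a \<otimes> b) = B a b)"
proof -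
  note B = complex_linear_simps[OF complex_bilinear_left[OF assms]]
    complex_linear_simps[OF complex_bilinear_right[OF assms]]
  define h where "h = (\<lambda>(x, y). B (unMult x) (unMult y))"
  have ker: "free_lift h p = 0" if "p \<in> ideal_generated tensor_relations" for p
    using that
  proof (rule ideal_generated_kernel)
    fix a r b :: "'a mult_monoid \<times> 'b mult_monoid \<Rightarrow>\<^sub>0 complex"
    assume r: "r \<in> tensor_relations"
    show "free_lift h (a * r * b) = 0"
    proof (induction a rule: poly_mapping_induct)
      case (single x c)
      show ?case
      proof (induction b rule: poly_mapping_induct)
        case (single y d)
        show ?case
          using r unfolding tensor_relations_def
          by (cases x; cases y; elim UnE CollectE exE conjE; hypsubst)
             (simp_all add: left_diff_distrib right_diff_distrib mult_single free_lift_diff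
                free_lift_single h_def plus_mult_monoid_def mult_scaleC_left mult_scaleC_right
                distrib_left distrib_right B scaleC_scaleC mult.commute
                complex_space.scale_right_diff_distrib scaleC_add_right)
      qed (simp add: distrib_left free_lift_add)
    qed (simp add: distrib_right free_lift_add)
  qed (simp_all add: free_lift_add free_lift_zero)
  define g where "g t = free_lift h (rep_tensor t)" for t
  have g_abs: "g (abs_tensor p) = free_lift h p" for p
  proof -
    have "rep_tensor (abs_tensor p) - p \<in> ideal_generated tensor_relations"
      using Quotient3_abs_rep[OF Quotient3_tensor, of "abs_tensor p"] by (simp only: tensor.abs_eq_iff)
    from ker[OF this] show ?thesis by (simp add: g_def free_lift_diff)
  qed
  have "g (s + t) = g s + g t" for s t
    by (induction s rule: tensor.abs_induct; induction t rule: tensor.abs_induct)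
       (simp add: plus_tensor.abs_eq g_abs free_lift_add)
  moreover have "g (a \<otimes> b) = B a b" for a b
    by (simp add: tens.abs_eq g_abs free_lift_single h_def scaleC_one)
  moreover have "g (c *\<^sub>C t) = c *\<^sub>C g t" for c t
    by (induction t rule: tensor_induct)
       (simp_all add: scaleC_tens calculation B scaleC_add_right)
  ultimately show ?thesis by (auto simp: complex_linear_def)
qed

lemma
  assumes "complex_bilinear B"
  shows complex_linear_tensor_lift: "complex_linear (tensor_lift B)"
    and tensor_lift_tens: "tensor_lift B (a \<otimes> b) = B a b"
proof -
  have "\<exists>!g. complex_linear g \<and> (\<forall>a b. g (a \<otimes> b) = B a b)"
  proof (rule ex_ex1I)
    show "g = g'" if "complex_linear g \<and> (\<forall>a b. g (a \<otimes> b) = B a b)"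
      "complex_linear g' \<and> (\<forall>a b. g' (a \<otimes> b) = B a b)" for g g'
      by (rule ext, rule tensor_linear_eqI) (use that in auto)
  qed (rule ex_tensor_lift[OF assms])
  from theI'[OF this] show "complex_linear (tensor_lift B)" "tensor_lift B (a \<otimes> b) = B a b"
    by (simp_all add: tensor_lift_def)
qed

text \<open>Bilinearity of \<open>B\<close> is inherited from \<open>g\<close>. A contraction with a
  complicated integrand is thus evaluated by proposing a linear map and checking it on pure
  tensors.\<close>

lemma tensor_lift_unique:
  assumes "complex_linear g" "\<And>a b. g (a \<otimes> b) = B a b"
  shows "tensor_lift B = g"
proof -
  have "B = (\<lambda>a b. g (a \<otimes> b))" by (simp add: fun_eq_iff assms(2))
  then have B: "complex_bilinear B"
    using complex_bilinear_compose[OF assms(1) complex_bilinear_tens] by simp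
  show ?thesis
    by (rule ext, rule tensor_linear_eqI[OF complex_linear_tensor_lift[OF B] assms(1)])
       (simp add: tensor_lift_tens B assms(2))
qed

subsection \<open>Enveloping algebras\<close>

lemma enveloping_relations_abs_eq:
  assumes "p - q \<in> enveloping_relations"
  shows "abs_uea p = abs_uea q"
  using ideal_generated.step[OF assms ideal_generated.zero, of 1 1] by (simp add: uea.abs_eq_iff)

lemma gen_add: "gen (u + v) = gen u + gen v"
proof -
  have "abs_uea (Poly_Mapping.single (Word [u + v]) 1) =
      abs_uea (Poly_Mapping.single (Word [u]) 1 + Poly_Mapping.single (Word [v]) 1)"
    by (rule enveloping_relations_abs_eq)
       (unfold enveloping_relations_def diff_diff_add[symmetric], blast)
  then show ?thesis by (simp only: gen.abs_eq plus_uea.abs_eq)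
qed

lemma gen_scaleC: "gen (c *\<^sub>C u) = c *\<^sub>C gen u"
proof -
  have "abs_uea (Poly_Mapping.single (Word [c *\<^sub>C u]) 1) = abs_uea (Poly_Mapping.single (Word [u]) c)"
    by (rule enveloping_relations_abs_eq) (unfold enveloping_relations_def, blast)
  then show ?thesis by (simp add: gen.abs_eq scaleC_uea.abs_eq mult_single)
qed

lemma gen_lie: "gen (lie u v) = gen u * gen v - gen v * gen u"
proof -
  have "abs_uea (Poly_Mapping.single (Word [u, v]) 1) =
      abs_uea (Poly_Mapping.single (Word [v, u]) 1 + Poly_Mapping.single (Word [lie u v]) 1)"
    by (rule enveloping_relations_abs_eq)
       (unfold enveloping_relations_def diff_diff_add[symmetric], blast)
  then show ?thesis
    by (simp add: gen.abs_eq plus_uea.abs_eq[symmetric] times_uea.abs_eq mult_single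
        plus_free_monoid_def)
qed

lemma complex_linear_gen: "complex_linear gen"
  by (simp add: complex_linear_def gen_add gen_scaleC)

text \<open>Up to a scalar, the class of a basis element of the free algebra is a product of
  generators, so such products span.\<close>

lemma uea_word_induct:
  assumes word: "\<And>us. P (\<Prod>u\<leftarrow>us. gen u)"
    and scale: "\<And>c x. P x \<Longrightarrow> P (c *\<^sub>C x)" and add: "\<And>x y. P x \<Longrightarrow> P y \<Longrightarrow> P (x + y)"
  shows "P x"
proof -
  have w: "abs_uea (Poly_Mapping.single (Word us) 1) = (\<Prod>u\<leftarrow>us. gen u)" for us :: "'a list"
  proof (induction us)
    case Nil
    then show ?case
      by (simp add: one_uea.abs_eq zero_free_monoid_def[symmetric])
  next
    case (Cons u us)
    have "abs_uea (Poly_Mapping.single (Word (u # us)) 1) =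
      abs_uea (Poly_Mapping.single (Word [u]) 1) * abs_uea (Poly_Mapping.single (Word us) 1)"
      by (simp add: times_uea.abs_eq mult_single plus_free_monoid_def)
    then show ?case by (simp add: Cons gen.abs_eq)
  qed
  have "P (abs_uea p)" for p
  proof (induction p rule: poly_mapping_induct)
    case (single k c)
    have "abs_uea (Poly_Mapping.single k c) = c *\<^sub>C abs_uea (Poly_Mapping.single (Word (letters k)) 1)"
      by (simp add: scaleC_uea.abs_eq mult_single)
    then show ?case by (cases k) (simp add: w scale word)
  next
    case (sum p q)
    then show ?case using add by (simp add: plus_uea.abs_eq[symmetric])
  qed
  then show ?thesis by (induction x rule: uea.abs_induct) auto
qed

lemma uea_induct [case_names one gen scale add]:
  assumes "P 1" "\<And>u x. P x \<Longrightarrow> P (gen u * x)"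
    and "\<And>c x. P x \<Longrightarrow> P (c *\<^sub>C x)" "\<And>x y. P x \<Longrightarrow> P y \<Longrightarrow> P (x + y)"
  shows "P x"
proof (rule uea_word_induct)
  show "P (\<Prod>u\<leftarrow>us. gen u)" for us
    by (induction us) (simp_all add: assms)
qed (simp_all add: assms)

lemma uea_induct_right [case_names one gen scale add]:
  assumes "P 1" "\<And>u x. P x \<Longrightarrow> P (x * gen u)"
    and "\<And>c x. P x \<Longrightarrow> P (c *\<^sub>C x)" "\<And>x y. P x \<Longrightarrow> P y \<Longrightarrow> P (x + y)"
  shows "P x"
proof (rule uea_word_induct)
  show "P (\<Prod>u\<leftarrow>us. gen u)" for us
    by (induction us rule: rev_induct) (simp_all add: assms)
qed (simp_all add: assms)

text \<open>
  The target multiplication is an arbitrary bilinear monoid operation, so that the opposite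
  algebra, hence the antipode, is covered.
\<close>

lemma ex_uea_lift:
  fixes mul :: "'b::complex_space \<Rightarrow> 'b \<Rightarrow> 'b" and \<psi> :: "'x::complex_lie_algebra \<Rightarrow> 'b"
  assumes mul: "complex_bilinear mul" "\<And>a b c. mul (mul a b) c = mul a (mul b c)"
      "\<And>a. mul e a = a" "\<And>a. mul a e = a"
    and \<psi>: "complex_linear \<psi>" "\<And>u v. \<psi> (lie u v) = mul (\<psi> u) (\<psi> v) - mul (\<psi> v) (\<psi> u)"
  shows "\<exists>f. complex_linear f \<and> f 1 = e \<and> (\<forall>a b. f (a * b) = mul (f a) (f b)) \<and> (\<forall>u. f (gen u) = \<psi> u)"
proof -
  note M = complex_linear_simps[OF complex_bilinear_left[OF mul(1)]]
    complex_linear_simps[OF complex_bilinear_right[OF mul(1)]]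
  note L = complex_linear_simps[OF \<psi>(1)]
  define h where "h w = foldr (\<lambda>u. mul (\<psi> u)) (letters w) e" for w
  have h_fold: "foldr (\<lambda>u. mul (\<psi> u)) us b = mul (foldr (\<lambda>u. mul (\<psi> u)) us e) b" for us b
    by (induction us) (simp_all add: mul)
  have h_plus: "h (v + w) = mul (h v) (h w)" for v w
    by (simp add: h_def plus_free_monoid_def) (rule h_fold)
  have hom: "free_lift h (p * q) = mul (free_lift h p) (free_lift h q)" for p q
  proof (induction p rule: poly_mapping_induct)
    case (single v c)
    show ?case
      by (induction q rule: poly_mapping_induct)
         (simp_all add: mult_single free_lift_single h_plus M scaleC_scaleC distrib_left
           free_lift_add mult.commute)
  qed (simp_all add: distrib_right free_lift_add M)
  have ker: "free_lift h p = 0" if "p \<in> ideal_generated enveloping_relations" for p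
    using that
  proof (rule ideal_generated_kernel)
    fix a r b :: "'x free_monoid \<Rightarrow>\<^sub>0 complex"
    assume r: "r \<in> enveloping_relations"
    have "free_lift h r = 0"
      using r unfolding enveloping_relations_def
      by (elim UnE CollectE exE conjE; hypsubst)
        (simp_all add: free_lift_diff free_lift_single h_def L scaleC_one \<psi>(2) mul)
    then show "free_lift h (a * r * b) = 0"
      by (simp add: hom M)
  qed (simp_all add: free_lift_add free_lift_zero)
  define f where "f t = free_lift h (rep_uea t)" for t
  have f_abs: "f (abs_uea p) = free_lift h p" for p
  proof -
    have "rep_uea (abs_uea p) - p \<in> ideal_generated enveloping_relations"
      using Quotient3_abs_rep[OF Quotient3_uea, of "abs_uea p"] by (simp only: uea.abs_eq_iff)
    from ker[OF this] show ?thesis by (simp add: f_def free_lift_diff)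
  qed
  have "f (s + t) = f s + f t" for s t
    by (induction s rule: uea.abs_induct; induction t rule: uea.abs_induct)
       (simp add: plus_uea.abs_eq f_abs free_lift_add)
  moreover have m: "f (s * t) = mul (f s) (f t)" for s t
    by (induction s rule: uea.abs_induct; induction t rule: uea.abs_induct)
       (simp add: times_uea.abs_eq f_abs hom)
  moreover have one: "f 1 = e"
    by (simp add: one_uea.abs_eq f_abs free_lift_single h_def zero_free_monoid_def scaleC_one
        flip: single_one)
  moreover have "f (gen u) = \<psi> u" for u
    by (simp add: gen.abs_eq f_abs free_lift_single h_def scaleC_one mul)
  \<comment> \<open>Scaling is multiplication by a multiple of the unit, so multiplicativity reduces
    the claim to the empty word.\<close>
  moreover have "f (c *\<^sub>C t) = c *\<^sub>C f t" for c t
  proof -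
    have "f (c *\<^sub>C 1) = c *\<^sub>C e"
      by (simp add: one_uea.abs_eq scaleC_uea.abs_eq f_abs free_lift_single h_def
          zero_free_monoid_def mult_single)
    then show ?thesis
      using m[of "c *\<^sub>C 1" t] by (simp add: mult_scaleC_left M mul)
  qed
  ultimately show ?thesis by (auto simp: complex_linear_def)
qed

text \<open>The step hypothesis only passes from \<open>x\<close> to \<open>gen u * x\<close>, so
  the lemma serves homomorphisms, antihomomorphisms and contractions composed with the coproduct
  alike.\<close>

lemma uea_hom_unique:
  assumes "complex_linear f" "complex_linear g" "f 1 = g 1"
    and "\<And>u x. f x = g x \<Longrightarrow> f (gen u * x) = g (gen u * x)"
  shows "f x = g x"
  by (induction x rule: uea_induct) (simp_all add: complex_linear_simps assms)

subsection \<open>The classical Hopf algebra\<close>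

lemma
  fixes a b :: "'a::complex_lie_algebra uea" and u :: 'a
  shows complex_linear_coproduct: "complex_linear (coproduct :: 'a uea \<Rightarrow> _)"
    and coproduct_one: "coproduct (1 :: 'a uea) = 1"
    and coproduct_mult: "coproduct (a * b) = coproduct a * coproduct b"
    and coproduct_gen: "coproduct (gen u) = gen u \<otimes> 1 + 1 \<otimes> gen u"
proof -
  let ?P = "\<lambda>D :: 'a uea \<Rightarrow> _. complex_linear D \<and> D 1 = 1 \<and> (\<forall>a b. D (a * b) = D a * D b)
     \<and> (\<forall>u. D (gen u) = gen u \<otimes> 1 + 1 \<otimes> gen u)"
  have "\<exists>!D. ?P D"
  proof (rule ex_ex1I)
    show "\<exists>D. ?P D"
    proof (rule ex_uea_lift)
      show "complex_bilinear ((*) :: ('a uea, 'a uea) tensor \<Rightarrow> _)"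
        by (intro complex_bilinearI complex_linear_intros)
      show "complex_linear (\<lambda>u. gen u \<otimes> 1 + 1 \<otimes> gen u)"
        by (intro complex_linear_intros
            complex_linear_compose[OF complex_bilinear_left[OF complex_bilinear_tens]]
            complex_linear_compose[OF complex_bilinear_right[OF complex_bilinear_tens]]
            complex_linear_gen)
    qed (simp_all add: mult.assoc algebra_simps tens_mult gen_lie
        complex_linear_diff[OF complex_bilinear_left[OF complex_bilinear_tens]]
        complex_linear_diff[OF complex_bilinear_right[OF complex_bilinear_tens]])
    show "D = D'" if "?P D" "?P D'" for D D'
      by (rule ext, rule uea_hom_unique) (use that in auto)
  qed
  from theI'[OF this]
  show "complex_linear (coproduct :: 'a uea \<Rightarrow> _)" "coproduct (1 :: 'a uea) = 1" "coproduct (a * b) = coproduct a * coproduct b"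
    "coproduct (gen u) = gen u \<otimes> 1 + 1 \<otimes> gen u"
    by (simp_all add: coproduct_def)
qed

lemma
  fixes a b :: "'a::complex_lie_algebra uea" and u :: 'a
  shows complex_linear_antipode: "complex_linear (antipode :: 'a uea \<Rightarrow> _)"
    and antipode_one: "antipode (1 :: 'a uea) = 1"
    and antipode_mult: "antipode (a * b) = antipode b * antipode a"
    and antipode_gen: "antipode (gen u) = - gen u"
proof -
  let ?P = "\<lambda>S :: 'a uea \<Rightarrow> _. complex_linear S \<and> S 1 = 1 \<and> (\<forall>a b. S (a * b) = S b * S a)
     \<and> (\<forall>u. S (gen u) = - gen u)"
  have "\<exists>!S. ?P S"
  proof (rule ex_ex1I)
    show "\<exists>S. ?P S"
      by (rule ex_uea_lift)
         (simp_all add: mult.assoc gen_lie complex_bilinearI complex_linear_intros complex_linear_gen)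
    show "D = D'" if "?P D" "?P D'" for D D'
      by (rule ext, rule uea_hom_unique) (use that in auto)
  qed
  from theI'[OF this]
  show "complex_linear (antipode :: 'a uea \<Rightarrow> _)" "antipode (1 :: 'a uea) = 1" "antipode (a * b) = antipode b * antipode a"
    "antipode (gen u) = - gen u"
    by (simp_all add: antipode_def)
qed

lemma antipode_antipode: "antipode (antipode x) = x"
  by (rule uea_hom_unique)
     (simp_all add: complex_linear_compose complex_linear_antipode complex_linear_id antipode_one
       antipode_mult antipode_gen complex_linear_minus)

lemma inv_antipode: "inv antipode = antipode"
  by (rule inv_equality) (simp_all add: antipode_antipode)

text \<open>The complex numbers as an algebra over themselves: this makes the counit an instance of
  \<open>ex_uea_lift\<close> and gives a meaning to \<lambda>-linearity for maps with values in
  \<open>complex fps\<close>.\<close>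

instantiation complex :: complex_algebra_1
begin
definition scaleC_complex :: "complex \<Rightarrow> complex \<Rightarrow> complex" where "c *\<^sub>C z = c * z"
instance by standard (simp_all add: scaleC_complex_def algebra_simps)
end

definition counit :: "'x::complex_lie_algebra uea \<Rightarrow> complex" where
  "counit = (SOME f. complex_linear f \<and> f 1 = 1 \<and> (\<forall>a b. f (a * b) = f a * f b) \<and> (\<forall>u. f (gen u) = 0))"

lemma
  fixes a b :: "'a::complex_lie_algebra uea" and u :: 'a
  shows complex_linear_counit: "complex_linear (counit :: 'a uea \<Rightarrow> _)"
    and counit_one: "counit (1 :: 'a uea) = 1"
    and counit_mult: "counit (a * b) = counit a * counit b"
    and counit_gen: "counit (gen u) = 0"
proof -
  have "\<exists>f :: 'a uea \<Rightarrow> complex. complex_linear f \<and> f 1 = 1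
    \<and> (\<forall>a b. f (a * b) = f a * f b) \<and> (\<forall>u. f (gen u) = 0)"
    by (rule ex_uea_lift) (simp_all add: complex_bilinearI complex_linear_intros)
  from someI_ex[OF this]
  show "complex_linear (counit :: 'a uea \<Rightarrow> _)" "counit (1 :: 'a uea) = 1"
    "counit (a * b) = counit a * counit b" "counit (gen u) = 0"
    by (simp_all add: counit_def)
qed

section \<open>Hopf algebra axioms of the undeformed structure\<close>

lemma tensor_hom_eqI:
  fixes f :: "('a::complex_algebra_1, 'b::complex_algebra_1) tensor \<Rightarrow> 'c::complex_algebra_1"
  assumes "complex_linear f" "\<And>a b c d. f ((a \<otimes> b) * (c \<otimes> d)) = f (a \<otimes> b) * f (c \<otimes> d)"
  shows "f (s * t) = f s * f t"
proof (induction s rule: tensor_induct)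
  case (tens a b)
  show ?case
    by (induction t rule: tensor_induct)
       (simp_all add: assms distrib_left complex_linear_add)
qed (simp_all add: distrib_right assms complex_linear_add)

lemma complex_bilinear_comp:
  assumes "complex_bilinear B" "complex_linear f" "complex_linear g"
  shows "complex_bilinear (\<lambda>a b. B (f a) (g b))"
  using assms complex_linear_compose[OF complex_bilinear_left[OF assms(1)] assms(2)]
    complex_linear_compose[OF complex_bilinear_right[OF assms(1)] assms(3)]
  by (simp add: complex_bilinear_def)

lemmas complex_bilinear_tens_comp = complex_bilinear_comp[OF complex_bilinear_tens]

lemma complex_bilinear_mult: "complex_bilinear ((*) :: 'a::complex_algebra_1 \<Rightarrow> _)"
  by (intro complex_bilinearI complex_linear_intros)

lemma complex_linear_tens_left: "complex_linear g \<Longrightarrow> complex_linear (\<lambda>a. g a \<otimes> b)"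
  and complex_linear_tens_right: "complex_linear g \<Longrightarrow> complex_linear (\<lambda>a. b \<otimes> g a)"
  using complex_linear_compose[OF complex_bilinear_left[OF complex_bilinear_tens]]
    complex_linear_compose[OF complex_bilinear_right[OF complex_bilinear_tens]] by auto

lemma
  fixes a :: "'a::complex_algebra_1" and b :: "'b::complex_algebra_1" and c :: "'c::complex_algebra_1"
  shows complex_linear_tensor_assoc: "complex_linear (tensor_assoc :: (('a, 'b) tensor, 'c) tensor \<Rightarrow> _)"
    and tensor_assoc_tens: "tensor_assoc ((a \<otimes> b) \<otimes> c) = a \<otimes> (b \<otimes> c)"
proof -
  have 1: "complex_bilinear (\<lambda>(a :: 'a) (b :: 'b). a \<otimes> (b \<otimes> c))" for c :: 'c
    by (intro complex_bilinearI complex_linear_tens_left complex_linear_tens_right complex_linear_id)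
  have lin: "complex_linear (\<lambda>c :: 'c. tensor_lift (\<lambda>a b. a \<otimes> (b \<otimes> c)) s)"
    for s :: "('a, 'b) tensor"
  proof (induction s rule: tensor_induct)
    case (tens a b)
    then show ?case
      by (simp add: tensor_lift_tens[OF 1] complex_linear_tens_right complex_linear_id)
  next
    case (add s t)
    then show ?case
      by (simp add: complex_linear_add[OF complex_linear_tensor_lift[OF 1]] complex_linear_plus)
  qed
  have 2: "complex_bilinear (\<lambda>s c :: 'c. tensor_lift (\<lambda>a b. a \<otimes> (b \<otimes> c)) (s :: ('a, 'b) tensor))"
    by (rule complex_bilinearI[OF complex_linear_tensor_lift[OF 1] lin])
  show "complex_linear (tensor_assoc :: (('a, 'b) tensor, 'c) tensor \<Rightarrow> _)"
    unfolding tensor_assoc_def by (rule complex_linear_tensor_lift[OF 2])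
  show "tensor_assoc ((a \<otimes> b) \<otimes> c) = a \<otimes> (b \<otimes> c)"
    by (simp add: tensor_assoc_def tensor_lift_tens[OF 2] tensor_lift_tens[OF 1])
qed

lemma tensor_assoc_mult: "tensor_assoc (s * t) = tensor_assoc s * tensor_assoc t"
proof (rule tensor_hom_eqI)
  fix a c :: "('a, 'b) tensor" and b d :: 'c
  show "tensor_assoc ((a \<otimes> b) * (c \<otimes> d)) = tensor_assoc (a \<otimes> b) * tensor_assoc (c \<otimes> d)"
  proof (induction a rule: tensor_induct)
    case (tens x y)
    show ?case
      by (induction c rule: tensor_induct)
         (simp_all add: tens_mult tensor_assoc_tens distrib_left tens_add_left
           complex_linear_add[OF complex_linear_tensor_assoc])
  qed (simp_all add: tens_mult tensor_assoc_tens distrib_right tens_add_left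
           complex_linear_add[OF complex_linear_tensor_assoc])
qed (rule complex_linear_tensor_assoc)

text \<open>Both sides are algebra homomorphisms in \<open>a\<close>, and on a generator both give
  the three placements of u among units.\<close>

lemma coproduct_coassoc:
  fixes a :: "'a::complex_lie_algebra uea"
  shows
  "tensor_assoc (tensor_lift (\<lambda>x y. coproduct x \<otimes> y) (coproduct a)) =
     tensor_lift (\<lambda>x y. x \<otimes> coproduct y) (coproduct a)"
proof -
  have bl: "complex_bilinear (\<lambda>x y. coproduct x \<otimes> y)" "complex_bilinear (\<lambda>x y. x \<otimes> coproduct y)"
    by (intro complex_bilinear_tens_comp complex_linear_coproduct complex_linear_id)+
  note lin = complex_linear_tensor_lift[OF bl(1)] complex_linear_tensor_lift[OF bl(2)]
  have hom: "tensor_lift (\<lambda>x y. coproduct x \<otimes> y) (s * t) =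
      tensor_lift (\<lambda>x y. coproduct x \<otimes> y) s * tensor_lift (\<lambda>x y. coproduct x \<otimes> y) t"
    "tensor_lift (\<lambda>x y. x \<otimes> coproduct y) (s * t) =
      tensor_lift (\<lambda>x y. x \<otimes> coproduct y) s * tensor_lift (\<lambda>x y. x \<otimes> coproduct y) t" for s t
    by (rule tensor_hom_eqI; simp add: lin bl tensor_lift_tens tens_mult coproduct_mult)+
  show ?thesis
  proof (rule uea_hom_unique)
    show "complex_linear (\<lambda>a. tensor_assoc (tensor_lift (\<lambda>x y. coproduct x \<otimes> y) (coproduct a)))"
      "complex_linear (\<lambda>a. tensor_lift (\<lambda>x y. x \<otimes> coproduct y) (coproduct a))"
      by (intro complex_linear_compose[OF complex_linear_tensor_assoc]
          complex_linear_compose[OF lin(1)] complex_linear_compose[OF lin(2)] complex_linear_coproduct)+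
    have 1: "tensor_lift (\<lambda>x y. coproduct x \<otimes> y) 1 = 1 \<otimes> 1"
      "tensor_lift (\<lambda>x y. x \<otimes> coproduct y) 1 = 1 \<otimes> 1"
      by (subst one_tensor[symmetric], simp add: tensor_lift_tens bl coproduct_one)+
    have "tensor_assoc ((1 \<otimes> 1) \<otimes> 1) = 1 \<otimes> (1 \<otimes> 1)"
      by (rule tensor_assoc_tens)
    then show "tensor_assoc (tensor_lift (\<lambda>x y. coproduct x \<otimes> y) (coproduct 1)) =
      tensor_lift (\<lambda>x y. x \<otimes> coproduct y) (coproduct 1)"
      by (simp add: coproduct_one 1 one_tensor)
  next
    fix u :: 'a and x :: "'a uea"
    assume IH: "tensor_assoc (tensor_lift (\<lambda>x y. coproduct x \<otimes> y) (coproduct x)) =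
      tensor_lift (\<lambda>x y. x \<otimes> coproduct y) (coproduct x)"
    have "tensor_assoc (tensor_lift (\<lambda>x y. coproduct x \<otimes> y) (coproduct (gen u))) =
      tensor_lift (\<lambda>x y. x \<otimes> coproduct y) (coproduct (gen u))"
      by (simp add: coproduct_gen coproduct_one complex_linear_add[OF lin(1)] complex_linear_add[OF lin(2)]
          tensor_lift_tens bl tens_add_left tens_add_right tensor_assoc_tens
          complex_linear_add[OF complex_linear_tensor_assoc] add.assoc flip: one_tensor)
    then show "tensor_assoc (tensor_lift (\<lambda>x y. coproduct x \<otimes> y) (coproduct (gen u * x))) =
      tensor_lift (\<lambda>x y. x \<otimes> coproduct y) (coproduct (gen u * x))"
      by (simp add: coproduct_mult hom tensor_assoc_mult IH)
  qed
qed

lemma tensor_lift_linear_factor: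
  assumes "complex_bilinear B" "complex_linear g"
  shows "tensor_lift (\<lambda>a b. g (B a b)) t = g (tensor_lift B t)"
  by (rule tensor_linear_eqI)
     (simp_all add: assms complex_linear_tensor_lift complex_linear_compose tensor_lift_tens
       complex_bilinear_compose)

lemma complex_bilinear_scaleC: "complex_bilinear (\<lambda>c x. c *\<^sub>C x)"
  by (intro complex_bilinearI complex_linearI)
     (simp_all add: scaleC_add_left scaleC_add_right scaleC_scaleC scaleC_complex_def mult.commute)

lemma coproduct_counit_left: "tensor_lift (\<lambda>x y. counit x *\<^sub>C y) (coproduct a) = a"
  and coproduct_counit_right: "tensor_lift (\<lambda>x y. counit y *\<^sub>C x) (coproduct a) = a"
proof -
  have bl: "complex_bilinear (\<lambda>x y. counit x *\<^sub>C y)" "complex_bilinear (\<lambda>x y. counit y *\<^sub>C x)"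
    using complex_bilinear_comp[OF complex_bilinear_scaleC complex_linear_counit complex_linear_id]
    by (auto simp: complex_bilinear_def)
  note lin = complex_linear_tensor_lift[OF bl(1)] complex_linear_tensor_lift[OF bl(2)]
  have hom: "tensor_lift (\<lambda>x y. counit x *\<^sub>C y) (s * t) =
      tensor_lift (\<lambda>x y. counit x *\<^sub>C y) s * tensor_lift (\<lambda>x y. counit x *\<^sub>C y) t"
    "tensor_lift (\<lambda>x y. counit y *\<^sub>C x) (s * t) =
      tensor_lift (\<lambda>x y. counit y *\<^sub>C x) s * tensor_lift (\<lambda>x y. counit y *\<^sub>C x) t" for s t
    by (rule tensor_hom_eqI; simp add: lin bl tensor_lift_tens tens_mult counit_mult mult_scaleC_left
        mult_scaleC_right scaleC_scaleC mult.commute)+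
  have 1: "tensor_lift (\<lambda>x y. counit x *\<^sub>C y) 1 = 1" "tensor_lift (\<lambda>x y. counit y *\<^sub>C x) 1 = 1"
    by (subst one_tensor[symmetric], simp add: tensor_lift_tens bl counit_one scaleC_one)+
  show "tensor_lift (\<lambda>x y. counit x *\<^sub>C y) (coproduct a) = a"
    by (rule uea_hom_unique)
       (simp_all add: complex_linear_compose[OF lin(1)] complex_linear_coproduct complex_linear_id
         coproduct_one 1 coproduct_mult coproduct_gen hom complex_linear_add[OF lin(1)]
         tensor_lift_tens bl counit_gen counit_one scaleC_one)
  show "tensor_lift (\<lambda>x y. counit y *\<^sub>C x) (coproduct a) = a"
    by (rule uea_hom_unique)
       (simp_all add: complex_linear_compose[OF lin(2)] complex_linear_coproduct complex_linear_id
         coproduct_one 1 coproduct_mult coproduct_gen hom complex_linear_add[OF lin(2)]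
         tensor_lift_tens bl counit_gen counit_one scaleC_one)
qed

text \<open>These contractions are not multiplicative. Instead they vanish on products with the
  coproduct of a generator: S(u a) b + S(a) u b = 0 in the first case, a u S(b) + a S(b u) = 0 in
  the second. The counit vanishes on such words as well. The second cancellation multiplies from the
  right, hence \<open>uea_induct_right\<close>.\<close>

lemma coproduct_antipode_left: "tensor_lift (\<lambda>x y. antipode x * y) (coproduct a) = counit a *\<^sub>C 1"
  and coproduct_antipode_right: "tensor_lift (\<lambda>x y. x * antipode y) (coproduct a) = counit a *\<^sub>C 1"
proof -
  have bl: "complex_bilinear (\<lambda>x y. antipode x * y)" "complex_bilinear (\<lambda>x y. x * antipode y)"
    by (intro complex_bilinear_comp[OF complex_bilinear_mult] complex_linear_antipode complex_linear_id)+
  note lin = complex_linear_tensor_lift[OF bl(1)] complex_linear_tensor_lift[OF bl(2)]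
  have z1: "tensor_lift (\<lambda>x y. antipode x * y) (coproduct (gen u) * t) = 0" for u t
  proof (induction t rule: tensor_induct)
    case (tens a b)
    show ?case
      by (simp add: coproduct_gen algebra_simps tens_mult complex_linear_simps[OF lin(1)]
         tensor_lift_tens bl antipode_mult antipode_gen)
  qed (simp add: distrib_left complex_linear_add[OF lin(1)])
  have z2: "tensor_lift (\<lambda>x y. x * antipode y) (t * coproduct (gen u)) = 0" for u t
  proof (induction t rule: tensor_induct)
    case (tens a b)
    show ?case
      by (simp add: coproduct_gen algebra_simps tens_mult complex_linear_simps[OF lin(2)]
         tensor_lift_tens bl antipode_mult antipode_gen)
  qed (simp add: distrib_right complex_linear_add[OF lin(2)])
  have 1: "tensor_lift (\<lambda>x y. antipode x * y) 1 = 1" "tensor_lift (\<lambda>x y. x * antipode y) 1 = 1"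
    by (subst one_tensor[symmetric], simp add: tensor_lift_tens bl antipode_one)+
  show "tensor_lift (\<lambda>x y. antipode x * y) (coproduct a) = counit a *\<^sub>C 1"
    by (induction a rule: uea_induct)
       (simp_all add: coproduct_one 1 counit_one scaleC_one coproduct_mult z1 counit_mult counit_gen
         complex_linear_simps[OF complex_linear_coproduct] complex_linear_simps[OF lin(1)]
         complex_linear_simps[OF complex_linear_counit] scaleC_add_left scaleC_scaleC scaleC_complex_def)
  show "tensor_lift (\<lambda>x y. x * antipode y) (coproduct a) = counit a *\<^sub>C 1"
    by (induction a rule: uea_induct_right)
       (simp_all add: coproduct_one 1 counit_one scaleC_one coproduct_mult z2 counit_mult counit_gen
         complex_linear_simps[OF complex_linear_coproduct] complex_linear_simps[OF lin(2)]
         complex_linear_simps[OF complex_linear_counit] scaleC_add_left scaleC_scaleC scaleC_complex_def)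
qed

section \<open>The adjoint action\<close>

lemma complex_bilinear_adj_integrand: "complex_bilinear (\<lambda>a b. a * x * antipode b)"
  by (intro complex_bilinearI complex_linear_intros complex_linear_antipode)

text \<open>The coproduct distributes u over the two sides of the sandwich, and S(u b) = - S(b) u
  moves it to the far right with a sign: generators act by commutators.\<close>

lemma adj_gen_mult: "adj (gen u * a) x = gen u * adj a x - adj a x * gen u"
proof -
  define J where "J = tensor_lift (\<lambda>a b. a * x * antipode b)"
  have lin: "complex_linear J"
    unfolding J_def by (rule complex_linear_tensor_lift[OF complex_bilinear_adj_integrand])
  have J_tens: "J (a \<otimes> b) = a * x * antipode b" for a b
    unfolding J_def by (rule tensor_lift_tens[OF complex_bilinear_adj_integrand])
  have "J (coproduct (gen u) * t) = gen u * J t - J t * gen u" for t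
  proof (induction t rule: tensor_induct)
    case (tens a b)
    show ?case
      by (simp add: coproduct_gen distrib_right tens_mult complex_linear_add[OF lin] J_tens antipode_mult antipode_gen mult.assoc)
  qed (simp add: distrib_left distrib_right complex_linear_add[OF lin])
  then show ?thesis by (simp add: adj_def coproduct_mult J_def)
qed

lemma adj_one: "adj 1 x = x"
  by (simp add: adj_def coproduct_one tensor_lift_tens[OF complex_bilinear_adj_integrand] antipode_one
      flip: one_tensor)

lemma complex_bilinear_adj: "complex_bilinear adj"
proof (rule complex_bilinearI)
  show "complex_linear (\<lambda>a. adj a x)" for x :: "'a uea"
    unfolding adj_def
    by (rule complex_linear_compose[OF complex_linear_tensor_lift[OF complex_bilinear_adj_integrand]
          complex_linear_coproduct])
  then have 1: "complex_linear (\<lambda>a. adj a x)" for x :: "'a uea" .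
  show "complex_linear (\<lambda>x. adj a x)" for a :: "'a uea"
  proof (induction a rule: uea_induct)
    case (scale c a)
    then show ?case by (simp add: complex_linear_scale[OF 1] complex_linear_scaleC)
  next
    case (add a b)
    then show ?case by (simp add: complex_linear_add[OF 1] complex_linear_plus)
  qed (simp_all add: adj_one adj_gen_mult complex_linear_intros)
qed

section \<open>Linear maps of formal power series\<close>

text \<open>Reindexing of sums over i + m + l = k, the combinatorial core of associativity of Cauchy
  products; \<open>sum_triangle_swap\<close> plays the same role for exchanging two factors.\<close>

lemma sum_triangle:
  fixes h :: "nat \<Rightarrow> nat \<Rightarrow> nat \<Rightarrow> 'a::comm_monoid_add"
  shows "(\<Sum>n\<le>k. \<Sum>i\<le>n. h i (n - i) (k - n)) = (\<Sum>i\<le>k. \<Sum>m\<le>k - i. h i m (k - i - m))"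
  using fps_mult_assoc_lemma[of h k] by (simp add: atLeast0AtMost)

lemma sum_triangle_swap:
  fixes h :: "nat \<Rightarrow> nat \<Rightarrow> nat \<Rightarrow> 'a::comm_monoid_add"
  shows "(\<Sum>i\<le>k. \<Sum>j\<le>k - i. h i j (k - i - j)) = (\<Sum>j\<le>k. \<Sum>i\<le>k - j. h i j (k - j - i))"
  unfolding sum.Sigma[OF finite_atMost ballI[OF finite_atMost]]
  by (rule sum.reindex_bij_witness[of _ prod.swap prod.swap]) (auto simp: add.commute)

text \<open>The Cauchy product along a bilinear map. Scalar multiplication, tensor product and
  algebra product of series all have this form, so associativity and exchange of factors are proved
  once.\<close>

definition conv :: "('a \<Rightarrow> 'b \<Rightarrow> 'c::comm_monoid_add) \<Rightarrow> 'a fps \<Rightarrow> 'b fps \<Rightarrow> 'c fps" where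
  "conv B f g = Abs_fps (\<lambda>n. \<Sum>i\<le>n. B (fps_nth f i) (fps_nth g (n - i)))"

lemma fps_scale_conv: "c \<bullet>\<^sub>\<lambda> f = conv (*\<^sub>C) c f"
  and fps_tens_conv: "a \<otimes>\<^sub>\<lambda> b = conv (\<otimes>) a b"
  and fps_times_conv: "p * q = conv (*) p q" for p q :: "'r::ring_1 fps"
  by (simp_all add: fps_scale_def fps_tens_def conv_def fps_eq_iff fps_mult_nth atLeast0AtMost)

lemma conv_assoc:
  assumes "complex_bilinear B1" "complex_bilinear B3"
    and "\<And>a b c. B1 (B2 a b) c = B3 a (B4 b c)"
  shows "conv B1 (conv B2 f g) h = conv B3 f (conv B4 g h)"
  using sum_triangle[of "\<lambda>i j l. B3 (fps_nth f i) (B4 (fps_nth g j) (fps_nth h l))"]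
  by (simp add: conv_def fps_eq_iff complex_linear_sum[OF complex_bilinear_left[OF assms(1)]]
      complex_linear_sum[OF complex_bilinear_right[OF assms(2)]] assms(3))

lemma conv_left_commute:
  assumes "complex_bilinear B1" "complex_bilinear B3"
    and "\<And>a b c. B1 a (B2 b c) = B3 b (B4 a c)"
  shows "conv B1 f (conv B2 g h) = conv B3 g (conv B4 f h)"
  using sum_triangle_swap[of "\<lambda>i j l. B3 (fps_nth g j) (B4 (fps_nth f i) (fps_nth h l))"]
  by (simp add: conv_def fps_eq_iff complex_linear_sum[OF complex_bilinear_right[OF assms(1)]]
      complex_linear_sum[OF complex_bilinear_right[OF assms(2)]] assms(3))

lemma conv_add_left: "complex_bilinear B \<Longrightarrow> conv B (f + f') g = conv B f g + conv B f' g"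
  and conv_add_right: "complex_bilinear B \<Longrightarrow> conv B f (g + g') = conv B f g + conv B f g'"
  by (simp_all add: conv_def fps_eq_iff sum.distrib complex_linear_add[OF complex_bilinear_left]
      complex_linear_add[OF complex_bilinear_right])

lemma conv_const_left: "complex_bilinear B \<Longrightarrow> conv B (fps_const a) g = fps_map (B a) g"
proof (rule fps_ext)
  fix n assume "complex_bilinear B"
  then have "(\<Sum>i\<le>n. B (fps_nth (fps_const a) i) (fps_nth g (n - i))) =
      (\<Sum>i\<le>n. if i = 0 then B a (fps_nth g n) else 0)"
    by (intro sum.cong) (auto simp: complex_linear_zero[OF complex_bilinear_left])
  then show "fps_nth (conv B (fps_const a) g) n = fps_nth (fps_map (B a) g) n"
    by (simp add: conv_def fps_map_def)
qed

lemma lambda_linearI: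
  assumes "\<And>x y. f (x + y) = f x + f y" "\<And>c x. f (c \<bullet>\<^sub>\<lambda> x) = c \<bullet>\<^sub>\<lambda> f x"
  shows "lambda_linear f"
  using assms by (simp add: lambda_linear_def)

lemma lambda_linear_add: "lambda_linear f \<Longrightarrow> f (x + y) = f x + f y"
  and lambda_linear_scale: "lambda_linear f \<Longrightarrow> f (c \<bullet>\<^sub>\<lambda> x) = c \<bullet>\<^sub>\<lambda> f x"
  by (simp_all add: lambda_linear_def)

lemma fps_scale_const: "fps_const a \<bullet>\<^sub>\<lambda> f = a *\<^sub>C f"
  by (simp add: fps_scale_conv conv_const_left complex_bilinear_scaleC fps_map_def scaleC_fps_def)

lemma fps_scale_add_right: "c \<bullet>\<^sub>\<lambda> (f + g) = c \<bullet>\<^sub>\<lambda> f + c \<bullet>\<^sub>\<lambda> g"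
  and fps_scale_add_left: "(c + d) \<bullet>\<^sub>\<lambda> f = c \<bullet>\<^sub>\<lambda> f + d \<bullet>\<^sub>\<lambda> f"
  by (simp_all add: fps_scale_conv conv_add_left conv_add_right complex_bilinear_scaleC)

lemma fps_scale_left_commute: "c \<bullet>\<^sub>\<lambda> d \<bullet>\<^sub>\<lambda> f = d \<bullet>\<^sub>\<lambda> c \<bullet>\<^sub>\<lambda> f"
  unfolding fps_scale_conv
  by (rule conv_left_commute) (simp_all add: complex_bilinear_scaleC scaleC_scaleC mult.commute)

lemma fps_scale_scale: "c \<bullet>\<^sub>\<lambda> d \<bullet>\<^sub>\<lambda> f = (c * d) \<bullet>\<^sub>\<lambda> f"
  unfolding fps_scale_conv fps_times_conv
  by (rule conv_assoc[symmetric]) (simp_all add: complex_bilinear_scaleC scaleC_scaleC)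

lemma fps_scale_one: "1 \<bullet>\<^sub>\<lambda> f = f"
  using fps_scale_const[of 1 f] by (simp add: scaleC_one)

lemma fps_scale_complex: "c \<bullet>\<^sub>\<lambda> f = c * f" for f :: "complex fps"
  unfolding fps_scale_conv fps_times_conv by (simp add: scaleC_complex_def[abs_def])

lemma lambda_linear_imp_complex_linear: "lambda_linear f \<Longrightarrow> complex_linear f"
  by (simp add: complex_linear_def lambda_linear_def flip: fps_scale_const)

lemmas lambda_linear_zero = complex_linear_zero[OF lambda_linear_imp_complex_linear]
  and lambda_linear_uminus = complex_linear_minus[OF lambda_linear_imp_complex_linear]

lemma complex_linear_fps_const: "complex_linear fps_const"
  by (rule complex_linearI) (simp_all add: fps_eq_iff scaleC_fps_def)

lemma lambda_linear_id: "lambda_linear (\<lambda>x. x)"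
  and lambda_linear_compose: "lambda_linear f \<Longrightarrow> lambda_linear g \<Longrightarrow> lambda_linear (\<lambda>x. f (g x))"
  by (simp_all add: lambda_linear_def)

lemma lambda_linear_fps_scale: "lambda_linear (\<lambda>x. c \<bullet>\<^sub>\<lambda> x)"
  and lambda_linear_fps_scale_left: "lambda_linear (\<lambda>c. c \<bullet>\<^sub>\<lambda> x)"
  by (auto intro!: lambda_linearI fps_scale_left_commute
      simp: fps_scale_add_right fps_scale_add_left fps_scale_scale fps_scale_complex)

lemma lambda_linear_conv_left: "complex_bilinear B \<Longrightarrow> lambda_linear (\<lambda>f. conv B f g)"
  unfolding fps_scale_conv lambda_linear_def
  by (auto simp: conv_add_left complex_bilinear_scaleC complex_linear_scale[OF complex_bilinear_left]
      intro!: conv_assoc)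

lemma lambda_linear_conv_right: "complex_bilinear B \<Longrightarrow> lambda_linear (\<lambda>g. conv B f g)"
  unfolding fps_scale_conv lambda_linear_def
  by (auto simp: conv_add_right complex_bilinear_scaleC complex_linear_scale[OF complex_bilinear_right]
      intro!: conv_left_commute)

lemma lambda_linear_fps_tens_left: "lambda_linear h \<Longrightarrow> lambda_linear (\<lambda>x. h x \<otimes>\<^sub>\<lambda> g)"
  and lambda_linear_fps_tens_right: "lambda_linear h \<Longrightarrow> lambda_linear (\<lambda>x. g \<otimes>\<^sub>\<lambda> h x)"
  unfolding fps_tens_conv
  using lambda_linear_compose[OF lambda_linear_conv_left[OF complex_bilinear_tens]]
    lambda_linear_compose[OF lambda_linear_conv_right[OF complex_bilinear_tens]] by auto

lemma lambda_linear_mult_right: "lambda_linear h \<Longrightarrow> lambda_linear (\<lambda>x. h x * g)"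
  and lambda_linear_mult_left: "lambda_linear h \<Longrightarrow> lambda_linear (\<lambda>x. g * h x)"
  for g :: "'a::complex_algebra_1 fps"
  unfolding fps_times_conv
  using lambda_linear_compose[OF lambda_linear_conv_left[OF complex_bilinear_mult]]
    lambda_linear_compose[OF lambda_linear_conv_right[OF complex_bilinear_mult]] by auto

lemma fps_tens_const_left: "fps_const a \<otimes>\<^sub>\<lambda> g = fps_map (\<lambda>b. a \<otimes> b) g"
  by (simp add: fps_tens_conv conv_const_left complex_bilinear_tens)

lemma fps_map_const: "complex_linear g \<Longrightarrow> fps_map g (fps_const x) = fps_const (g x)"
  by (simp add: fps_map_def fps_eq_iff complex_linear_zero)

lemma fps_map_nth: "fps_nth (fps_map g f) n = g (fps_nth f n)"
  by (simp add: fps_map_def)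

lemma fps_tens_const: "fps_const a \<otimes>\<^sub>\<lambda> fps_const b = fps_const (a \<otimes> b)"
  by (simp add: fps_tens_const_left fps_map_const complex_linear_tens_right complex_linear_id)

lemma lambda_linear_fps_map: "complex_linear g \<Longrightarrow> lambda_linear (fps_map g)"
  by (rule lambda_linearI)
     (simp_all add: fps_map_def fps_eq_iff fps_scale_def complex_linear_simps)

lemma lambda_linear_fps_ext:
  assumes "complex_linear \<phi>"
  shows "lambda_linear (fps_ext \<phi>)"
proof (rule lambda_linearI)
  show "fps_ext \<phi> (x + y) = fps_ext \<phi> x + fps_ext \<phi> y" for x y
    by (simp add: fps_ext_def fps_eq_iff complex_linear_add[OF assms] sum.distrib)
  show "fps_ext \<phi> (c \<bullet>\<^sub>\<lambda> x) = c \<bullet>\<^sub>\<lambda> fps_ext \<phi> x" for c x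
    using sum_triangle[of "\<lambda>i m l. fps_nth c i *\<^sub>C fps_nth (\<phi> (fps_nth x m)) l"]
    by (simp add: fps_ext_def fps_eq_iff fps_scale_def complex_linear_simps[OF assms]
        fps_sum_nth scaleC_fps_def complex_space.scale_sum_right)
qed

lemma fps_ext_const:
  assumes "complex_linear \<phi>"
  shows "fps_ext \<phi> (fps_const x) = \<phi> x"
proof (rule fps_ext)
  fix k
  have "(\<Sum>n\<le>k. fps_nth (\<phi> (fps_nth (fps_const x) n)) (k - n)) =
      (\<Sum>n\<le>k. if n = 0 then fps_nth (\<phi> x) k else 0)"
    by (rule sum.cong) (simp_all add: complex_linear_zero[OF assms])
  then show "fps_nth (fps_ext \<phi> (fps_const x)) k = fps_nth (\<phi> x) k"
    by (simp add: fps_ext_def)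
qed

text \<open>Division by \<lambda> with the constant term dropped. It presents every series as a
  constant plus a multiple of \<lambda>, the shape in which \<lambda>-linear maps are
  compared.\<close>

definition fps_shift1 :: "'a fps \<Rightarrow> 'a fps" where
  "fps_shift1 f = Abs_fps (\<lambda>n. fps_nth f (Suc n))"

lemma fps_scale_X_nth: "fps_nth (fps_X \<bullet>\<^sub>\<lambda> f) n = (case n of 0 \<Rightarrow> 0 | Suc m \<Rightarrow> fps_nth f m)"
proof (cases n)
  case (Suc m)
  have "(\<Sum>i\<le>n. fps_nth fps_X i *\<^sub>C fps_nth f (n - i)) = (\<Sum>i\<le>n. if i = 1 then fps_nth f m else 0)"
    by (rule sum.cong) (auto simp: fps_X_nth Suc scaleC_one)
  then show ?thesis using Suc by (simp add: fps_scale_def)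
qed (simp add: fps_scale_def)

lemma fps_shift1_decompose: "f = fps_const (fps_nth f 0) + fps_X \<bullet>\<^sub>\<lambda> fps_shift1 f"
  by (simp add: fps_eq_iff fps_scale_X_nth fps_shift1_def split: nat.split)

text \<open>\<lambda>-linearity forces \<lambda>-adic continuity: in a constant plus \<lambda> times
  a series, the second summand contributes to coefficient n only through coefficient n - 1 of an
  image, which the induction covers for all series.\<close>

lemma lambda_linear_eqI:
  assumes "lambda_linear f" "lambda_linear g" "\<And>x. f (fps_const x) = g (fps_const x)"
  shows "f z = g z"
proof (rule fps_ext)
  show "fps_nth (f z) n = fps_nth (g z) n" for n
  proof (induction n arbitrary: z)
    case 0
    show ?case
      by (subst (1 2) fps_shift1_decompose[of z])
         (simp add: lambda_linear_add assms lambda_linear_scale fps_scale_X_nth)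
  next
    case (Suc n)
    show ?case
      by (subst (1 2) fps_shift1_decompose[of z])
         (simp add: lambda_linear_add assms lambda_linear_scale fps_scale_X_nth Suc)
  qed
qed

text \<open>Collapses a coefficientwise extension once its values are recognised as \<Phi> of
  constants, by comparing both sides on constant series.\<close>

lemma fps_ext_factor:
  assumes "lambda_linear \<Phi>" "complex_linear N"
  shows "fps_ext (\<lambda>x. \<Phi> (fps_const (N x))) z = \<Phi> (fps_map N z)"
proof -
  have 1: "complex_linear (\<lambda>x. \<Phi> (fps_const (N x)))"
    by (intro complex_linear_compose[OF lambda_linear_imp_complex_linear[OF assms(1)]]
        complex_linear_compose[OF complex_linear_fps_const] assms)
  show ?thesis
    by (rule lambda_linear_eqI[of "fps_ext (\<lambda>x. \<Phi> (fps_const (N x)))" "\<lambda>z. \<Phi> (fps_map N z)"])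
       (simp_all add: lambda_linear_fps_ext 1 lambda_linear_compose assms lambda_linear_fps_map
          fps_ext_const fps_map_const)
qed

lemma fps_ext_fps_const: "complex_linear N \<Longrightarrow> fps_ext (\<lambda>x. fps_const (N x)) z = fps_map N z"
  by (rule fps_ext_factor[OF lambda_linear_id])

lemma fps_map_fps_map: "fps_map f (fps_map g z) = fps_map (\<lambda>x. f (g x)) z"
  by (simp add: fps_map_def)

lemma fps_map_ident: "fps_map (\<lambda>x. x) z = z"
  by (simp add: fps_map_def fps_eq_iff)

text \<open>The identity is known for constants; each of the four arguments is then freed in turn by
  \<open>lambda_linear_eqI\<close>.\<close>

lemma fps_tens_mult: "(a \<otimes>\<^sub>\<lambda> b) * (c \<otimes>\<^sub>\<lambda> d) = (a * c) \<otimes>\<^sub>\<lambda> (b * d)"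
proof -
  note lin = lambda_linear_fps_tens_left lambda_linear_fps_tens_right lambda_linear_mult_left
    lambda_linear_mult_right lambda_linear_id
  have 1: "(fps_const a \<otimes>\<^sub>\<lambda> fps_const b) * (fps_const c \<otimes>\<^sub>\<lambda> fps_const d) =
      (fps_const a * fps_const c) \<otimes>\<^sub>\<lambda> (fps_const b * fps_const d)" for a b c d
    by (simp add: fps_tens_const tens_mult)
  have 2: "(a \<otimes>\<^sub>\<lambda> fps_const b) * (fps_const c \<otimes>\<^sub>\<lambda> fps_const d) =
      (a * fps_const c) \<otimes>\<^sub>\<lambda> (fps_const b * fps_const d)" for a b c d
    by (rule lambda_linear_eqI[where f = "\<lambda>a. (a \<otimes>\<^sub>\<lambda> fps_const b) * (fps_const c \<otimes>\<^sub>\<lambda> fps_const d)" and g = "\<lambda>a. (a * fps_const c) \<otimes>\<^sub>\<lambda> (fps_const b * fps_const d)" and z = a])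
       (intro lin, intro lin, rule 1)
  have 3: "(a \<otimes>\<^sub>\<lambda> b) * (fps_const c \<otimes>\<^sub>\<lambda> fps_const d) =
      (a * fps_const c) \<otimes>\<^sub>\<lambda> (b * fps_const d)" for a b c d
    by (rule lambda_linear_eqI[where f = "\<lambda>b. (a \<otimes>\<^sub>\<lambda> b) * (fps_const c \<otimes>\<^sub>\<lambda> fps_const d)" and g = "\<lambda>b. (a * fps_const c) \<otimes>\<^sub>\<lambda> (b * fps_const d)" and z = b])
       (intro lin, intro lin, rule 2)
  have 4: "(a \<otimes>\<^sub>\<lambda> b) * (c \<otimes>\<^sub>\<lambda> fps_const d) =
      (a * c) \<otimes>\<^sub>\<lambda> (b * fps_const d)" for a b c d
    by (rule lambda_linear_eqI[where f = "\<lambda>c. (a \<otimes>\<^sub>\<lambda> b) * (c \<otimes>\<^sub>\<lambda> fps_const d)" and g = "\<lambda>c. (a * c) \<otimes>\<^sub>\<lambda> (b * fps_const d)" and z = c])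
       (intro lin, intro lin, rule 3)
  show ?thesis
    by (rule lambda_linear_eqI[where f = "\<lambda>d. (a \<otimes>\<^sub>\<lambda> b) * (c \<otimes>\<^sub>\<lambda> d)" and g = "\<lambda>d. (a * c) \<otimes>\<^sub>\<lambda> (b * d)" and z = d])
       (intro lin, intro lin, rule 4)
qed

lemma fps_map_mult_tens: "fps_map (tensor_lift (*)) (f \<otimes>\<^sub>\<lambda> g) = f * g"
  for f :: "'a::complex_algebra_1 fps"
  by (simp add: fps_map_def fps_tens_def fps_eq_iff fps_mult_nth atLeast0AtMost
      complex_linear_sum[OF complex_linear_tensor_lift] complex_bilinear_mult tensor_lift_tens)

lemma fps_map_mult:
  assumes "complex_linear g" "\<And>a b. g (a * b) = g a * g b"
  shows "fps_map g (f * h) = fps_map g f * fps_map g h"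
  by (simp add: fps_map_def fps_eq_iff fps_mult_nth complex_linear_sum[OF assms(1)] assms(2))

lemma fps_map_antimult:
  assumes "complex_linear g" "\<And>a b. g (a * b) = g b * g a"
  shows "fps_map g (f * h) = fps_map g h * fps_map g f"
proof (rule fps_ext)
  fix n
  have "(\<Sum>i\<le>n. g (fps_nth h (n - i)) * g (fps_nth f i)) = (\<Sum>i\<le>n. g (fps_nth h i) * g (fps_nth f (n - i)))"
    by (rule sum.reindex_bij_witness[of _ "\<lambda>i. n - i" "\<lambda>i. n - i"]) auto
  then show "fps_nth (fps_map g (f * h)) n = fps_nth (fps_map g h * fps_map g f) n"
    by (simp add: fps_map_def fps_mult_nth complex_linear_sum[OF assms(1)] assms(2) atLeast0AtMost)
qed

lemma mult_fps_const: "f * fps_const a = fps_map (\<lambda>x. x * a) f"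
  and fps_const_mult_fps_map: "fps_const a * f = fps_map (\<lambda>x. a * x) f"
  for f :: "'a::complex_algebra_1 fps"
  by (simp_all add: fps_eq_iff fps_map_def)

section \<open>Exponentials of operators\<close>

definition exp_term :: "('a::complex_space \<Rightarrow> 'a) \<Rightarrow> nat \<Rightarrow> 'a \<Rightarrow> 'a" where
  "exp_term \<Omega> n x = (1 / fact n) *\<^sub>C (\<Omega> ^^ n) x"

text \<open>exp(\<lambda> \<Omega>) applied to a series. Each power of \<Omega> carries one power of
  \<lambda>, so every coefficient is a finite sum and no convergence is involved.\<close>

definition opexp :: "('a::complex_space \<Rightarrow> 'a) \<Rightarrow> 'a fps \<Rightarrow> 'a fps" where
  "opexp \<Omega> f = Abs_fps (\<lambda>k. \<Sum>i\<le>k. exp_term \<Omega> i (fps_nth f (k - i)))"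

lemma complex_linear_funpow: "complex_linear \<Omega> \<Longrightarrow> complex_linear (\<Omega> ^^ n)"
  for \<Omega> :: "'a::complex_space \<Rightarrow> 'a"
  by (induction n) (auto simp: id_def o_def intro: complex_linear_id complex_linear_compose)

lemma complex_linear_exp_term: "complex_linear \<Omega> \<Longrightarrow> complex_linear (exp_term \<Omega> n)"
  unfolding exp_term_def[abs_def] by (intro complex_linear_scaleC complex_linear_funpow)

lemma exp_term_0: "exp_term \<Omega> 0 x = x"
  by (simp add: exp_term_def scaleC_one)

lemma exp_term_Suc:
  assumes "complex_linear \<Omega>"
  shows "of_nat (Suc n) *\<^sub>C exp_term \<Omega> (Suc n) x = \<Omega> (exp_term \<Omega> n x)"
proof -
  have "of_nat (Suc n) * (1 / fact (Suc n)) = (1 / fact n :: complex)"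
    by (simp add: field_simps del: of_nat_Suc)
  then show ?thesis
    by (simp add: exp_term_def complex_linear_scale[OF assms] scaleC_scaleC del: of_nat_Suc fact_Suc)
qed

lemma exp_term_intertwine:
  assumes "complex_linear M" "\<And>x. M (\<Omega> x) = \<Omega>' (M x)"
  shows "M (exp_term \<Omega> n x) = exp_term \<Omega>' n (M x)"
proof -
  have "M ((\<Omega> ^^ n) x) = (\<Omega>' ^^ n) (M x)"
    by (induction n) (simp_all add: assms)
  then show ?thesis by (simp add: exp_term_def complex_linear_scale[OF assms(1)])
qed

text \<open>The binomial theorem for commuting operators, obtained from the recursion
  \<open>exp_term_Suc\<close>, the analogue of the differential equation of the exponential.\<close>

lemma exp_term_add:
  assumes lin: "complex_linear \<Omega>" "complex_linear \<Omega>'" and comm: "\<And>x. \<Omega> (\<Omega>' x) = \<Omega>' (\<Omega> x)"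
  shows "exp_term (\<lambda>x. \<Omega> x + \<Omega>' x) n x = (\<Sum>i\<le>n. exp_term \<Omega> i (exp_term \<Omega>' (n - i) x))"
proof (induction n)
  case (Suc n)
  let ?e = "\<lambda>i j. exp_term \<Omega> i (exp_term \<Omega>' j x)"
  have lin': "complex_linear (\<lambda>x. \<Omega> x + \<Omega>' x)"
    by (intro complex_linear_plus lin)
  have 1: "of_nat (Suc i) *\<^sub>C ?e (Suc i) j = \<Omega> (?e i j)" for i j
    by (rule exp_term_Suc[OF lin(1)])
  have 2: "of_nat (Suc j) *\<^sub>C ?e i (Suc j) = \<Omega>' (?e i j)" for i j
    using exp_term_intertwine[of \<Omega>' \<Omega> \<Omega> i, OF lin(2) comm[symmetric]]
    by (simp only: complex_linear_scale[OF complex_linear_exp_term[OF lin(1)], symmetric]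
        exp_term_Suc[OF lin(2)])
  \<comment> \<open>The factor n + 1 is split as i + (n + 1 - i); the facts \<open>1\<close> and
    \<open>2\<close> absorb one part each, lowering the corresponding index.\<close>
  have "of_nat (Suc n) *\<^sub>C (\<Sum>i\<le>Suc n. ?e i (Suc n - i)) =
      (\<Sum>i\<le>Suc n. of_nat i *\<^sub>C ?e i (Suc n - i)) + (\<Sum>i\<le>Suc n. of_nat (Suc n - i) *\<^sub>C ?e i (Suc n - i))"
    unfolding complex_space.scale_sum_right sum.distrib[symmetric]
    by (rule sum.cong[OF refl]) (simp flip: scaleC_add_left of_nat_add del: of_nat_Suc)
  also have "(\<Sum>i\<le>Suc n. of_nat i *\<^sub>C ?e i (Suc n - i)) = (\<Sum>i\<le>n. \<Omega> (?e i (n - i)))"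
    by (subst sum.atMost_Suc_shift) (simp add: 1 del: of_nat_Suc)
  also have "(\<Sum>i\<le>Suc n. of_nat (Suc n - i) *\<^sub>C ?e i (Suc n - i)) = (\<Sum>i\<le>n. \<Omega>' (?e i (n - i)))"
  proof -
    have "of_nat (Suc n - i) *\<^sub>C ?e i (Suc n - i) = \<Omega>' (?e i (n - i))" if "i \<in> {..n}" for i
    proof -
      from that have "Suc n - i = Suc (n - i)" by auto
      then show ?thesis by (simp only: 2)
    qed
    then have "(\<Sum>i\<le>n. of_nat (Suc n - i) *\<^sub>C ?e i (Suc n - i)) = (\<Sum>i\<le>n. \<Omega>' (?e i (n - i)))"
      by (rule sum.cong[OF refl])
    then show ?thesis
      by (simp only: sum.atMost_Suc diff_self_eq_0 of_nat_0 complex_space.scale_zero_left add_0_right)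
  qed
  also have "(\<Sum>i\<le>n. \<Omega> (?e i (n - i))) + (\<Sum>i\<le>n. \<Omega>' (?e i (n - i))) =
      \<Omega> (exp_term (\<lambda>x. \<Omega> x + \<Omega>' x) n x) + \<Omega>' (exp_term (\<lambda>x. \<Omega> x + \<Omega>' x) n x)"
    by (simp add: Suc.IH complex_linear_sum[OF lin(1)] complex_linear_sum[OF lin(2)])
  also have "\<dots> = of_nat (Suc n) *\<^sub>C exp_term (\<lambda>x. \<Omega> x + \<Omega>' x) (Suc n) x"
    by (rule exp_term_Suc[OF lin', symmetric])
  finally show ?case
    by (simp del: of_nat_Suc)
qed (simp add: exp_term_0)

lemma opexp_nth: "fps_nth (opexp \<Omega> f) k = (\<Sum>i\<le>k. exp_term \<Omega> i (fps_nth f (k - i)))"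
  by (simp add: opexp_def)

lemma lambda_linear_opexp:
  assumes "complex_linear \<Omega>"
  shows "lambda_linear (opexp \<Omega>)"
proof (rule lambda_linearI)
  note e = complex_linear_simps[OF complex_linear_exp_term[OF assms]]
  show "opexp \<Omega> (x + y) = opexp \<Omega> x + opexp \<Omega> y" for x y
    by (simp add: fps_eq_iff opexp_nth e sum.distrib)
  show "opexp \<Omega> (c \<bullet>\<^sub>\<lambda> x) = c \<bullet>\<^sub>\<lambda> opexp \<Omega> x" for c x
    using sum_triangle_swap[of "\<lambda>i j l. fps_nth c j *\<^sub>C exp_term \<Omega> i (fps_nth x l)"]
    by (simp add: fps_eq_iff opexp_nth e fps_scale_def complex_space.scale_sum_right)
qed

lemma opexp_compose:
  assumes lin: "complex_linear \<Omega>" "complex_linear \<Omega>'" and comm: "\<And>x. \<Omega> (\<Omega>' x) = \<Omega>' (\<Omega> x)"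
  shows "opexp \<Omega> (opexp \<Omega>' f) = opexp (\<lambda>x. \<Omega> x + \<Omega>' x) f"
  using sum_triangle[of "\<lambda>i j l. exp_term \<Omega> i (exp_term \<Omega>' j (fps_nth f l))"]
  by (simp add: fps_eq_iff opexp_nth exp_term_add[OF assms]
      complex_linear_sum[OF complex_linear_exp_term[OF lin(1)]])

lemma exp_term_zero: "exp_term (\<lambda>_. 0) n x = (if n = 0 then x else 0)"
  by (cases n) (simp_all add: exp_term_def scaleC_one)

lemma opexp_zero: "opexp (\<lambda>_. 0) f = f"
  by (simp add: fps_eq_iff opexp_nth exp_term_zero if_distrib[of "\<lambda>n. n = _"] cong: if_cong)

lemma opexp_inverse:
  assumes "complex_linear \<Omega>"
  shows "opexp \<Omega> (opexp (\<lambda>x. - \<Omega> x) f) = f" "opexp (\<lambda>x. - \<Omega> x) (opexp \<Omega> f) = f"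
  by (simp_all add: opexp_compose assms complex_linear_uminus complex_linear_minus opexp_zero)

lemma fps_map_opexp:
  assumes "complex_linear M" "\<And>x. M (\<Omega> x) = \<Omega>' (M x)"
  shows "fps_map M (opexp \<Omega> f) = opexp \<Omega>' (fps_map M f)"
  by (simp add: fps_eq_iff fps_map_nth opexp_nth complex_linear_sum[OF assms(1)]
      exp_term_intertwine[of M \<Omega> \<Omega>', OF assms])

text \<open>Because the operators commute, powers are converted one factor at a time: under
  \<open>M\<close> the outermost \<Omega> becomes \<Omega>', which is then moved inside. This
  handles multiplication of two legs, through which an operator on a single leg need not
  descend.\<close>

lemma fps_map_opexp_cong:
  assumes "complex_linear M" "\<And>x. M (\<Omega> x) = M (\<Omega>' x)" "\<And>x. \<Omega> (\<Omega>' x) = \<Omega>' (\<Omega> x)"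
  shows "fps_map M (opexp \<Omega> f) = fps_map M (opexp \<Omega>' f)"
proof -
  have comm: "(\<Omega> ^^ n) (\<Omega>' x) = \<Omega>' ((\<Omega> ^^ n) x)" for n x
    by (induction n) (simp_all add: assms(3))
  have "M ((\<Omega> ^^ n) x) = M ((\<Omega>' ^^ n) x)" for n x
    by (induction n arbitrary: x) (simp, metis assms(2) comm funpow.simps(2) funpow_swap1 o_apply)
  then show ?thesis
    by (simp add: fps_eq_iff fps_map_nth opexp_nth complex_linear_sum[OF assms(1)] exp_term_def
        complex_linear_scale[OF assms(1)])
qed

text \<open>Agreement is required only on a set that contains the coefficients and is stable under
  one of the operators, such as a centraliser.\<close>

lemma opexp_cong_on:
  assumes "\<And>x. x \<in> W \<Longrightarrow> \<Omega> x = \<Omega>' x" "\<And>x. x \<in> W \<Longrightarrow> \<Omega>' x \<in> W" "\<And>n. fps_nth f n \<in> W"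
  shows "opexp \<Omega> f = opexp \<Omega>' f"
proof -
  have W: "(\<Omega>' ^^ n) x \<in> W" if "x \<in> W" for n x
    by (induction n) (simp_all add: assms that)
  have "(\<Omega> ^^ n) x = (\<Omega>' ^^ n) x" if "x \<in> W" for n x
    by (induction n) (simp_all add: assms W that)
  then show ?thesis
    by (simp add: fps_eq_iff opexp_nth exp_term_def assms(3))
qed

lemma opexp_fixed:
  assumes "\<And>n. \<Omega> (fps_nth f n) = 0" "complex_linear \<Omega>"
  shows "opexp \<Omega> f = f"
  using opexp_cong_on[of "{x. \<Omega> x = 0}" \<Omega> "\<lambda>_. 0" f]
  by (simp add: assms opexp_zero complex_linear_zero)

text \<open>For integrands that are themselves series, as in the star product of two series: an
  exponent on the argument of \<phi> becomes one acting on the coefficients of its values.\<close>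

lemma fps_ext_opexp:
  assumes "complex_linear \<phi>" "complex_linear \<Omega>" "complex_linear \<Theta>"
    and "\<And>x. \<phi> (\<Omega> x) = fps_map \<Theta> (\<phi> x)"
  shows "fps_ext \<phi> (opexp \<Omega> f) = opexp \<Theta> (fps_ext \<phi> f)"
proof (rule lambda_linear_eqI[where z = f])
  show "lambda_linear (\<lambda>f. fps_ext \<phi> (opexp \<Omega> f))" "lambda_linear (\<lambda>f. opexp \<Theta> (fps_ext \<phi> f))"
    using lambda_linear_compose[OF lambda_linear_fps_ext lambda_linear_opexp]
      lambda_linear_compose[OF lambda_linear_opexp lambda_linear_fps_ext] assms(1-3) by blast+
  fix x
  have pow: "fps_nth (\<phi> ((\<Omega> ^^ n) x)) k = (\<Theta> ^^ n) (fps_nth (\<phi> x) k)" for n k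
    by (induction n) (simp_all add: assms(4) fps_map_nth)
  have c: "fps_nth (opexp \<Omega> (fps_const x)) n = exp_term \<Omega> n x" for n
  proof -
    have "(\<Sum>i\<le>n. exp_term \<Omega> i (fps_nth (fps_const x) (n - i))) = (\<Sum>i\<le>n. if i = n then exp_term \<Omega> n x else 0)"
      by (rule sum.cong) (auto simp: complex_linear_zero[OF complex_linear_exp_term[OF assms(2)]])
    then show ?thesis by (simp add: opexp_nth)
  qed
  show "fps_ext \<phi> (opexp \<Omega> (fps_const x)) = opexp \<Theta> (fps_ext \<phi> (fps_const x))"
    by (simp add: fps_eq_iff fps_ext_def[of _ "opexp _ _"] fps_ext_const assms(1) opexp_nth[of \<Theta>] c
        exp_term_def complex_linear_scale[OF assms(1)] scaleC_fps_def pow)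
qed

text \<open>Starting from 1, all terms stay in the centraliser of \<open>a\<close>, where left and
  right multiplication by \<open>a\<close> coincide.\<close>

lemma opexp_mult_right_one:
  "opexp (\<lambda>x. x * a) 1 = opexp (\<lambda>x. a * x) 1" for a :: "'a::complex_algebra_1"
  by (rule opexp_cong_on[of "{x. x * a = a * x}"]) (simp_all add: mult.assoc)

lemma opexp_mult_left: "opexp (\<lambda>x. a * x) f = opexp (\<lambda>x. a * x) 1 * f"
  and opexp_mult_right: "opexp (\<lambda>x. x * a) f = f * opexp (\<lambda>x. a * x) 1"
  for a :: "'a::complex_algebra_1"
proof -
  show "opexp (\<lambda>x. a * x) f = opexp (\<lambda>x. a * x) 1 * f"
  proof (rule lambda_linear_eqI[where z = f])
    show "lambda_linear (opexp (\<lambda>x. a * x))" "lambda_linear (\<lambda>f. opexp (\<lambda>x. a * x) 1 * f)"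
      by (intro lambda_linear_opexp complex_linear_intros lambda_linear_mult_left lambda_linear_id)+
    fix x
    have "fps_map (\<lambda>y. y * x) (opexp (\<lambda>y. a * y) 1) = opexp (\<lambda>y. a * y) (fps_map (\<lambda>y. y * x) 1)"
      by (rule fps_map_opexp) (simp_all add: complex_linear_intros mult.assoc)
    then show "opexp (\<lambda>x. a * x) (fps_const x) = opexp (\<lambda>x. a * x) 1 * fps_const x"
      by (simp flip: mult_fps_const)
  qed
  show "opexp (\<lambda>x. x * a) f = f * opexp (\<lambda>x. a * x) 1"
  proof (rule lambda_linear_eqI[where z = f])
    show "lambda_linear (opexp (\<lambda>x. x * a))" "lambda_linear (\<lambda>f. f * opexp (\<lambda>x. a * x) 1)"
      by (intro lambda_linear_opexp complex_linear_intros lambda_linear_mult_right lambda_linear_id)+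
    fix x
    have "fps_map (\<lambda>y. x * y) (opexp (\<lambda>y. y * a) 1) = opexp (\<lambda>y. y * a) (fps_map (\<lambda>y. x * y) 1)"
      by (rule fps_map_opexp) (simp_all add: complex_linear_intros mult.assoc)
    then show "opexp (\<lambda>x. x * a) (fps_const x) = fps_const x * opexp (\<lambda>x. a * x) 1"
      by (simp add: opexp_mult_right_one flip: fps_const_mult_fps_map)
  qed
qed

lemma opexp_mult_one_nth:
  "fps_nth (opexp (\<lambda>x. a * x) 1) n = (1 / fact n) *\<^sub>C (a :: 'a::complex_algebra_1) ^ n"
proof -
  have "((\<lambda>x. a * x) ^^ n) x = a ^ n * x" for n x
    by (induction n) (simp_all add: mult.assoc)
  then have "(\<Sum>i\<le>n. exp_term (\<lambda>x. a * x) i (fps_nth 1 (n - i))) =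
      (\<Sum>i\<le>n. if i = n then (1 / fact n) *\<^sub>C a ^ n else 0)"
    by (intro sum.cong) (auto simp: exp_term_def)
  then show ?thesis by (simp add: opexp_nth)
qed

subsection \<open>Rescaled exponentials\<close>

text \<open>
  The factor of the deformation parameter in \<open>\<F>\<^sup>-\<^sup>1\<close> is \<open>\<i>/2\<close>; absorbing it leaves only
  integer coefficients in all operators below.
\<close>

definition texp :: "('a::complex_space \<Rightarrow> 'a) \<Rightarrow> 'a fps \<Rightarrow> 'a fps" where
  "texp A = opexp (\<lambda>x. (\<i> / 2) *\<^sub>C A x)"

lemma lambda_linear_texp: "complex_linear A \<Longrightarrow> lambda_linear (texp A)"
  unfolding texp_def by (intro lambda_linear_opexp complex_linear_scaleC)

lemma texp_compose:
  assumes "complex_linear A" "complex_linear B" "\<And>x. A (B x) = B (A x)"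
  shows "texp A (texp B f) = texp (\<lambda>x. A x + B x) f"
  unfolding texp_def
  by (subst opexp_compose)
     (simp_all add: assms complex_linear_scaleC complex_linear_scale scaleC_add_right)

lemma texp_inverse:
  assumes "complex_linear A"
  shows "texp A (texp (\<lambda>x. - A x) f) = f" "texp (\<lambda>x. - A x) (texp A f) = f"
  using opexp_inverse[OF complex_linear_scaleC[OF assms], of "\<i> / 2" f]
  by (simp_all add: texp_def)

lemma fps_map_texp:
  assumes "complex_linear M" "\<And>x. M (A x) = B (M x)"
  shows "fps_map M (texp A f) = texp B (fps_map M f)"
  unfolding texp_def by (rule fps_map_opexp) (simp_all add: assms complex_linear_scale)

lemma fps_map_texp_cong:
  assumes "complex_linear M" "\<And>x. M (A x) = M (B x)" "\<And>x. A (B x) = B (A x)"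
    and "complex_linear A" "complex_linear B"
  shows "fps_map M (texp A f) = fps_map M (texp B f)"
  unfolding texp_def by (rule fps_map_opexp_cong) (simp_all add: assms complex_linear_scale)

lemma texp_cong_on:
  assumes "\<And>x. x \<in> W \<Longrightarrow> A x = B x" "\<And>x. x \<in> W \<Longrightarrow> (\<i> / 2) *\<^sub>C B x \<in> W" "\<And>n. fps_nth f n \<in> W"
  shows "texp A f = texp B f"
  unfolding texp_def by (rule opexp_cong_on[of W]) (simp_all add: assms)

lemma texp_fixed:
  assumes "\<And>n. A (fps_nth f n) = 0" "complex_linear A"
  shows "texp A f = f"
  unfolding texp_def by (rule opexp_fixed) (simp_all add: assms complex_linear_scaleC)

lemma fps_ext_texp:
  assumes "complex_linear \<phi>" "complex_linear A" "complex_linear B"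
    and "\<And>x. \<phi> (A x) = fps_map B (\<phi> x)"
  shows "fps_ext \<phi> (texp A f) = texp B (fps_ext \<phi> f)"
  unfolding texp_def
  by (rule fps_ext_opexp)
     (simp_all add: assms complex_linear_scaleC complex_linear_scale scaleC_fps_def fps_map_def fps_eq_iff)

text \<open>Turns an exponential on one leg into an exponential on the tensor product, where
  exponents from different legs can be added.\<close>

lemma fps_tens_texp_left:
  assumes "complex_linear A'" "\<And>x y. A' (x \<otimes> y) = A x \<otimes> y"
  shows "texp A f \<otimes>\<^sub>\<lambda> g = texp A' (f \<otimes>\<^sub>\<lambda> g)"
proof -
  let ?s = "\<lambda>A x. (\<i> / 2) *\<^sub>C A x"
  have lin: "complex_linear (exp_term (?s A') n)" for n
    by (intro complex_linear_exp_term complex_linear_scaleC assms)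
  have e: "exp_term (?s A) n x \<otimes> y = exp_term (?s A') n (x \<otimes> y)" for n x y
    by (rule exp_term_intertwine)
       (simp_all add: complex_linear_tens_left complex_linear_id assms scaleC_tens)
  show ?thesis
    using sum_triangle[of "\<lambda>i j l. exp_term (?s A') i (fps_nth f j \<otimes> fps_nth g l)"]
    by (simp add: texp_def fps_eq_iff fps_tens_def opexp_nth complex_linear_sum[OF lin] e
        complex_linear_sum[OF complex_linear_tens_left[OF complex_linear_id]])
qed

lemma fps_tens_texp_right:
  assumes "complex_linear A'" "\<And>x y. A' (x \<otimes> y) = x \<otimes> A y"
  shows "f \<otimes>\<^sub>\<lambda> texp A g = texp A' (f \<otimes>\<^sub>\<lambda> g)"
proof -
  let ?s = "\<lambda>A x. (\<i> / 2) *\<^sub>C A x"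
  have lin: "complex_linear (exp_term (?s A') n)" for n
    by (intro complex_linear_exp_term complex_linear_scaleC assms)
  have e: "x \<otimes> exp_term (?s A) n y = exp_term (?s A') n (x \<otimes> y)" for n x y
    by (rule exp_term_intertwine)
       (simp_all add: complex_linear_tens_right complex_linear_id assms scaleC_tens tens_scaleC_right)
  show ?thesis
    using sum_triangle_swap[of "\<lambda>i j l. exp_term (?s A') j (fps_nth f i \<otimes> fps_nth g l)"]
    by (simp add: texp_def fps_eq_iff fps_tens_def opexp_nth complex_linear_sum[OF lin] e
        complex_linear_sum[OF complex_linear_tens_right[OF complex_linear_id]])
qed

text \<open>The exponential of (\<i>\<lambda>/2) p as an element, in contrast to the operator
  exponential \<open>texp\<close>; multiplication by it on either side is again a
  \<open>texp\<close>.\<close>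

definition expo :: "'a::complex_algebra_1 \<Rightarrow> 'a fps" where
  "expo p = texp (\<lambda>x. p * x) 1"

lemma expo_mult_left: "texp (\<lambda>x. p * x) f = expo p * f"
  and expo_mult_right: "texp (\<lambda>x. x * p) f = f * expo p"
  using opexp_mult_left[of "(\<i> / 2) *\<^sub>C p" f] opexp_mult_right[of "(\<i> / 2) *\<^sub>C p" f]
  by (simp_all add: expo_def texp_def mult_scaleC_left mult_scaleC_right)

lemma expo_mult: "p * q = q * p \<Longrightarrow> expo p * expo q = expo (p + q)"
proof -
  assume pq: "p * q = q * p"
  have "p * (q * x) = q * (p * x)" for x
    using pq by (metis mult.assoc)
  then have "texp (\<lambda>x. p * x) (texp (\<lambda>x. q * x) 1) = texp (\<lambda>x. p * x + q * x) 1"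
    by (intro texp_compose complex_linear_intros)
  then show ?thesis
    by (simp add: expo_mult_left expo_def[of q, symmetric] expo_def[of "p + q"] distrib_right)
qed

lemma expo_zero: "expo 0 = 1"
  unfolding expo_def by (rule texp_fixed) (simp_all add: complex_linear_mult_left[OF complex_linear_id])

lemma expo_minus: "expo p * expo (- p) = 1" "expo (- p) * expo p = 1"
  by (simp_all add: expo_mult expo_zero)

lemma ring_inverse_expo: "ring_inverse (expo p) = expo (- p)"
  unfolding ring_inverse_def
proof (rule the_equality)
  show "y = expo (- p)" if "expo p * y = 1 \<and> y * expo p = 1" for y
    using that by (metis expo_minus(1) mult.assoc mult.left_neutral mult.right_neutral)
qed (simp add: expo_minus)

lemma scaleC_power: "(s *\<^sub>C a) ^ n = s ^ n *\<^sub>C a ^ n" for a :: "'a::complex_algebra_1"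
  by (induction n) (simp_all add: scaleC_one mult_scaleC_left mult_scaleC_right scaleC_scaleC mult.commute)

lemma expo_nth: "fps_nth (expo p) n = ((\<i> / 2) ^ n / fact n) *\<^sub>C p ^ n"
  using opexp_mult_one_nth[of "(\<i> / 2) *\<^sub>C p" n]
  by (simp add: expo_def texp_def scaleC_power scaleC_scaleC mult_scaleC_left)

text \<open>The main device for sums over the legs of \<F>: a contraction \<open>N\<close> that
  turns multiplication by the exponent into an operator \<open>A\<close> turns the whole exponential
  into that of \<open>A\<close>, applied to the value of \<open>N\<close> at the unit.\<close>

lemma fps_map_expo:
  assumes "complex_linear N" "\<And>y. N (p * y) = A (N y)"
  shows "fps_map N (expo p) = texp A (fps_const (N 1))"
proof -
  have "fps_map N 1 = fps_const (N 1)"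
    using fps_map_const[OF assms(1), of 1] by simp
  then show ?thesis
    unfolding expo_def by (subst fps_map_texp[where B = A]) (simp_all add: assms)
qed

lemma fps_ext_fps_map:
  assumes "complex_linear M"
  shows "fps_ext (\<lambda>y. fps_map M (\<phi> y)) z = fps_map M (fps_ext \<phi> z)"
  by (simp add: fps_ext_def fps_map_def fps_eq_iff complex_linear_sum[OF assms])

lemma complex_linear_fps_map_left: "complex_bilinear B \<Longrightarrow> complex_linear (\<lambda>a. fps_map (B a) f)"
  by (rule complex_linearI)
     (simp_all add: fps_map_def fps_eq_iff scaleC_fps_def complex_linear_add[OF complex_bilinear_left]
       complex_linear_scale[OF complex_bilinear_left])

lemma complex_bilinear_fps_tens: "complex_bilinear (\<otimes>\<^sub>\<lambda>)"
  by (intro complex_bilinearI lambda_linear_imp_complex_linear lambda_linear_fps_tens_left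
      lambda_linear_fps_tens_right lambda_linear_id)

text \<open>The order-preserving form of \<lambda>-adic continuity; it lets uniqueness arguments
  proceed one order at a time.\<close>

lemma lambda_linear_nth_cong:
  assumes "lambda_linear \<Phi>" "\<And>j. j \<le> k \<Longrightarrow> fps_nth f j = fps_nth g j"
  shows "fps_nth (\<Phi> f) k = fps_nth (\<Phi> g) k"
  using assms(2)
proof (induction k arbitrary: f g)
  case 0
  then show ?case
    by (subst fps_shift1_decompose[of f], subst fps_shift1_decompose[of g])
       (simp add: lambda_linear_add[OF assms(1)] lambda_linear_scale[OF assms(1)] fps_scale_X_nth)
next
  case (Suc k)
  have "fps_nth (\<Phi> (fps_shift1 f)) k = fps_nth (\<Phi> (fps_shift1 g)) k"
    by (rule Suc.IH) (simp add: fps_shift1_def Suc.prems)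
  then show ?case
    by (subst fps_shift1_decompose[of f], subst fps_shift1_decompose[of g])
       (simp add: lambda_linear_add[OF assms(1)] lambda_linear_scale[OF assms(1)] fps_scale_X_nth
         Suc.prems)
qed

section \<open>Abelian twists\<close>

locale abelian_twist =
  fixes V1 V2 :: "'x::complex_lie_algebra"
  assumes lie_zero: "lie V1 V2 = 0"
begin

abbreviation v1 where "v1 \<equiv> gen V1"
abbreviation v2 where "v2 \<equiv> gen V2"

text \<open>V1 and V2 in the first leg (\<open>a1\<close>, \<open>a2\<close>) and in the second leg
  (\<open>b1\<close>, \<open>b2\<close>). Once all operators are left and right multiplications by
  these four commuting elements, both commutation of operators and equality of exponents are decided
  by simplification.\<close>

definition a1 :: "('x uea, 'x uea) tensor" where "a1 = v1 \<otimes> 1"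
definition a2 :: "('x uea, 'x uea) tensor" where "a2 = v2 \<otimes> 1"
definition b1 :: "('x uea, 'x uea) tensor" where "b1 = 1 \<otimes> v1"
definition b2 :: "('x uea, 'x uea) tensor" where "b2 = 1 \<otimes> v2"

lemmas ab_defs = a1_def a2_def b1_def b2_def

lemma v_commute: "v2 * v1 = v1 * v2"
  using gen_lie[of V1 V2] by (simp add: lie_zero complex_linear_zero[OF complex_linear_gen])

lemma v_left_commute: "v2 * (v1 * x) = v1 * (v2 * x)"
  by (simp add: v_commute flip: mult.assoc)

lemma ab_commute:
  "a2 * a1 = a1 * a2" "b1 * a1 = a1 * b1" "b2 * a1 = a1 * b2"
  "b1 * a2 = a2 * b1" "b2 * a2 = a2 * b2" "b2 * b1 = b1 * b2"
  by (simp_all add: ab_defs tens_mult v_commute)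

lemma ab_left_commute:
  "a2 * (a1 * x) = a1 * (a2 * x)" "b1 * (a1 * x) = a1 * (b1 * x)" "b2 * (a1 * x) = a1 * (b2 * x)"
  "b1 * (a2 * x) = a2 * (b1 * x)" "b2 * (a2 * x) = a2 * (b2 * x)" "b2 * (b1 * x) = b1 * (b2 * x)"
  by (simp_all add: ab_commute flip: mult.assoc)

lemmas ab_simps = algebra_simps ab_commute ab_left_commute

definition P where "P = a1 * b2 - a2 * b1"

abbreviation F where "F \<equiv> twist V1 V2"

text \<open>\<open>expo\<close> carries \<i>/2 where the twist carries -\<i>/2, hence the sign:
  \<open>P\<close> is the exponent of the inverse twist.\<close>

lemma twist_expo: "F = expo (- P)"
proof (rule fps_ext)
  fix n
  have "P = gen V1 \<otimes> gen V2 - gen V2 \<otimes> gen V1"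
    by (simp add: P_def ab_defs tens_mult)
  moreover have "- P = (- 1) *\<^sub>C P"
    by (simp add: scaleC_one)
  then have "(- P) ^ n = (- 1) ^ n *\<^sub>C P ^ n"
    by (simp only: scaleC_power)
  moreover have "(- \<i> / 2) ^ n = ((- 1) * (\<i> / 2)) ^ n"
    by (rule arg_cong[of _ _ "\<lambda>z. z ^ n"]) simp
  then have "(\<i> / 2) ^ n / fact n * (- 1) ^ n = (- \<i> / 2) ^ n / (fact n :: complex)"
    unfolding power_mult_distrib by simp
  ultimately show "fps_nth F n = fps_nth (expo (- P)) n"
    by (simp add: twist_def expo_nth scaleC_scaleC)
qed

lemma ring_inverse_twist: "ring_inverse F = expo P"
  by (simp add: twist_expo ring_inverse_expo)

lemma complex_linear_flip: "complex_linear (flip :: ('a::complex_algebra_1, 'b::complex_algebra_1) tensor \<Rightarrow> _)"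
  and flip_tens: "flip (a \<otimes> b) = b \<otimes> a"
proof -
  have "complex_bilinear (\<lambda>(a :: 'p::complex_algebra_1) (b :: 'q::complex_algebra_1). b \<otimes> a)"
    by (intro complex_bilinearI complex_linear_tens_left complex_linear_tens_right complex_linear_id)
  note * = complex_linear_tensor_lift[OF this] tensor_lift_tens[OF this]
  show "complex_linear (flip :: ('a, 'b) tensor \<Rightarrow> _)" "flip (a \<otimes> b) = b \<otimes> a"
    unfolding flip_def by (rule *)+
qed

text \<open>Exchanging the legs reverses the sign of \<open>P\<close>, so the flipped twist equals
  the inverse twist, R is the square of the latter, and the inverse of R has exponent -2P.\<close>

lemma inverse_R_matrix: "ring_inverse (R_matrix F) = expo (- (P + P))"
proof -
  have "flip ((- P) * y) = P * flip y" for y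
    by (induction y rule: tensor_induct)
       (simp_all add: P_def ab_defs algebra_simps tens_mult complex_linear_simps[OF complex_linear_flip]
         flip_tens)
  then have "fps_map flip F = texp (\<lambda>x. P * x) (fps_const (flip 1))"
    unfolding twist_expo by (rule fps_map_expo[OF complex_linear_flip])
  also have "flip 1 = (1 :: ('x uea, 'x uea) tensor)"
    by (simp add: flip_tens flip: one_tensor)
  finally have "fps_map flip F = expo P"
    by (simp add: expo_def)
  then have "R_matrix F = expo (P + P)"
    by (simp add: R_matrix_def ring_inverse_twist expo_mult)
  then show ?thesis by (simp only: ring_inverse_expo)
qed

definition \<delta> :: "'x uea \<Rightarrow> 'x uea" where "\<delta> x = v1 * x * v2 - v2 * x * v1"

lemma complex_linear_\<delta>: "complex_linear \<delta>"
  unfolding \<delta>_def[abs_def] by (intro complex_linear_intros)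

lemma \<delta>_one: "\<delta> 1 = 0"
  by (simp add: \<delta>_def v_commute)

text \<open>The antipode reverses order and sign in the second leg, so left multiplication by v in
  that leg becomes right multiplication of the sandwich by -v.\<close>

lemma \<delta>_sandwich:
  "tensor_lift (\<lambda>a b. a * x * antipode b) (P * y) = - \<delta> (tensor_lift (\<lambda>a b. a * x * antipode b) y)"
proof -
  define J where "J = tensor_lift (\<lambda>a b. a * x * antipode b)"
  have lin: "complex_linear J"
    unfolding J_def by (rule complex_linear_tensor_lift[OF complex_bilinear_adj_integrand])
  have J_tens: "J (a \<otimes> b) = a * x * antipode b" for a b
    unfolding J_def by (rule tensor_lift_tens[OF complex_bilinear_adj_integrand])
  have "J (P * y) = - \<delta> (J y)"
  proof (induction y rule: tensor_induct)
    case (tens a b)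
    show ?case
      by (simp add: P_def ab_defs algebra_simps tens_mult complex_linear_simps[OF lin] J_tens \<delta>_def
          antipode_mult antipode_gen)
  next
    case (add s t)
    then show ?case
      by (simp add: distrib_left complex_linear_simps[OF lin] complex_linear_add[OF complex_linear_\<delta>])
  qed
  then show ?thesis by (simp add: J_def)
qed

text \<open>The sandwich with filling 1 starts at 1, where \<delta> vanishes because V1 and V2
  commute.\<close>

lemma chi_twist: "chi F = 1"
proof -
  let ?J = "tensor_lift (\<lambda>a b. a * antipode b)"
  have J: "tensor_lift (\<lambda>a b. a * 1 * antipode b) = ?J" by simp
  have lin: "complex_linear ?J"
    using complex_linear_tensor_lift[OF complex_bilinear_adj_integrand[of 1]] by simp
  have "?J ((- P) * y) = \<delta> (?J y)" for y
    using \<delta>_sandwich[of 1 y] by (simp add: complex_linear_minus[OF lin])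
  then have "chi F = texp \<delta> (fps_const (?J 1))"
    unfolding chi_def twist_expo by (rule fps_map_expo[OF lin])
  also have "?J 1 = 1"
    using tensor_lift_tens[OF complex_bilinear_adj_integrand[of 1], of 1 1]
    by (simp add: one_tensor antipode_one)
  also have "texp \<delta> (fps_const 1) = 1"
    by (rule trans[OF texp_fixed])
       (simp_all add: complex_linear_\<delta> \<delta>_one complex_linear_zero[OF complex_linear_\<delta>])
  finally show ?thesis .
qed

definition D where "D = texp \<delta>"
definition X where "X = texp (\<lambda>x. - \<delta> x)"

lemma lambda_linear_D: "lambda_linear D" and lambda_linear_X: "lambda_linear X"
  unfolding D_def X_def by (intro lambda_linear_texp complex_linear_uminus complex_linear_\<delta>)+

lemma D_X: "D (X f) = f" and X_D: "X (D f) = f"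
  unfolding D_def X_def by (rule texp_inverse[OF complex_linear_\<delta>])+

text \<open>The prescribed values of the structure maps feed \<open>X_map\<close> with single legs,
  hence with constants. As \<chi> = 1 and the antipode is its own inverse, the integrand is the
  sandwich of \<open>\<delta>_sandwich\<close>.\<close>

lemma X_map_const: "X_map F (fps_const x) = X (fps_const x)"
proof -
  let ?J = "tensor_lift (\<lambda>a b. a * x * antipode b)"
  have lin: "complex_linear ?J"
    by (rule complex_linear_tensor_lift[OF complex_bilinear_adj_integrand])
  have "tensor_lift (\<lambda>a b. fps_const (a * x * antipode b)) = (\<lambda>t. fps_const (?J t))"
    by (rule ext, rule tensor_lift_linear_factor[OF complex_bilinear_adj_integrand complex_linear_fps_const])
  then have "X_map F (fps_const x) = fps_ext (\<lambda>t. fps_const (?J t)) (expo P)"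
    by (simp add: X_map_def chi_twist inv_antipode ring_inverse_twist)
  also have "\<dots> = fps_map ?J (expo P)"
    by (rule fps_ext_fps_const[OF lin])
  also have "\<dots> = X (fps_const (?J 1))"
    unfolding X_def by (rule fps_map_expo[OF lin \<delta>_sandwich])
  also have "?J 1 = x"
    using tensor_lift_tens[OF complex_bilinear_adj_integrand, of x 1 1]
    by (simp add: one_tensor antipode_one)
  finally show ?thesis .
qed

subsection \<open>The star product\<close>

text \<open>ad V1 on the first leg and ad V2 on the second, minus the same with V1 and V2 exchanged:
  the exponent through which the inverse twist acts on a pair of factors.\<close>

definition B where
  "B y = (a1 * (b2 * y - y * b2) - (b2 * y - y * b2) * a1)
       - (a2 * (b1 * y - y * b1) - (b1 * y - y * b1) * a2)"

lemma complex_linear_B: "complex_linear B"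
  unfolding B_def[abs_def] by (intro complex_linear_intros)

lemma B_tens:
  "B (x \<otimes> y) = (v1 * x - x * v1) \<otimes> (v2 * y - y * v2) - (v2 * x - x * v2) \<otimes> (v1 * y - y * v1)"
  by (simp add: B_def ab_defs algebra_simps tens_mult
      complex_linear_diff[OF complex_linear_tens_left[OF complex_linear_id]]
      complex_linear_diff[OF complex_linear_tens_right[OF complex_linear_id]])

lemma star_texp: "star F \<xi> \<eta> = fps_map (tensor_lift (*)) (texp B (\<xi> \<otimes>\<^sub>\<lambda> \<eta>))"
proof -
  let ?m = "tensor_lift (*) :: ('x uea, 'x uea) tensor \<Rightarrow> _"
  let ?b = "\<lambda>a b. fps_map (adj a) \<xi> \<otimes>\<^sub>\<lambda> fps_map (adj b) \<eta>"
  let ?\<phi> = "tensor_lift ?b"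
  have m: "complex_linear ?m"
    by (rule complex_linear_tensor_lift[OF complex_bilinear_mult])
  have b: "complex_bilinear ?b"
    by (intro complex_bilinear_comp[OF complex_bilinear_fps_tens] complex_linear_fps_map_left
        complex_bilinear_adj)
  have lin: "complex_linear ?\<phi>"
    by (rule complex_linear_tensor_lift[OF b])
  have "tensor_lift (\<lambda>a b. fps_map (adj a) \<xi> * fps_map (adj b) \<eta>) t = fps_map ?m (?\<phi> t)" for t
    by (simp flip: fps_map_mult_tens
        tensor_lift_linear_factor[OF b lambda_linear_imp_complex_linear[OF lambda_linear_fps_map[OF m]]])
  then have "tensor_lift (\<lambda>a b. fps_map (adj a) \<xi> * fps_map (adj b) \<eta>) = (\<lambda>t. fps_map ?m (?\<phi> t))"
    by (rule ext)
  then have "star F \<xi> \<eta> = fps_map ?m (fps_ext ?\<phi> (expo P))"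
    by (simp add: star_def ring_inverse_twist fps_ext_fps_map[OF m])
  also have "fps_ext ?\<phi> (expo P) = texp B (fps_ext ?\<phi> 1)"
    unfolding expo_def
  proof (rule fps_ext_texp[OF lin _ complex_linear_B])
    show "complex_linear (\<lambda>y. P * y)" by (intro complex_linear_intros)
    show "?\<phi> (P * y) = fps_map B (?\<phi> y)" for y
    proof (induction y rule: tensor_induct)
      case (tens a b)
      have "?\<phi> (P * (a \<otimes> b)) = ?b (v1 * a) (v2 * b) - ?b (v2 * a) (v1 * b)"
        by (simp add: P_def ab_defs left_diff_distrib tens_mult complex_linear_diff[OF lin]
            tensor_lift_tens[OF b])
      also have "\<dots> = fps_map B (?b a b)"
        by (simp add: fps_eq_iff fps_map_def fps_tens_def adj_gen_mult B_tens
            complex_linear_sum[OF complex_linear_B] sum_subtractf)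
      finally show ?case by (simp add: tensor_lift_tens[OF b])
    next
      case (add s t)
      then show ?case
        by (simp add: distrib_left complex_linear_add[OF lin]
            lambda_linear_add[OF lambda_linear_fps_map[OF complex_linear_B]])
    qed
  qed
  also have "fps_ext ?\<phi> 1 = \<xi> \<otimes>\<^sub>\<lambda> \<eta>"
    using fps_ext_const[OF lin, of 1] tensor_lift_tens[OF b, of 1 1]
    by (simp add: one_tensor adj_one[abs_def] fps_map_ident)
  finally show ?thesis .
qed

lemma star_nth_0: "fps_nth (star F \<xi> \<eta>) 0 = fps_nth \<xi> 0 * fps_nth \<eta> 0"
  by (simp add: star_texp fps_map_nth texp_def opexp_nth exp_term_0 fps_tens_def
      tensor_lift_tens[OF complex_bilinear_mult])

text \<open>\<open>\<delta>1\<close> and \<open>\<delta>2\<close> are \<delta> on a single leg.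
  \<open>\<delta>12\<close> puts its factors on the outside of both legs, so that multiplying the
  legs turns it into \<delta> of the product.\<close>

definition \<delta>1 where "\<delta>1 y = a1 * y * a2 - a2 * y * a1"
definition \<delta>2 where "\<delta>2 y = b1 * y * b2 - b2 * y * b1"
definition \<delta>12 where "\<delta>12 y = a1 * y * b2 - a2 * y * b1"

lemma complex_linear_\<delta>1: "complex_linear \<delta>1"
  and complex_linear_\<delta>2: "complex_linear \<delta>2"
  and complex_linear_\<delta>12: "complex_linear \<delta>12"
  unfolding \<delta>1_def[abs_def] \<delta>2_def[abs_def] \<delta>12_def[abs_def] by (intro complex_linear_intros)+

lemma \<delta>1_tens: "\<delta>1 (x \<otimes> y) = \<delta> x \<otimes> y" and \<delta>2_tens: "\<delta>2 (x \<otimes> y) = x \<otimes> \<delta> y"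
  by (simp_all add: \<delta>1_def \<delta>2_def \<delta>_def ab_defs tens_mult
      complex_linear_diff[OF complex_linear_tens_left[OF complex_linear_id]]
      complex_linear_diff[OF complex_linear_tens_right[OF complex_linear_id]])

definition DD where "DD = texp (\<lambda>y. \<delta>1 y + \<delta>2 y)"
definition XX where "XX = texp (\<lambda>y. - (\<delta>1 y + \<delta>2 y))"

lemma lambda_linear_DD: "lambda_linear DD" and lambda_linear_XX: "lambda_linear XX"
  unfolding DD_def XX_def
  by (intro lambda_linear_texp complex_linear_uminus complex_linear_plus complex_linear_\<delta>1
      complex_linear_\<delta>2)+

lemma DD_XX: "DD (XX f) = f" and XX_DD: "XX (DD f) = f"
  unfolding DD_def XX_def
  by (rule texp_inverse[OF complex_linear_plus[OF complex_linear_\<delta>1 complex_linear_\<delta>2]])+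

lemma \<delta>1_\<delta>2: "\<delta>1 (\<delta>2 y) = \<delta>2 (\<delta>1 y)"
  by (simp add: \<delta>1_def \<delta>2_def ab_simps)

lemma DD_tens: "DD (\<xi> \<otimes>\<^sub>\<lambda> \<eta>) = D \<xi> \<otimes>\<^sub>\<lambda> D \<eta>"
  unfolding D_def fps_tens_texp_left[OF complex_linear_\<delta>1 \<delta>1_tens]
    fps_tens_texp_right[OF complex_linear_\<delta>2 \<delta>2_tens] DD_def
  by (subst texp_compose)
     (simp_all add: complex_linear_\<delta>1 complex_linear_\<delta>2 \<delta>1_\<delta>2 add.commute[of "\<delta>2 _"])

text \<open>After multiplication of the legs, the exponent \<open>\<delta>12\<close> coming from
  \<open>D\<close> and the exponent \<open>B\<close> of the star product add up to the Leibniz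
  expression \<delta>(a) b + a \<delta>(b). The leftover terms a v1 v2 b and a v2 v1 b cancel
  because V1 and V2 commute.\<close>

lemma D_star: "D (star F \<xi> \<eta>) = D \<xi> * D \<eta>"
proof -
  let ?m = "tensor_lift (*) :: ('x uea, 'x uea) tensor \<Rightarrow> _"
  have m: "complex_linear ?m"
    by (rule complex_linear_tensor_lift[OF complex_bilinear_mult])
  note m_tens = tensor_lift_tens[OF complex_bilinear_mult]
  have 1: "?m (\<delta>12 y) = \<delta> (?m y)" for y
    by (rule tensor_linear_eqI, rule complex_linear_compose[OF m complex_linear_\<delta>12],
        rule complex_linear_compose[OF complex_linear_\<delta> m])
       (simp add: m_tens \<delta>12_def ab_defs tens_mult complex_linear_diff[OF m] \<delta>_def mult.assoc)
  have 2: "?m (\<delta>12 y + B y) = ?m (\<delta>1 y + \<delta>2 y)" for y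
  proof (rule tensor_linear_eqI[where f = "\<lambda>y. ?m (\<delta>12 y + B y)" and g = "\<lambda>y. ?m (\<delta>1 y + \<delta>2 y)"])
    show "complex_linear (\<lambda>y. ?m (\<delta>12 y + B y))"
      by (rule complex_linear_compose[OF m complex_linear_plus[OF complex_linear_\<delta>12 complex_linear_B]])
    show "complex_linear (\<lambda>y. ?m (\<delta>1 y + \<delta>2 y))"
      by (rule complex_linear_compose[OF m complex_linear_plus[OF complex_linear_\<delta>1 complex_linear_\<delta>2]])
    show "?m (\<delta>12 (a \<otimes> b) + B (a \<otimes> b)) = ?m (\<delta>1 (a \<otimes> b) + \<delta>2 (a \<otimes> b))" for a b
      by (simp add: complex_linear_simps[OF m] m_tens \<delta>12_def B_tens \<delta>1_tens \<delta>2_tens ab_defs tens_mult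
         \<delta>_def algebra_simps v_commute v_left_commute)
  qed
  \<comment> \<open>Commutation is what allows \<open>2\<close> to be exponentiated, as that
    identity holds only after the legs are multiplied.\<close>
  have 3: "(\<lambda>y. \<delta>12 y + B y) (\<delta>1 y + \<delta>2 y) = \<delta>1 (\<delta>12 y + B y) + \<delta>2 (\<delta>12 y + B y)" for y
    by (simp add: \<delta>12_def B_def \<delta>1_def \<delta>2_def ab_simps)
  have "D (star F \<xi> \<eta>) = fps_map ?m (texp \<delta>12 (texp B (\<xi> \<otimes>\<^sub>\<lambda> \<eta>)))"
    unfolding D_def star_texp by (rule fps_map_texp[where M = ?m and A = \<delta>12 and B = \<delta>, OF m 1, symmetric])
  also have "texp \<delta>12 (texp B (\<xi> \<otimes>\<^sub>\<lambda> \<eta>)) = texp (\<lambda>y. \<delta>12 y + B y) (\<xi> \<otimes>\<^sub>\<lambda> \<eta>)"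
    by (rule texp_compose) (simp_all add: complex_linear_\<delta>12 complex_linear_B \<delta>12_def B_def ab_simps)
  also have "fps_map ?m \<dots> = fps_map ?m (DD (\<xi> \<otimes>\<^sub>\<lambda> \<eta>))"
    unfolding DD_def
    by (rule fps_map_texp_cong[where M = ?m, OF m 2 3
          complex_linear_plus[OF complex_linear_\<delta>12 complex_linear_B]
          complex_linear_plus[OF complex_linear_\<delta>1 complex_linear_\<delta>2]])
  finally show ?thesis
    by (simp add: DD_tens fps_map_mult_tens)
qed

lemma star_eq: "star F \<xi> \<eta> = X (D \<xi> * D \<eta>)"
  by (metis D_star X_D)

lemma D_one: "D 1 = 1"
  unfolding D_def
  by (rule texp_fixed) (auto simp: complex_linear_\<delta> \<delta>_one complex_linear_zero[OF complex_linear_\<delta>])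

lemma X_one: "X 1 = 1"
  by (metis D_one X_D)

lemma star_assoc: "star F (star F a b) c = star F a (star F b c)"
  by (simp add: star_eq D_X mult.assoc)

lemma star_one: "star F 1 a = a" "star F a 1 = a"
  by (simp_all add: star_eq D_one X_D)

lemma lambda_linear_star_left: "lambda_linear (\<lambda>\<xi>. star F \<xi> \<eta>)"
  and lambda_linear_star_right: "lambda_linear (\<lambda>\<eta>. star F \<xi> \<eta>)"
  unfolding star_eq
  by (intro lambda_linear_compose[OF lambda_linear_X] lambda_linear_mult_left lambda_linear_mult_right
      lambda_linear_D)+

text \<open>The nested extensions are collapsed by uniqueness: the closed form is \<lambda>-linear
  in both arguments and agrees with the definition on pure tensors, by \<open>D_star\<close> on each
  leg.\<close>

lemma tensor_star_eq: "tensor_star F s t = XX (DD s * DD t)"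
proof -
  let ?G = "\<lambda>s t. XX (DD s * DD t)"
  have lin1: "lambda_linear (\<lambda>s. ?G s t)" and lin2: "lambda_linear (\<lambda>t. ?G s t)" for s t
    by (intro lambda_linear_compose[OF lambda_linear_XX] lambda_linear_mult_left
        lambda_linear_mult_right lambda_linear_DD)+
  have clin1: "complex_linear (\<lambda>s. ?G (fps_const s) t)" and clin2: "complex_linear (\<lambda>t. ?G s (fps_const t))" for s t
    using complex_linear_compose[OF lambda_linear_imp_complex_linear[OF lin1] complex_linear_fps_const]
      complex_linear_compose[OF lambda_linear_imp_complex_linear[OF lin2] complex_linear_fps_const]
    by auto
  have pure: "?G (fps_const (a \<otimes> b)) (fps_const (c \<otimes> d)) =
      star F (fps_const a) (fps_const c) \<otimes>\<^sub>\<lambda> star F (fps_const b) (fps_const d)" for a b c d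
  proof -
    have "DD (star F (fps_const a) (fps_const c) \<otimes>\<^sub>\<lambda> star F (fps_const b) (fps_const d)) =
      DD (fps_const (a \<otimes> b)) * DD (fps_const (c \<otimes> d))"
      by (simp add: DD_tens D_star fps_tens_mult flip: fps_tens_const)
    then show ?thesis by (metis XX_DD)
  qed
  have "tensor_lift (\<lambda>c d. star F (fps_const a) (fps_const c) \<otimes>\<^sub>\<lambda> star F (fps_const b) (fps_const d)) =
     (\<lambda>t'. ?G (fps_const (a \<otimes> b)) (fps_const t'))" for a b
    by (rule tensor_lift_unique[OF clin2 pure])
  moreover have "tensor_lift (\<lambda>a b. ?G (fps_const (a \<otimes> b)) (fps_const t')) =
     (\<lambda>s'. ?G (fps_const s') (fps_const t'))" for t'
    by (rule tensor_lift_unique[OF clin1 refl])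
  moreover have "fps_ext (\<lambda>t'. ?G s (fps_const t')) t = ?G s t" for s
    using fps_ext_factor[OF lin2 complex_linear_id, of s t] by (simp add: fps_map_ident)
  moreover have "fps_ext (\<lambda>s'. ?G (fps_const s') t) s = ?G s t"
    using fps_ext_factor[OF lin1 complex_linear_id, of t s] by (simp add: fps_map_ident)
  ultimately show ?thesis by (simp add: tensor_star_def)
qed

text \<open>The step hypothesis is graded by order because the star product with a generator differs
  from the ordinary one by a multiple of \<lambda>. An outer induction on the order disposes of that
  multiple for all series at once, an inner one runs through words of generators.\<close>

lemma lambda_linear_star_unique:
  assumes f: "lambda_linear f" and g: "lambda_linear g" and one: "f 1 = g 1"
    and step: "\<And>u x n. (\<And>k. k \<le> n \<Longrightarrow> fps_nth (f x) k = fps_nth (g x) k) \<Longrightarrow>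
      fps_nth (f (star F (fps_const (gen u)) x)) n = fps_nth (g (star F (fps_const (gen u)) x)) n"
  shows "f = g"
proof -
  have "\<forall>x. \<forall>k<n. fps_nth (f x) k = fps_nth (g x) k" for n
  proof (induction n)
    case (Suc n)
    have X: "fps_nth (f (fps_X \<bullet>\<^sub>\<lambda> y)) k = fps_nth (g (fps_X \<bullet>\<^sub>\<lambda> y)) k" if "k < Suc n" for y k
      using Suc that
      by (cases k) (simp_all add: lambda_linear_scale[OF f] lambda_linear_scale[OF g] fps_scale_X_nth)
    have const: "\<forall>k<Suc n. fps_nth (f (fps_const x)) k = fps_nth (g (fps_const x)) k" for x
    proof (induction x rule: uea_induct)
      case one
      then show ?case by (simp add: assms(3))
    next
      case (scale c x)
      have "f (fps_const (c *\<^sub>C x)) = c *\<^sub>C f (fps_const x)"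
        "g (fps_const (c *\<^sub>C x)) = c *\<^sub>C g (fps_const x)"
        by (simp_all only: complex_linear_scale[OF complex_linear_fps_const]
            complex_linear_scale[OF lambda_linear_imp_complex_linear[OF f]]
            complex_linear_scale[OF lambda_linear_imp_complex_linear[OF g]])
      with scale show ?case by (simp add: scaleC_fps_def)
    next
      case (add x y)
      then show ?case
        by (simp add: lambda_linear_add[OF f] lambda_linear_add[OF g] flip: fps_const_add)
    next
      case (gen u x)
      let ?s = "star F (fps_const (gen u)) (fps_const x)"
      \<comment> \<open>Solves for the ordinary product: the star product is governed by
        \<open>step\<close>, the correction by the lower orders in \<open>X\<close>.\<close>
      have "?s = fps_const (gen u * x) + fps_X \<bullet>\<^sub>\<lambda> fps_shift1 ?s"
        using fps_shift1_decompose[of ?s] by (simp add: star_nth_0)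
      then have "f ?s = f (fps_const (gen u * x)) + f (fps_X \<bullet>\<^sub>\<lambda> fps_shift1 ?s)"
        "g ?s = g (fps_const (gen u * x)) + g (fps_X \<bullet>\<^sub>\<lambda> fps_shift1 ?s)"
        by (metis lambda_linear_add f g)+
      then have fg: "f (fps_const (gen u * x)) = f ?s - f (fps_X \<bullet>\<^sub>\<lambda> fps_shift1 ?s)"
        "g (fps_const (gen u * x)) = g ?s - g (fps_X \<bullet>\<^sub>\<lambda> fps_shift1 ?s)"
        by simp_all
      have "fps_nth (f ?s) k = fps_nth (g ?s) k" if "k < Suc n" for k
        using that gen by (intro step) auto
      then show ?case by (simp add: fg X)
    qed
    show ?case
    proof (intro allI impI)
      fix x k assume "k < Suc n"
      then show "fps_nth (f x) k = fps_nth (g x) k"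
        by (subst (1 2) fps_shift1_decompose[of x])
           (simp add: lambda_linear_add[OF f] lambda_linear_add[OF g] const X)
    qed
  qed simp
  then show ?thesis
    by (auto simp: fun_eq_iff fps_eq_iff)
qed

end

section \<open>The deformed Hopf structure\<close>

context abelian_twist
begin

subsection \<open>Counit\<close>

text \<open>The exponent \<open>B\<close> consists of commutators, which the counit annihilates, so
  the counit does not see the deformation of the product.\<close>

lemma counit_star: "fps_map counit (star F a b) = fps_map counit a * fps_map counit b"
proof -
  let ?m = "tensor_lift (*) :: ('x uea, 'x uea) tensor \<Rightarrow> _"
  have m: "complex_linear ?m"
    by (rule complex_linear_tensor_lift[OF complex_bilinear_mult])
  note lin = complex_linear_compose[OF complex_linear_counit m]
  have "counit (?m (B y)) = 0" for y
    by (rule tensor_linear_eqI[where f = "\<lambda>y. counit (?m (B y))" and g = "\<lambda>_. 0"])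
       (simp_all add: complex_linear_compose[OF lin complex_linear_B] complex_linear_0 B_tens
         complex_linear_diff[OF m] tensor_lift_tens[OF complex_bilinear_mult]
         complex_linear_diff[OF complex_linear_counit] counit_mult counit_gen)
  then have "fps_map (\<lambda>y. counit (?m y)) (texp B z) = texp (\<lambda>_. 0) (fps_map (\<lambda>y. counit (?m y)) z)" for z
    by (intro fps_map_texp lin)
  then show ?thesis
    using fps_map_mult_tens[of a b]
    by (simp add: star_texp fps_map_fps_map texp_fixed complex_linear_0
        flip: fps_map_mult[OF complex_linear_counit counit_mult])
       (metis fps_map_fps_map)
qed

lemma fps_map_counit_one: "fps_map counit (1 :: 'x uea fps) = 1"
  using fps_map_const[OF complex_linear_counit, of "1 :: 'x uea"] by (simp add: counit_one)

lemma star_counit_eq: "star_counit F = fps_map counit"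
  unfolding star_counit_def
proof (rule the_equality)
  let ?e = "fps_map counit :: 'x uea fps \<Rightarrow> _"
  note ll = lambda_linear_fps_map[OF complex_linear_counit]
  have counit_const_gen: "?e (fps_const (gen u)) = 0" for u
    by (simp add: fps_map_const[OF complex_linear_counit] counit_gen)
  show "(\<forall>a b. ?e (a + b) = ?e a + ?e b)
     \<and> (\<forall>c a. ?e (c \<bullet>\<^sub>\<lambda> a) = c * ?e a)
     \<and> ?e 1 = 1 \<and> (\<forall>a b. ?e (star F a b) = ?e a * ?e b)
     \<and> (\<forall>u. ?e (fps_const (gen u)) = 0)"
    by (simp add: fps_scale_complex lambda_linear_add[OF ll] lambda_linear_scale[OF ll] counit_star
        fps_map_counit_one counit_const_gen)
  fix e
  assume e: "(\<forall>a b. e (a + b) = e a + e b) \<and> (\<forall>c a. e (c \<bullet>\<^sub>\<lambda> a) = c * e a)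
     \<and> e 1 = 1 \<and> (\<forall>a b. e (star F a b) = e a * e b) \<and> (\<forall>u. e (fps_const (gen u)) = 0)"
  show "e = ?e"
  proof (rule lambda_linear_star_unique)
    show "lambda_linear e" using e by (simp add: lambda_linear_def fps_scale_complex)
    show "lambda_linear ?e" by (rule ll)
    show "e 1 = ?e 1" using e by (simp add: fps_map_counit_one)
    show "fps_nth (e (star F (fps_const (gen u)) x)) n =
        fps_nth (?e (star F (fps_const (gen u)) x)) n" for u x n
      using e by (simp add: counit_star counit_const_gen)
  qed
qed

subsection \<open>Coproduct\<close>

text \<open>
  \<open>K\<close> is the sum of the exponents of \<open>D\<close> (moved through the coproduct), of the conjugation by \<open>\<F>\<close>,
  and of the inverse of \<open>D \<otimes> D\<close>.
\<close>

definition K where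
  "K y = (a2 * (b1 * y - y * b1) + (b1 * y - y * b1) * a2)
       - (a1 * (b2 * y - y * b2) + (b2 * y - y * b2) * a1)"

lemma complex_linear_K: "complex_linear K"
  unfolding K_def[abs_def] by (intro complex_linear_intros)

definition cop where "cop f = XX (F * fps_map coproduct (D f) * expo P)"

lemma cop_texp: "cop f = texp K (fps_map coproduct f)"
proof -
  \<comment> \<open>The coproduct sends V1 to a1 + b1 and V2 to a2 + b2; this is \<delta> moved
    through it.\<close>
  define \<Delta>\<delta> where "\<Delta>\<delta> y = (a1 + b1) * y * (a2 + b2) - (a2 + b2) * y * (a1 + b1)" for y
  have lin: "complex_linear \<Delta>\<delta>"
    unfolding \<Delta>\<delta>_def[abs_def] by (intro complex_linear_intros)
  have \<Delta>: "coproduct (\<delta> x) = \<Delta>\<delta> (coproduct x)" for x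
    by (simp add: \<delta>_def \<Delta>\<delta>_def complex_linear_diff[OF complex_linear_coproduct] coproduct_mult
        coproduct_gen ab_defs)
  have "fps_map coproduct (D f) = texp \<Delta>\<delta> (fps_map coproduct f)"
    unfolding D_def by (rule fps_map_texp[where A = \<delta> and B = \<Delta>\<delta>, OF complex_linear_coproduct \<Delta>])
  then have "F * fps_map coproduct (D f) = texp (\<lambda>y. (- P) * y) (texp \<Delta>\<delta> (fps_map coproduct f))"
    by (simp only: twist_expo expo_mult_left)
  also have "\<dots> = texp (\<lambda>y. (- P) * y + \<Delta>\<delta> y) (fps_map coproduct f)"
    by (rule texp_compose, intro complex_linear_intros, rule lin, simp add: P_def \<Delta>\<delta>_def ab_simps)
  finally have "F * fps_map coproduct (D f) * expo P =
      texp (\<lambda>y. y * P) (texp (\<lambda>y. (- P) * y + \<Delta>\<delta> y) (fps_map coproduct f))"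
    by (simp only: expo_mult_right)
  also have "\<dots> = texp (\<lambda>y. y * P + ((- P) * y + \<Delta>\<delta> y)) (fps_map coproduct f)"
    by (rule texp_compose, intro complex_linear_intros, intro complex_linear_intros lin,
        simp add: P_def \<Delta>\<delta>_def ab_simps)
  finally have "cop f = texp (\<lambda>y. - (\<delta>1 y + \<delta>2 y))
      (texp (\<lambda>y. y * P + ((- P) * y + \<Delta>\<delta> y)) (fps_map coproduct f))"
    by (simp only: cop_def XX_def)
  also have "\<dots> = texp (\<lambda>y. - (\<delta>1 y + \<delta>2 y) + (y * P + ((- P) * y + \<Delta>\<delta> y))) (fps_map coproduct f)"
  proof (rule texp_compose)
    show "complex_linear (\<lambda>y. - (\<delta>1 y + \<delta>2 y))"
      by (intro complex_linear_uminus complex_linear_plus complex_linear_\<delta>1 complex_linear_\<delta>2)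
    show "complex_linear (\<lambda>y. y * P + ((- P) * y + \<Delta>\<delta> y))"
      by (intro complex_linear_intros lin)
  qed (simp add: P_def \<Delta>\<delta>_def \<delta>1_def \<delta>2_def ab_simps)
  \<comment> \<open>Expanding \<Delta>\<delta> produces \<delta>1 and \<delta>2, which cancel; only
    terms mixing the two legs remain.\<close>
  also have "(\<lambda>y. - (\<delta>1 y + \<delta>2 y) + (y * P + ((- P) * y + \<Delta>\<delta> y))) = K"
    by (rule ext) (simp add: P_def \<Delta>\<delta>_def \<delta>1_def \<delta>2_def K_def ab_simps)
  finally show ?thesis .
qed

lemma lambda_linear_cop: "lambda_linear cop"
  unfolding cop_texp[abs_def]
  by (intro lambda_linear_compose[OF lambda_linear_texp[OF complex_linear_K]]
      lambda_linear_fps_map complex_linear_coproduct)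

lemma cop_one: "cop 1 = 1"
proof -
  have "(1 :: ('x uea, 'x uea) tensor fps) = 1 \<otimes>\<^sub>\<lambda> 1"
    using fps_tens_const[of "1 :: 'x uea" "1 :: 'x uea"] by (simp add: one_tensor)
  then have "XX 1 = 1"
    by (metis DD_tens D_one XX_DD)
  moreover have "fps_map coproduct (1 :: 'x uea fps) = 1"
    using fps_map_const[OF complex_linear_coproduct, of "1 :: 'x uea"] by (simp add: coproduct_one)
  ultimately show ?thesis
    by (simp add: cop_def D_one twist_expo expo_minus)
qed

lemma cop_star: "cop (star F a b) = tensor_star F (cop a) (cop b)"
proof -
  have "expo P * (expo (- P) * x) = x" for x
    by (simp add: expo_minus flip: mult.assoc)
  then have "(F * s * expo P) * (F * t * expo P) = F * (s * t) * expo P" for s t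
    by (simp add: twist_expo mult.assoc)
  then show ?thesis
    by (simp add: cop_def tensor_star_eq DD_XX D_star
        fps_map_mult[OF complex_linear_coproduct coproduct_mult])
qed

text \<open>Every term of \<open>K\<close> contains a commutator with an element of the second leg,
  so gen u \<otimes> 1 is fixed. On 1 \<otimes> gen u, \<open>K\<close> reduces to 2H, where H is
  the action of -P through \<open>adj\<close> on the second leg; the factor 2 is the one in the
  exponent of the inverse R-matrix.\<close>

lemma cop_gen:
  "cop (fps_const (gen u)) = fps_const (gen u) \<otimes>\<^sub>\<lambda> 1
     + fps_ext (tensor_lift (\<lambda>a b. X_map F (fps_const a) \<otimes>\<^sub>\<lambda> fps_const (adj b (gen u))))
         (ring_inverse (R_matrix F))"
proof -
  let ?N = "tensor_lift (\<lambda>(a :: 'x uea) (b :: 'x uea). a \<otimes> adj b (gen u))"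
  have bl: "complex_bilinear (\<lambda>(a :: 'x uea) (b :: 'x uea). a \<otimes> adj b (gen u))"
    by (rule complex_bilinear_tens_comp[OF complex_linear_id complex_bilinear_left[OF complex_bilinear_adj]])
  note N_lin = complex_linear_tensor_lift[OF bl] and N_tens = tensor_lift_tens[OF bl]
  have m\<delta>1: "complex_linear (\<lambda>y. - \<delta>1 y)"
    by (intro complex_linear_uminus complex_linear_\<delta>1)
  define H where "H y = a2 * (b1 * y - y * b1) - a1 * (b2 * y - y * b2)" for y
  have H_lin: "complex_linear H"
    unfolding H_def[abs_def] by (intro complex_linear_intros)
  have HH_lin: "complex_linear (\<lambda>y. H y + H y)"
    by (intro complex_linear_plus H_lin)
  define w :: "('x uea, 'x uea) tensor fps" where "w = fps_const (1 \<otimes> gen u)"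
  have "tensor_lift (\<lambda>a b. X_map F (fps_const a) \<otimes>\<^sub>\<lambda> fps_const (adj b (gen u))) =
      (\<lambda>t. texp (\<lambda>y. - \<delta>1 y) (fps_const (?N t)))"
  proof (rule tensor_lift_unique)
    show "complex_linear (\<lambda>t. texp (\<lambda>y. - \<delta>1 y) (fps_const (?N t)))"
      by (intro complex_linear_compose[OF lambda_linear_imp_complex_linear[OF lambda_linear_texp[OF m\<delta>1]]]
          complex_linear_compose[OF complex_linear_fps_const] N_lin)
    have "- \<delta>1 (x \<otimes> y) = (- \<delta> x) \<otimes> y" for x y
      by (simp add: \<delta>1_tens complex_linear_minus[OF complex_linear_tens_left[OF complex_linear_id]])
    from fps_tens_texp_left[OF m\<delta>1 this, of "fps_const _" "fps_const _"]
    show "texp (\<lambda>y. - \<delta>1 y) (fps_const (?N (a \<otimes> b))) =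
        X_map F (fps_const a) \<otimes>\<^sub>\<lambda> fps_const (adj b (gen u))" for a b
      by (simp add: N_tens X_map_const X_def fps_tens_const)
  qed
  moreover have "fps_ext (\<lambda>t. texp (\<lambda>y. - \<delta>1 y) (fps_const (?N t))) z =
      texp (\<lambda>y. - \<delta>1 y) (fps_map ?N z)" for z
    by (rule fps_ext_factor[OF lambda_linear_texp[OF m\<delta>1] N_lin])
  moreover have "fps_map ?N (expo (- (P + P))) = texp (\<lambda>y. H y + H y) w"
  proof -
    have "?N (P * y) = - H (?N y)" for y
    proof (rule tensor_linear_eqI[where f = "\<lambda>y. ?N (P * y)" and g = "\<lambda>y. - H (?N y)"])
      show "complex_linear (\<lambda>y. ?N (P * y))" "complex_linear (\<lambda>y. - H (?N y))"
        by (intro complex_linear_compose[OF N_lin] complex_linear_compose[OF H_lin]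
            complex_linear_intros N_lin)+
      show "?N (P * (a \<otimes> b)) = - H (?N (a \<otimes> b))" for a b
        by (simp add: P_def ab_defs H_def algebra_simps tens_mult N_tens complex_linear_diff[OF N_lin]
            adj_gen_mult complex_linear_diff[OF complex_linear_tens_right[OF complex_linear_id]])
    qed
    then have "?N (- (P + P) * y) = H (?N y) + H (?N y)" for y
      by (simp add: complex_linear_simps[OF N_lin] algebra_simps)
    then have "fps_map ?N (expo (- (P + P))) = texp (\<lambda>y. H y + H y) (fps_const (?N 1))"
      by (rule fps_map_expo[OF N_lin])
    then show ?thesis
      using N_tens[of 1 1] by (simp add: w_def one_tensor adj_one)
  qed
  moreover have "texp (\<lambda>y. - \<delta>1 y) (texp (\<lambda>y. H y + H y) w) = texp (\<lambda>y. - \<delta>1 y + (H y + H y)) w"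
    by (rule texp_compose[OF m\<delta>1 HH_lin]) (simp add: \<delta>1_def H_def ab_simps)
  moreover have "texp K w = texp (\<lambda>y. - \<delta>1 y + (H y + H y)) w"
  proof (rule texp_cong_on)
    \<comment> \<open>The centraliser of the first-leg elements contains 1 \<otimes> gen u and is
      stable under the operators; on it \<delta>1, the exponent contributed by \<open>X_map\<close>,
      vanishes.\<close>
    let ?W = "{y. y * a1 = a1 * y \<and> y * a2 = a2 * y}"
    have left: "y * (a1 * z) = a1 * (y * z)" "y * (a2 * z) = a2 * (y * z)" if "y \<in> ?W" for y z
      using that by (simp_all flip: mult.assoc)
    show "K y = - \<delta>1 y + (H y + H y)" if "y \<in> ?W" for y
      using that by (simp add: K_def \<delta>1_def H_def ab_simps left[OF that])
    show "(\<i> / 2) *\<^sub>C (- \<delta>1 y + (H y + H y)) \<in> ?W" if "y \<in> ?W" for y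
      using that by (simp add: \<delta>1_def H_def ab_simps left[OF that] mult_scaleC_left mult_scaleC_right)
    show "fps_nth w n \<in> ?W" for n
      by (simp add: w_def ab_defs tens_mult)
  qed
  moreover have "texp K (fps_const (gen u \<otimes> 1)) = fps_const (gen u \<otimes> 1)"
    by (rule texp_fixed[OF _ complex_linear_K])
       (simp add: complex_linear_zero[OF complex_linear_K], simp add: K_def ab_defs tens_mult)
  moreover have "cop (fps_const (gen u)) = texp K (fps_const (gen u \<otimes> 1)) + texp K w"
    by (simp add: cop_texp fps_map_const[OF complex_linear_coproduct] coproduct_gen w_def
        lambda_linear_add[OF lambda_linear_texp[OF complex_linear_K]] flip: fps_const_add)
  moreover have "fps_const (gen u) \<otimes>\<^sub>\<lambda> (1 :: 'x uea fps) = fps_const (gen u \<otimes> 1)"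
    using fps_tens_const[of "gen u" "1 :: 'x uea"] by simp
  ultimately show ?thesis
    by (simp only: inverse_R_matrix)
qed

lemma star_coproduct_eq: "star_coproduct F = cop"
  unfolding star_coproduct_def
proof (rule the_equality)
  show "lambda_linear cop \<and> cop 1 = 1 \<and> (\<forall>a b. cop (star F a b) = tensor_star F (cop a) (cop b))
     \<and> (\<forall>u. cop (fps_const (gen u)) = fps_const (gen u) \<otimes>\<^sub>\<lambda> 1
          + fps_ext (tensor_lift (\<lambda>a b. X_map F (fps_const a) \<otimes>\<^sub>\<lambda> fps_const (adj b (gen u))))
              (ring_inverse (R_matrix F)))"
    using lambda_linear_cop cop_one cop_star cop_gen by blast
  fix C
  assume C: "lambda_linear C \<and> C 1 = 1 \<and> (\<forall>a b. C (star F a b) = tensor_star F (C a) (C b))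
     \<and> (\<forall>u. C (fps_const (gen u)) = fps_const (gen u) \<otimes>\<^sub>\<lambda> 1
          + fps_ext (tensor_lift (\<lambda>a b. X_map F (fps_const a) \<otimes>\<^sub>\<lambda> fps_const (adj b (gen u))))
              (ring_inverse (R_matrix F)))"
  show "C = cop"
  proof (rule lambda_linear_star_unique)
    show "lambda_linear C" "lambda_linear cop" "C 1 = cop 1"
      using C lambda_linear_cop cop_one by auto
    fix u x n assume "\<And>k. k \<le> n \<Longrightarrow> fps_nth (C x) k = fps_nth (cop x) k"
    \<comment> \<open>Agreement is known only up to order n, so star multiplication is viewed as a
      \<lambda>-linear, hence order-preserving, map of its second factor.\<close>
    then have "fps_nth (tensor_star F s (C x)) n = fps_nth (tensor_star F s (cop x)) n" for s
      unfolding tensor_star_eq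
      by (intro lambda_linear_nth_cong[where \<Phi> = "\<lambda>t. XX (DD s * DD t)"]
          lambda_linear_compose[OF lambda_linear_XX] lambda_linear_mult_left lambda_linear_DD)
    moreover have "C (fps_const (gen u)) = cop (fps_const (gen u))"
      using C cop_gen by metis
    ultimately show "fps_nth (C (star F (fps_const (gen u)) x)) n =
        fps_nth (cop (star F (fps_const (gen u)) x)) n"
      using C cop_star by metis
  qed
qed

subsection \<open>Antipode\<close>

definition ant where "ant f = X (fps_map antipode (D f))"

lemma lambda_linear_ant: "lambda_linear ant"
  unfolding ant_def[abs_def]
  by (intro lambda_linear_compose[OF lambda_linear_X]
      lambda_linear_compose[OF lambda_linear_fps_map[OF complex_linear_antipode]] lambda_linear_D)

lemma ant_one: "ant 1 = 1"
  using fps_map_const[OF complex_linear_antipode, of "1 :: 'x uea"]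
  by (simp add: ant_def D_one X_one antipode_one)

lemma ant_star: "ant (star F a b) = star F (ant b) (ant a)"
  by (simp add: ant_def star_eq D_X fps_map_antimult[OF complex_linear_antipode antipode_mult])

lemma ant_ant: "ant (ant f) = f"
  by (simp add: ant_def D_X X_D fps_map_fps_map antipode_antipode fps_map_ident)

lemma bij_ant: "bij ant"
  by (rule o_bij[of ant]) (simp_all add: fun_eq_iff ant_ant)

lemma inv_ant: "inv ant = ant"
  by (rule inv_equality) (simp_all add: ant_ant)

text \<open>The right-hand side is the value prescribed for the inverse of the antipode; it can be
  compared with \<open>ant\<close> because \<open>ant\<close> is an involution. Both sides equal
  minus \<open>X\<close> applied twice to u. On the left the antipode changes the sign of \<delta>,
  which turns \<open>D\<close> into \<open>X\<close>. On the right one \<open>X\<close> comes from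
  the star product, the other from the exponent \<delta>1 - 2H.\<close>

lemma ant_gen:
  "ant (fps_const (gen u)) = - fps_ext (tensor_lift (\<lambda>a b.
      star F (fps_const (adj a (gen u))) (X_map F (fps_const b)))) (ring_inverse (R_matrix F))"
proof -
  let ?m = "tensor_lift (*) :: ('x uea, 'x uea) tensor \<Rightarrow> _"
  have m: "complex_linear ?m"
    by (rule complex_linear_tensor_lift[OF complex_bilinear_mult])
  note m_tens = tensor_lift_tens[OF complex_bilinear_mult]
  let ?N = "tensor_lift (\<lambda>(a :: 'x uea) (b :: 'x uea). adj a (gen u) \<otimes> b)"
  have bl: "complex_bilinear (\<lambda>(a :: 'x uea) (b :: 'x uea). adj a (gen u) \<otimes> b)"
    by (rule complex_bilinear_tens_comp[OF complex_bilinear_left[OF complex_bilinear_adj] complex_linear_id])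
  note N_lin = complex_linear_tensor_lift[OF bl] and N_tens = tensor_lift_tens[OF bl]
  define H where "H y = (a1 * (b2 * y) - (b2 * y) * a1) - (a2 * (b1 * y) - (b1 * y) * a2)" for y
  have H_lin: "complex_linear H"
    unfolding H_def[abs_def] by (intro complex_linear_intros)
  define w :: "('x uea, 'x uea) tensor fps" where "w = fps_const (gen u \<otimes> 1)"
  let ?\<Phi> = "\<lambda>z. X (fps_map ?m (texp \<delta>1 z))"
  have \<Phi>_lin: "lambda_linear ?\<Phi>"
    by (intro lambda_linear_compose[OF lambda_linear_X] lambda_linear_compose[OF lambda_linear_fps_map[OF m]]
        lambda_linear_texp complex_linear_\<delta>1)
  have "tensor_lift (\<lambda>a b. star F (fps_const (adj a (gen u))) (X_map F (fps_const b))) =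
      (\<lambda>t. ?\<Phi> (fps_const (?N t)))"
  proof (rule tensor_lift_unique)
    show "complex_linear (\<lambda>t. ?\<Phi> (fps_const (?N t)))"
      by (intro complex_linear_compose[OF lambda_linear_imp_complex_linear[OF \<Phi>_lin]]
          complex_linear_compose[OF complex_linear_fps_const] N_lin)
    show "?\<Phi> (fps_const (?N (a \<otimes> b))) = star F (fps_const (adj a (gen u))) (X_map F (fps_const b))" for a b
      using fps_tens_texp_left[OF complex_linear_\<delta>1 \<delta>1_tens, of "fps_const (adj a (gen u))" "fps_const b"]
      by (simp add: N_tens X_map_const star_eq D_X[unfolded D_def] D_def fps_tens_const flip: fps_map_mult_tens)
  qed
  moreover have "fps_ext (\<lambda>t. ?\<Phi> (fps_const (?N t))) z = ?\<Phi> (fps_map ?N z)" for z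
    by (rule fps_ext_factor[OF \<Phi>_lin N_lin])
  moreover have "fps_map ?N (expo (- (P + P))) = texp (\<lambda>y. - (H y + H y)) w"
  proof -
    have "?N (P * y) = H (?N y)" for y
    proof (rule tensor_linear_eqI[where f = "\<lambda>y. ?N (P * y)" and g = "\<lambda>y. H (?N y)"])
      show "complex_linear (\<lambda>y. ?N (P * y))" "complex_linear (\<lambda>y. H (?N y))"
        by (intro complex_linear_compose[OF N_lin] complex_linear_compose[OF H_lin]
            complex_linear_intros N_lin)+
      show "?N (P * (a \<otimes> b)) = H (?N (a \<otimes> b))" for a b
        by (simp add: P_def ab_defs H_def algebra_simps tens_mult N_tens complex_linear_diff[OF N_lin]
            adj_gen_mult complex_linear_diff[OF complex_linear_tens_left[OF complex_linear_id]])
    qed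
    then have "?N (- (P + P) * y) = - (H (?N y) + H (?N y))" for y
      by (simp add: complex_linear_simps[OF N_lin] algebra_simps)
    then have "fps_map ?N (expo (- (P + P))) = texp (\<lambda>y. - (H y + H y)) (fps_const (?N 1))"
      by (rule fps_map_expo[OF N_lin])
    then show ?thesis
      using N_tens[of 1 1] by (simp add: w_def one_tensor adj_one)
  qed
  moreover have "fps_map ?m (texp \<delta>1 (texp (\<lambda>y. - (H y + H y)) w)) = X (fps_const (gen u))"
  proof -
    \<comment> \<open>Multiplication of the legs identifies \<delta>1 with H, so that \<delta>1 - 2H
      becomes first -H and then -\<delta>1.\<close>
    have mH: "?m (\<delta>1 y) = ?m (H y)" for y
    proof (rule tensor_linear_eqI[where f = "\<lambda>y. ?m (\<delta>1 y)" and g = "\<lambda>y. ?m (H y)"])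
      show "complex_linear (\<lambda>y. ?m (\<delta>1 y))" "complex_linear (\<lambda>y. ?m (H y))"
        by (rule complex_linear_compose[OF m complex_linear_\<delta>1] complex_linear_compose[OF m H_lin])+
      show "?m (\<delta>1 (a \<otimes> b)) = ?m (H (a \<otimes> b))" for a b
        by (simp add: \<delta>1_def H_def ab_defs algebra_simps tens_mult complex_linear_simps[OF m] m_tens
            v_commute v_left_commute)
    qed
    have comm: "\<delta>1 (H y) = H (\<delta>1 y)" for y
      by (simp add: \<delta>1_def H_def ab_simps)
    have "fps_map ?m (texp \<delta>1 z) = fps_map ?m (texp H z)" for z
      by (rule fps_map_texp_cong[where M = ?m, OF m mH comm complex_linear_\<delta>1 H_lin])
    moreover have "texp H (texp (\<lambda>y. - (H y + H y)) w) = texp (\<lambda>y. - H y) w"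
      using texp_compose[OF H_lin complex_linear_uminus[OF complex_linear_plus[OF H_lin H_lin]], of w]
      by (simp add: complex_linear_simps[OF H_lin])
    moreover have "fps_map ?m (texp (\<lambda>y. - H y) w) = fps_map ?m (texp (\<lambda>y. - \<delta>1 y) w)"
      by (rule fps_map_texp_cong[OF m])
         (simp_all add: complex_linear_minus[OF m] mH comm complex_linear_uminus H_lin complex_linear_\<delta>1
           complex_linear_minus[OF H_lin] complex_linear_minus[OF complex_linear_\<delta>1])
    moreover have "texp (\<lambda>y. - \<delta>1 y) w = X (fps_const (gen u)) \<otimes>\<^sub>\<lambda> fps_const 1"
      unfolding X_def w_def fps_tens_const[symmetric]
      by (rule fps_tens_texp_left[symmetric])
         (simp_all add: complex_linear_uminus complex_linear_\<delta>1 \<delta>1_tens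
           complex_linear_minus[OF complex_linear_tens_left[OF complex_linear_id]])
    ultimately show ?thesis by (simp add: fps_map_mult_tens)
  qed
  moreover have "ant (fps_const (gen u)) = - X (X (fps_const (gen u)))"
  proof -
    have "antipode (\<delta> x) = - \<delta> (antipode x)" for x
      by (simp add: \<delta>_def complex_linear_diff[OF complex_linear_antipode] antipode_mult antipode_gen mult.assoc)
    then have "fps_map antipode (D f) = X (fps_map antipode f)" for f
      unfolding D_def X_def by (rule fps_map_texp[OF complex_linear_antipode])
    then show ?thesis
      by (simp add: ant_def fps_map_const[OF complex_linear_antipode] antipode_gen
          lambda_linear_uminus[OF lambda_linear_X] flip: fps_const_neg)
  qed
  ultimately show ?thesis
    by (simp only: inverse_R_matrix)
qed

text \<open>The prescribed values concern the inverse, so uniqueness is applied to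
  \<open>inv S\<close>, which inherits \<lambda>-linearity and the reversal of star products from
  the bijection \<open>S\<close>. As \<open>ant\<close> is an involution, \<open>S\<close> is then
  \<open>ant\<close> too.\<close>

lemma star_antipode_eq: "star_antipode F = ant"
  unfolding star_antipode_def
proof (rule the_equality)
  let ?g = "\<lambda>u. - fps_ext (tensor_lift (\<lambda>a b. star F (fps_const (adj a (gen u))) (X_map F (fps_const b))))
              (ring_inverse (R_matrix F))"
  show "lambda_linear ant \<and> bij ant \<and> ant 1 = 1 \<and> (\<forall>a b. ant (star F a b) = star F (ant b) (ant a))
     \<and> (\<forall>u. inv ant (fps_const (gen u)) = ?g u)"
    using lambda_linear_ant bij_ant ant_one ant_star ant_gen inv_ant by simp
  fix S
  assume S: "lambda_linear S \<and> bij S \<and> S 1 = 1 \<and> (\<forall>a b. S (star F a b) = star F (S b) (S a))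
     \<and> (\<forall>u. inv S (fps_const (gen u)) = ?g u)"
  have inv1: "S (inv S y) = y" and inv2: "inv S (S y) = y" for y
    using S by (simp_all add: bij_is_surj surj_f_inv_f bij_is_inj)
  have T_star: "inv S (star F a b) = star F (inv S b) (inv S a)" for a b
    using S inv1 inv2 by metis
  have "inv S = ant"
  proof (rule lambda_linear_star_unique)
    show T_lin: "lambda_linear (inv S)"
      using S inv1 inv2 unfolding lambda_linear_def by metis
    show "lambda_linear ant" "inv S 1 = ant 1"
      using S inv2 ant_one lambda_linear_ant by (metis, metis)
    fix u x n assume "\<And>k. k \<le> n \<Longrightarrow> fps_nth (inv S x) k = fps_nth (ant x) k"
    then have "fps_nth (star F (inv S x) t) n = fps_nth (star F (ant x) t) n" for t
      by (intro lambda_linear_nth_cong[OF lambda_linear_star_left])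
    then show "fps_nth (inv S (star F (fps_const (gen u)) x)) n =
        fps_nth (ant (star F (fps_const (gen u)) x)) n"
      using S ant_gen[of u] by (simp add: T_star ant_star)
  qed
  then show "S = ant"
    using inv1 inv2 ant_ant by (metis ext)
qed

end

subsection \<open>Subalgebras generated by symmetries of the twist\<close>

text \<open>The undeformed enveloping algebra of \<gg> inside that of all vector fields, built by
  left multiplication with generators so that inductions follow words.\<close>

inductive_set uea_sub :: "'x::complex_lie_algebra set \<Rightarrow> 'x uea set" for \<gg> where
  one: "1 \<in> uea_sub \<gg>"
| gen: "u \<in> \<gg> \<Longrightarrow> x \<in> uea_sub \<gg> \<Longrightarrow> gen u * x \<in> uea_sub \<gg>"
| scale: "x \<in> uea_sub \<gg> \<Longrightarrow> c *\<^sub>C x \<in> uea_sub \<gg>"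
| add: "x \<in> uea_sub \<gg> \<Longrightarrow> y \<in> uea_sub \<gg> \<Longrightarrow> x + y \<in> uea_sub \<gg>"

lemma uea_sub_zero: "0 \<in> uea_sub \<gg>"
  using uea_sub.scale[OF uea_sub.one, of 0] by simp

lemma uea_sub_sum: "(\<And>i. i \<in> I \<Longrightarrow> f i \<in> uea_sub \<gg>) \<Longrightarrow> sum f I \<in> uea_sub \<gg>"
  by (induction I rule: infinite_finite_induct) (simp_all add: uea_sub_zero uea_sub.add)

lemma uea_sub_mult: "x \<in> uea_sub \<gg> \<Longrightarrow> y \<in> uea_sub \<gg> \<Longrightarrow> x * y \<in> uea_sub \<gg>"
  by (induction rule: uea_sub.induct)
     (simp_all add: uea_sub.intros mult.assoc mult_scaleC_left distrib_right)

inductive_set tensor_sub :: "'x::complex_lie_algebra set \<Rightarrow> ('x uea, 'x uea) tensor set" for \<gg> where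
  tens: "x \<in> uea_sub \<gg> \<Longrightarrow> y \<in> uea_sub \<gg> \<Longrightarrow> x \<otimes> y \<in> tensor_sub \<gg>"
| add: "s \<in> tensor_sub \<gg> \<Longrightarrow> t \<in> tensor_sub \<gg> \<Longrightarrow> s + t \<in> tensor_sub \<gg>"

lemma tensor_sub_scale: "t \<in> tensor_sub \<gg> \<Longrightarrow> c *\<^sub>C t \<in> tensor_sub \<gg>"
  by (induction rule: tensor_sub.induct)
     (simp_all add: scaleC_tens scaleC_add_right tensor_sub.intros uea_sub.scale)

lemma coproduct_uea_sub: "x \<in> uea_sub \<gg> \<Longrightarrow> coproduct x \<in> tensor_sub \<gg>"
proof (induction rule: uea_sub.induct)
  case one
  then show ?case
    using tensor_sub.tens[OF uea_sub.one uea_sub.one, of \<gg>] by (simp add: coproduct_one one_tensor)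
next
  case (gen u x)
  have "(gen u \<otimes> 1 + 1 \<otimes> gen u) * t \<in> tensor_sub \<gg>" if "t \<in> tensor_sub \<gg>" for t
    using that
  proof induction
    case (tens x y)
    then show ?case
      by (simp add: distrib_right tens_mult tensor_sub.intros uea_sub.gen gen(1))
  qed (simp add: distrib_left tensor_sub.add)
  then show ?case using gen by (simp add: coproduct_mult coproduct_gen)
qed (simp_all add: complex_linear_simps[OF complex_linear_coproduct] tensor_sub_scale tensor_sub.add)

lemma tensor_square_add:
  "s \<in> tensor_square A \<Longrightarrow> t \<in> tensor_square A \<Longrightarrow> s + t \<in> tensor_square A"
  by (induction rule: tensor_square.induct) (simp_all add: add.assoc tensor_square.step)

lemma tensor_square_scale: "t \<in> tensor_square A \<Longrightarrow> c \<bullet>\<^sub>\<lambda> t \<in> tensor_square A"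
proof (induction rule: tensor_square.induct)
  case zero
  then show ?case
    by (simp add: lambda_linear_zero[OF lambda_linear_fps_scale] tensor_square.zero)
next
  case (step a b t d)
  then show ?case
    by (simp add: fps_scale_add_right fps_scale_scale tensor_square.step)
qed

lemma tensor_square_tens: "a \<in> A \<Longrightarrow> b \<in> A \<Longrightarrow> a \<otimes>\<^sub>\<lambda> b \<in> tensor_square A"
  using tensor_square.step[of a A b 0 1] by (simp add: tensor_square.zero fps_scale_one)

lemma fps_scale_one_right: "c \<bullet>\<^sub>\<lambda> 1 = fps_map (\<lambda>z. z *\<^sub>C 1) c"
proof (rule fps_ext)
  fix n
  have "(\<Sum>i\<le>n. fps_nth c i *\<^sub>C fps_nth 1 (n - i)) = (\<Sum>i\<le>n. if i = n then fps_nth c n *\<^sub>C 1 else 0)"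
    by (rule sum.cong) auto
  then show "fps_nth (c \<bullet>\<^sub>\<lambda> 1) n = fps_nth (fps_map (\<lambda>z. z *\<^sub>C 1) c) n"
    by (simp add: fps_scale_def fps_map_def)
qed

lemma complex_bilinear_fps_scale: "complex_bilinear (\<bullet>\<^sub>\<lambda>)"
  by (intro complex_bilinearI lambda_linear_imp_complex_linear lambda_linear_fps_scale
      lambda_linear_fps_scale_left)

section \<open>Elements commuting with the twist\<close>

locale twist_symmetry = abelian_twist V1 V2 for V1 V2 :: "'x::complex_lie_algebra" +
  fixes \<gg> :: "'x set"
  assumes symmetry: "u \<in> \<gg> \<Longrightarrow> lie u V1 = 0" "u \<in> \<gg> \<Longrightarrow> lie u V2 = 0"
begin

lemma gen_commute:
  assumes "u \<in> \<gg>"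
  shows "v1 * gen u = gen u * v1" "v2 * gen u = gen u * v2"
  using gen_lie[of u V1] gen_lie[of u V2] symmetry[OF assms]
  by (simp_all add: complex_linear_zero[OF complex_linear_gen])

lemma uea_sub_commute:
  "x \<in> uea_sub \<gg> \<Longrightarrow> v1 * x = x * v1" "x \<in> uea_sub \<gg> \<Longrightarrow> v2 * x = x * v2"
proof -
  assume "x \<in> uea_sub \<gg>"
  then have "v1 * x = x * v1 \<and> v2 * x = x * v2"
  proof induction
    case (gen u x)
    have comm: "v * (gen u * x) = gen u * x * v" if "v * gen u = gen u * v" "v * x = x * v" for v
      using that by (metis mult.assoc)
    from gen show ?case by (auto intro!: comm gen_commute)
  qed (simp_all add: mult_scaleC_left mult_scaleC_right distrib_left distrib_right)
  then show "v1 * x = x * v1" "v2 * x = x * v2" by auto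
qed

lemma K_tensor_sub: "t \<in> tensor_sub \<gg> \<Longrightarrow> K t = 0"
proof (induction rule: tensor_sub.induct)
  case (tens x y)
  then show ?case
    by (simp add: K_def ab_defs tens_mult uea_sub_commute)
qed (simp add: complex_linear_add[OF complex_linear_K])

text \<open>Both legs of the classical coproduct stay in the enveloping algebra of \<gg>, where the
  exponent \<open>K\<close> vanishes.\<close>

lemma cop_uea_sub:
  assumes "\<And>n. fps_nth f n \<in> uea_sub \<gg>"
  shows "cop f = fps_map coproduct f"
  unfolding cop_texp
  by (rule texp_fixed) (simp_all add: complex_linear_K fps_map_nth K_tensor_sub coproduct_uea_sub assms)

lemma \<delta>_uea_sub: "x \<in> uea_sub \<gg> \<Longrightarrow> \<delta> x = 0"
  using v_commute by (simp add: \<delta>_def uea_sub_commute mult.assoc)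

lemma ant_uea_sub:
  assumes "\<And>n. fps_nth f n \<in> uea_sub \<gg>"
  shows "ant f = fps_map antipode f"
proof -
  have "D f = f"
    unfolding D_def by (rule texp_fixed) (simp_all add: complex_linear_\<delta> \<delta>_uea_sub assms)
  moreover have "\<delta> (antipode x) = - antipode (\<delta> x)" for x
    by (simp add: \<delta>_def complex_linear_diff[OF complex_linear_antipode] antipode_mult antipode_gen mult.assoc)
  then have "X (fps_map antipode f) = fps_map antipode f"
    unfolding X_def
    by (intro texp_fixed complex_linear_uminus complex_linear_\<delta>)
       (simp add: fps_map_nth \<delta>_uea_sub assms complex_linear_zero[OF complex_linear_antipode])
  ultimately show ?thesis by (simp add: ant_def)
qed

text \<open>Each term of \<open>B\<close> contains one commutator per factor, so a single factor
  that commutes with V1 and V2 makes the star product classical.\<close>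

lemma star_central:
  assumes "(\<forall>n. v1 * fps_nth f n = fps_nth f n * v1 \<and> v2 * fps_nth f n = fps_nth f n * v2)
    \<or> (\<forall>n. v1 * fps_nth g n = fps_nth g n * v1 \<and> v2 * fps_nth g n = fps_nth g n * v2)"
  shows "star F f g = f * g"
proof -
  have "B (fps_nth f i \<otimes> fps_nth g j) = 0" for i j
    using assms
    by (auto simp: B_tens complex_linear_zero[OF complex_linear_tens_left[OF complex_linear_id]]
        complex_linear_zero[OF complex_linear_tens_right[OF complex_linear_id]])
  then have "texp B (f \<otimes>\<^sub>\<lambda> g) = f \<otimes>\<^sub>\<lambda> g"
    by (intro texp_fixed complex_linear_B)
       (simp add: fps_tens_def complex_linear_sum[OF complex_linear_B])
  then show ?thesis by (simp add: star_texp fps_map_mult_tens)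
qed

lemma star_uea_sub:
  assumes "(\<forall>n. fps_nth f n \<in> uea_sub \<gg>) \<or> (\<forall>n. fps_nth g n \<in> uea_sub \<gg>)"
  shows "star F f g = f * g"
  using assms by (intro star_central) (auto simp: uea_sub_commute)

abbreviation A where "A \<equiv> enveloping_star F \<gg>"

text \<open>Coefficientwise control, sufficient for identities. Membership in \<open>A\<close>
  itself is finer, as \<open>A\<close> is not completed in \<lambda>; closure under the structure
  maps is therefore proved by separate inductions over the generation of \<open>A\<close>.\<close>

lemma enveloping_star_uea_sub: "f \<in> A \<Longrightarrow> fps_nth f n \<in> uea_sub \<gg>"
  unfolding enveloping_star_def
proof (induction arbitrary: n rule: star_subalgebra_generated.induct)
  case one
  then show ?case by (simp add: uea_sub.one uea_sub_zero)
next
  case (gen a)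
  then show ?case
    using uea_sub.gen[OF _ uea_sub.one] by (auto simp: uea_sub_zero)
next
  case (add a b)
  then show ?case by (simp add: uea_sub.add)
next
  case (scale a c)
  then show ?case by (simp add: fps_scale_def uea_sub_sum uea_sub.scale)
next
  case (star a b)
  then show ?case by (simp add: star_uea_sub fps_mult_nth uea_sub_sum uea_sub_mult)
qed

lemma star_subalgebra_enveloping: "star_subalgebra F A"
  unfolding star_subalgebra_def enveloping_star_def by (auto intro: star_subalgebra_generated.intros)

text \<open>By \<lambda>-linearity in both arguments it is enough to multiply pure tensors, where
  the product acts leg by leg.\<close>

lemma tensor_star_tensor_square:
  assumes "s \<in> tensor_square A" "t \<in> tensor_square A"
  shows "tensor_star F s t \<in> tensor_square A"
proof -
  have lin1: "lambda_linear (\<lambda>s. tensor_star F s t)" and lin2: "lambda_linear (\<lambda>t. tensor_star F s t)" for s t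
    unfolding tensor_star_eq
    by (intro lambda_linear_compose[OF lambda_linear_XX] lambda_linear_mult_left
        lambda_linear_mult_right lambda_linear_DD)+
  have pure: "tensor_star F (a \<otimes>\<^sub>\<lambda> b) (c \<otimes>\<^sub>\<lambda> d) = star F a c \<otimes>\<^sub>\<lambda> star F b d" for a b c d
  proof -
    have "DD (star F a c \<otimes>\<^sub>\<lambda> star F b d) = DD (a \<otimes>\<^sub>\<lambda> b) * DD (c \<otimes>\<^sub>\<lambda> d)"
      by (simp add: DD_tens D_star fps_tens_mult)
    then show ?thesis by (metis XX_DD tensor_star_eq)
  qed
  have star: "star F a b \<in> A" if "a \<in> A" "b \<in> A" for a b
    using star_subalgebra_enveloping that by (simp add: star_subalgebra_def)
  have "tensor_star F (a \<otimes>\<^sub>\<lambda> b) t \<in> tensor_square A" if "a \<in> A" "b \<in> A" for a b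
    using assms(2)
    by induction
       (simp_all add: lambda_linear_zero[OF lin2] lambda_linear_add[OF lin2] lambda_linear_scale[OF lin2]
         pure tensor_square.zero tensor_square.step star that)
  with assms(1) show ?thesis
    by induction
       (simp_all add: lambda_linear_zero[OF lin1] lambda_linear_add[OF lin1] lambda_linear_scale[OF lin1]
         tensor_square.zero tensor_square_add tensor_square_scale)
qed

lemma cop_enveloping: "f \<in> A \<Longrightarrow> cop f \<in> tensor_square A"
  unfolding enveloping_star_def
proof (induction rule: star_subalgebra_generated.induct)
  case one
  have "1 \<otimes>\<^sub>\<lambda> 1 \<in> tensor_square A"
    using star_subalgebra_enveloping by (simp add: star_subalgebra_def tensor_square_tens)
  then show ?case
    using fps_tens_const[of "1 :: 'x uea" "1 :: 'x uea"]
    by (simp add: cop_one one_tensor enveloping_star_def)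
next
  case (gen a)
  then obtain u where u: "u \<in> \<gg>" "a = fps_const (gen u)" by auto
  have "a \<in> A" "1 \<in> A"
    using u by (auto simp: enveloping_star_def intro: star_subalgebra_generated.intros)
  then have "a \<otimes>\<^sub>\<lambda> 1 + 1 \<otimes>\<^sub>\<lambda> a \<in> tensor_square A"
    by (intro tensor_square_add tensor_square_tens)
  moreover have "cop a = a \<otimes>\<^sub>\<lambda> 1 + 1 \<otimes>\<^sub>\<lambda> a"
    using cop_uea_sub[OF enveloping_star_uea_sub[OF \<open>a \<in> A\<close>]]
      fps_tens_const[of "gen u" "1 :: 'x uea"] fps_tens_const[of "1 :: 'x uea" "gen u"]
    by (simp add: u fps_map_const[OF complex_linear_coproduct] coproduct_gen flip: fps_const_add)
  ultimately show ?case by (simp add: enveloping_star_def)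
next
  case (star a b)
  then show ?case
    using tensor_star_tensor_square[unfolded enveloping_star_def] by (simp add: cop_star)
qed (simp_all add: lambda_linear_add[OF lambda_linear_cop] lambda_linear_scale[OF lambda_linear_cop]
    tensor_square_add tensor_square_scale)

lemma ant_enveloping: "f \<in> A \<Longrightarrow> ant f \<in> A"
  unfolding enveloping_star_def
proof (induction rule: star_subalgebra_generated.induct)
  case one
  then show ?case by (simp add: ant_one star_subalgebra_generated.one)
next
  case (gen a)
  then obtain u where u: "u \<in> \<gg>" "a = fps_const (gen u)" by auto
  have "a \<in> A"
    using u by (auto simp: enveloping_star_def intro: star_subalgebra_generated.intros)
  then have "ant a = - a"
    using ant_uea_sub[OF enveloping_star_uea_sub[OF \<open>a \<in> A\<close>]]
    by (simp add: u fps_map_const[OF complex_linear_antipode] antipode_gen)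
  also have "- a = fps_const (- 1) \<bullet>\<^sub>\<lambda> a"
    unfolding fps_scale_const by (simp add: scaleC_one)
  finally show ?case using gen by (simp add: star_subalgebra_generated.intros)
qed (simp_all add: lambda_linear_add[OF lambda_linear_ant] lambda_linear_scale[OF lambda_linear_ant]
    ant_star star_subalgebra_generated.intros)

lemma hopf_subalgebra: "star_hopf_subalgebra F A"
  using star_subalgebra_enveloping cop_enveloping ant_enveloping
  by (auto simp: star_hopf_subalgebra_def star_coproduct_eq star_antipode_eq)

text \<open>The integrands in the Hopf axioms are deformed, yet on legs from the enveloping algebra
  of \<gg> they agree with constant classical ones. The coproduct of an element of \<open>A\<close>
  only has such legs, so each axiom reduces to its classical form, coefficient by
  coefficient.\<close>

lemma fps_ext_cop:
  assumes f: "f \<in> A" and bl: "complex_bilinear b" "complex_bilinear b'"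
    and eq: "\<And>x y. x \<in> uea_sub \<gg> \<Longrightarrow> y \<in> uea_sub \<gg> \<Longrightarrow> b x y = fps_const (b' x y)"
  shows "fps_ext (tensor_lift b) (cop f) = fps_map (\<lambda>x. tensor_lift b' (coproduct x)) f"
proof -
  note f_sub = enveloping_star_uea_sub[OF f]
  note lin = complex_linear_tensor_lift[OF bl(1)] complex_linear_tensor_lift[OF bl(2)]
  have "tensor_lift b t = fps_const (tensor_lift b' t)" if "t \<in> tensor_sub \<gg>" for t
    using that
    by induction
       (simp_all add: tensor_lift_tens bl eq complex_linear_add[OF lin(1)] complex_linear_add[OF lin(2)])
  then have "fps_ext (tensor_lift b) (cop f) = fps_ext (\<lambda>t. fps_const (tensor_lift b' t)) (cop f)"
    by (simp add: fps_ext_def cop_uea_sub[OF f_sub] fps_map_nth coproduct_uea_sub f_sub)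
  also have "\<dots> = fps_map (tensor_lift b') (cop f)"
    by (rule fps_ext_fps_const[OF lin(2)])
  finally show ?thesis
    by (simp add: cop_uea_sub[OF f_sub] fps_map_fps_map)
qed

lemma fps_const_uea_sub: "x \<in> uea_sub \<gg> \<Longrightarrow> fps_nth (fps_const x) n \<in> uea_sub \<gg>"
  by (simp add: uea_sub_zero)

lemma cop_const: "x \<in> uea_sub \<gg> \<Longrightarrow> cop (fps_const x) = fps_const (coproduct x)"
  by (simp add: cop_uea_sub fps_const_uea_sub fps_map_const complex_linear_coproduct del: fps_nth_fps_const)

lemma ant_const: "x \<in> uea_sub \<gg> \<Longrightarrow> ant (fps_const x) = fps_const (antipode x)"
  by (simp add: ant_uea_sub fps_const_uea_sub fps_map_const complex_linear_antipode del: fps_nth_fps_const)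

lemma hopf_algebra: "star_hopf_algebra F A"
proof -
  note clin_const = complex_linear_compose[OF lambda_linear_imp_complex_linear complex_linear_fps_const]
  note cop_lin = clin_const[OF lambda_linear_cop]
    and ant_lin = clin_const[OF lambda_linear_ant]
    and counit_lin = clin_const[OF lambda_linear_fps_map[OF complex_linear_counit]]
  have coassoc: "fps_map tensor_assoc (fps_ext (tensor_lift (\<lambda>x y. cop (fps_const x) \<otimes>\<^sub>\<lambda> fps_const y)) (cop a)) =
     fps_ext (tensor_lift (\<lambda>x y. fps_const x \<otimes>\<^sub>\<lambda> cop (fps_const y))) (cop a)" if a: "a \<in> A" for a
  proof -
    have "fps_ext (tensor_lift (\<lambda>x y. cop (fps_const x) \<otimes>\<^sub>\<lambda> fps_const y)) (cop a) =
        fps_map (\<lambda>x. tensor_lift (\<lambda>x y. coproduct x \<otimes> y) (coproduct x)) a"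
      by (intro fps_ext_cop[OF a] complex_bilinear_comp[OF complex_bilinear_fps_tens]
          complex_bilinear_tens_comp cop_lin complex_linear_fps_const complex_linear_coproduct
          complex_linear_id) (simp add: cop_const fps_tens_const)
    moreover have "fps_ext (tensor_lift (\<lambda>x y. fps_const x \<otimes>\<^sub>\<lambda> cop (fps_const y))) (cop a) =
        fps_map (\<lambda>x. tensor_lift (\<lambda>x y. x \<otimes> coproduct y) (coproduct x)) a"
      by (intro fps_ext_cop[OF a] complex_bilinear_comp[OF complex_bilinear_fps_tens]
          complex_bilinear_tens_comp cop_lin complex_linear_fps_const complex_linear_coproduct
          complex_linear_id) (simp add: cop_const fps_tens_const)
    ultimately show ?thesis
      by (simp add: fps_map_fps_map coproduct_coassoc)
  qed
  have counit_const: "fps_map counit (fps_const x) = fps_const (counit x)" for x :: "'x uea"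
    by (rule fps_map_const[OF complex_linear_counit])
  have scale_const: "fps_const c \<bullet>\<^sub>\<lambda> fps_const x = fps_const (c *\<^sub>C x)" for c and x :: "'x uea"
    by (simp add: fps_scale_const complex_linear_scale[OF complex_linear_fps_const])
  have bl1: "complex_bilinear (\<lambda>(x :: 'x uea) (y :: 'x uea). fps_map counit (fps_const x) \<bullet>\<^sub>\<lambda> fps_const y)"
    "complex_bilinear (\<lambda>(x :: 'x uea) (y :: 'x uea). counit x *\<^sub>C y)"
    by (intro complex_bilinear_comp[OF complex_bilinear_fps_scale] counit_lin complex_linear_fps_const
        complex_bilinear_comp[OF complex_bilinear_scaleC] complex_linear_counit complex_linear_id)+
  have bl2: "complex_bilinear (\<lambda>(x :: 'x uea) (y :: 'x uea). fps_map counit (fps_const y) \<bullet>\<^sub>\<lambda> fps_const x)"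
    "complex_bilinear (\<lambda>(x :: 'x uea) (y :: 'x uea). counit y *\<^sub>C x)"
    using bl1 by (auto simp: complex_bilinear_def)
  have counit_left: "fps_ext (tensor_lift (\<lambda>x y. fps_map counit (fps_const x) \<bullet>\<^sub>\<lambda> fps_const y)) (cop a) = a"
    if a: "a \<in> A" for a
    using fps_ext_cop[OF a bl1]
    by (simp add: counit_const scale_const coproduct_counit_left fps_map_ident)
  have counit_right: "fps_ext (tensor_lift (\<lambda>x y. fps_map counit (fps_const y) \<bullet>\<^sub>\<lambda> fps_const x)) (cop a) = a"
    if a: "a \<in> A" for a
    using fps_ext_cop[OF a bl2]
    by (simp add: counit_const scale_const coproduct_counit_right fps_map_ident)
  have bl_star: "complex_bilinear (star F)"
    by (intro complex_bilinearI lambda_linear_imp_complex_linear lambda_linear_star_left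
        lambda_linear_star_right)
  have star_const: "star F (fps_const x) (fps_const y) = fps_const (x * y)"
    if "x \<in> uea_sub \<gg> \<or> y \<in> uea_sub \<gg>" for x y
    using that star_uea_sub[of "fps_const x" "fps_const y"] by (auto simp: uea_sub_zero)
  have ant_left: "fps_ext (tensor_lift (\<lambda>x y. star F (ant (fps_const x)) (fps_const y))) (cop a) =
      fps_map counit a \<bullet>\<^sub>\<lambda> 1" if a: "a \<in> A" for a
    by (subst fps_ext_cop[OF a complex_bilinear_comp[OF bl_star ant_lin complex_linear_fps_const]
          complex_bilinear_comp[OF complex_bilinear_mult complex_linear_antipode complex_linear_id]])
       (simp_all add: ant_const star_const coproduct_antipode_left fps_scale_one_right fps_map_fps_map)
  have ant_right: "fps_ext (tensor_lift (\<lambda>x y. star F (fps_const x) (ant (fps_const y)))) (cop a) =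
      fps_map counit a \<bullet>\<^sub>\<lambda> 1" if a: "a \<in> A" for a
    by (subst fps_ext_cop[OF a complex_bilinear_comp[OF bl_star complex_linear_fps_const ant_lin]
          complex_bilinear_comp[OF complex_bilinear_mult complex_linear_id complex_linear_antipode]])
       (simp_all add: ant_const star_const coproduct_antipode_right fps_scale_one_right fps_map_fps_map)
  show ?thesis
    unfolding star_hopf_algebra_def
    using hopf_subalgebra
    by (simp add: star_assoc star_one star_coproduct_eq star_antipode_eq cop_one cop_star coassoc
        counit_left counit_right ant_left ant_right star_counit_eq counit_star
        fps_map_counit_one)
qed

text \<open>The coproduct of a symmetry commutes with the exponent, hence with its powers and with
  every coefficient of the twist.\<close>

lemma invariant: "invariant_deformation V1 V2 \<gg>"
  unfolding invariant_deformation_def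
proof (intro ballI conjI symmetry)
  fix u assume "u \<in> \<gg>"
  let ?t = "coproduct (gen u)"
  have "?t * - P = - P * ?t"
    using gen_commute[OF \<open>u \<in> \<gg>\<close>] by (simp add: coproduct_gen P_def ab_defs algebra_simps tens_mult)
  then have "?t * (- P) ^ n = (- P) ^ n * ?t" for n
    by (metis power_commuting_commutes)
  then show "fps_const ?t * F = F * fps_const ?t"
    by (simp add: twist_expo fps_eq_iff expo_nth mult_scaleC_left mult_scaleC_right)
qed

end

section \<open>Vector fields of the black hole\<close>

lemma four_eq_zero: "(4 :: 4) = 0"
  by simp

text \<open>The standard enumeration of the index type is 1, 2, 3, 4, and there 4 is 0, the time
  index.\<close>

lemma forall_spacetime: "(\<forall>i::4. Q i) \<longleftrightarrow> Q 0 \<and> Q 1 \<and> Q 2 \<and> Q 3"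
  unfolding forall_4 four_eq_zero by blast

text \<open>The fields concerned have real components, so at each point they also supply a direction
  for Frechet derivatives on the real space; \<open>cvec\<close> embeds them into the complex
  fields.\<close>

definition cvec :: "real ^ 4 \<Rightarrow> complex ^ 4" where
  "cvec w = (\<chi> k. of_real (w $ k))"

lemma cvec_nth: "cvec w $ k = of_real (w $ k)"
  by (simp add: cvec_def)

definition rot :: "4 \<Rightarrow> real ^ 4 \<Rightarrow> real ^ 4" where
  "rot i p = (\<chi> k. \<Sum>j\<in>{1, 2, 3}. levi_civita i j k * p $ j)"

lemma linear_rot: "linear (rot i)"
  by (rule linearI) (simp_all add: rot_def vec_eq_iff algebra_simps sum.distrib sum_distrib_left)

lemma rotation_field_cvec: "rotation_field i p = cvec (rot i p)"
  unfolding vec_eq_iff forall_spacetime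
  by (simp add: rotation_field_def coord_field_def cvec_def rot_def axis_def levi_civita_def)

lemma rot_nth_0: "rot i p $ 0 = 0"
  by (simp add: rot_def levi_civita_def)

lemma radius_cong: "(\<And>i. i \<in> {1, 2, 3} \<Longrightarrow> p $ i = q $ i) \<Longrightarrow> radius p = radius q"
  by (simp add: radius_def)

text \<open>
  The integral curve of a rotation through \<open>p\<close>; as \<open>- rot i (rot i p)\<close> is the projection of \<open>p\<close>
  onto the plane of rotation, no choice of coordinates is needed.
\<close>

definition rotation_curve :: "4 \<Rightarrow> real ^ 4 \<Rightarrow> real \<Rightarrow> real ^ 4" where
  "rotation_curve i p s = p + (1 - cos s) *\<^sub>R rot i (rot i p) + sin s *\<^sub>R rot i p"

lemma radius_rotation_curve:
  assumes "i \<in> {1, 2, 3}"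
  shows "radius (rotation_curve i p s) = radius p"
proof -
  \<comment> \<open>Each rotation acts in one coordinate plane, so a single planar identity, used
    for the three coordinate pairs, covers all axes.\<close>
  have "(cos s * x - sin s * y)\<^sup>2 + (cos s * y + sin s * x)\<^sup>2 = x\<^sup>2 + y\<^sup>2" for x y
  proof -
    have "(cos s * x - sin s * y)\<^sup>2 + (cos s * y + sin s * x)\<^sup>2 = ((cos s)\<^sup>2 + (sin s)\<^sup>2) * (x\<^sup>2 + y\<^sup>2)"
      by algebra
    then show ?thesis by simp
  qed
  from this[of "p $ 2" "p $ 3"] this[of "p $ 3" "p $ 1"] this[of "p $ 1" "p $ 2"] assms show ?thesis
    by (auto simp: radius_def rotation_curve_def rot_def levi_civita_def algebra_simps)
qed

text \<open>By the chain rule a directional derivative may be read off from any curve with the right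
  velocity. Only \<open>h\<close> as a whole has to be differentiable, not the functions of the
  radius from which it is assembled.\<close>

lemma frechet_derivative_along_curve:
  assumes "h differentiable at p" "\<gamma> 0 = p" "(\<gamma> has_vector_derivative w) (at 0)"
    and "((\<lambda>s. h (\<gamma> s)) has_vector_derivative d) (at (0::real))"
  shows "frechet_derivative h (at p) w = d"
proof -
  have "(h has_derivative frechet_derivative h (at p)) (at (\<gamma> 0))"
    using assms(1,2) by (simp add: frechet_derivative_works)
  then have "(h has_derivative frechet_derivative h (at p)) (at (\<gamma> 0) within range \<gamma>)"
    by (rule has_derivative_at_withinI)
  from vector_derivative_diff_chain_within[OF assms(3) this]
  have "((\<lambda>s. h (\<gamma> s)) has_vector_derivative frechet_derivative h (at p) w) (at 0)"
    by (simp add: o_def)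
  from vector_derivative_unique_at[OF this assms(4)] show ?thesis .
qed

lemma sum_partial:
  assumes "h differentiable at p"
  shows "(\<Sum>j\<in>UNIV. of_real (w $ j) * partial j h p) = frechet_derivative h (at p) w"
proof -
  interpret linear "frechet_derivative h (at p)"
    by (rule linear_frechet_derivative[OF assms])
  have "w = (\<Sum>j\<in>UNIV. (w $ j) *\<^sub>R axis j 1)"
    by (simp add: vec_eq_iff axis_def if_distrib cong: if_cong)
  then have "frechet_derivative h (at p) w = (\<Sum>j\<in>UNIV. (w $ j) *\<^sub>R frechet_derivative h (at p) (axis j 1))"
    by (metis (mono_tags, lifting) sum scale sum.cong)
  then show ?thesis
    by (simp add: partial_def scaleR_conv_of_real)
qed

section \<open>Vanishing brackets on the region\<close>

locale spacetime_region =
  fixes M :: "(real ^ 4) set" and vf :: "'x::complex_lie_algebra \<Rightarrow> vector_field"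
  assumes open_M: "open M" and iso: "vector_field_isomorphism M vf"
begin

lemma vf_add: "vf (u + v) = (\<lambda>p. vf u p + vf v p)"
  and vf_scale: "vf (c *\<^sub>C u) = (\<lambda>p. c *s vf u p)"
  and vf_lie: "vf (lie u v) = vf_bracket M (vf u) (vf v)"
  and vf_mem: "vf u \<in> vector_fields M"
  and vf_inj: "vf u = vf v \<Longrightarrow> u = v"
  using iso by (auto simp: vector_field_isomorphism_def bij_betw_def inj_on_def)

lemma vf_zero: "vf 0 = (\<lambda>p. 0)"
  using vf_add[of 0 0] by (simp add: fun_eq_iff)

lemma vf_differentiable:
  assumes "p \<in> M"
  shows "(\<lambda>q. vf u q $ k) differentiable at p"
proof -
  have "smooth_on M (\<lambda>q. vf u q $ k)"
    using vf_mem[of u] by (simp add: vector_fields_def)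
  then have "foldr partial [] (\<lambda>q. vf u q $ k) differentiable_on M"
    unfolding smooth_on_def by blast
  then show ?thesis
    using assms by (simp add: differentiable_on_eq_differentiable_at[OF open_M])
qed

text \<open>With real components, the coordinate sum in the bracket is a difference of two
  directional derivatives.\<close>

lemma bracket_eq_0I:
  assumes x: "vf u = on_region M (\<lambda>p. cvec (x p))" and y: "vf v = on_region M (\<lambda>p. cvec (y p))"
    and eq: "\<And>p k. p \<in> M \<Longrightarrow> frechet_derivative (\<lambda>q. vf v q $ k) (at p) (x p) =
      frechet_derivative (\<lambda>q. vf u q $ k) (at p) (y p)"
  shows "lie u v = 0"
proof (rule vf_inj)
  have "(\<Sum>j\<in>UNIV. vf u p $ j * partial j (\<lambda>q. vf v q $ k) p - vf v p $ j * partial j (\<lambda>q. vf u q $ k) p) = 0"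
    if p: "p \<in> M" for p k
    using sum_partial[OF vf_differentiable[OF p, of v k], of "x p"]
      sum_partial[OF vf_differentiable[OF p, of u k], of "y p"] p
    by (simp add: sum_subtractf x y on_region_def cvec_nth eq[OF p, unfolded x y on_region_def])
  then show "vf (lie u v) = vf 0"
    by (auto simp: vf_lie vf_zero vf_bracket_def on_region_def fun_eq_iff vec_eq_iff)
qed

text \<open>Extension by zero does not affect derivatives inside the region, because
  \<open>M\<close> is open.\<close>

lemma frechet_derivative_on_region:
  assumes "p \<in> M" "vf u = on_region M (\<lambda>p. cvec (x p))"
    and "((\<lambda>q. x q $ k) has_derivative D) (at p)"
  shows "frechet_derivative (\<lambda>q. vf u q $ k) (at p) = (\<lambda>w. of_real (D w))"
proof -
  have "((\<lambda>q. complex_of_real (x q $ k)) has_derivative (\<lambda>w. of_real (D w))) (at p)"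
    by (rule has_derivative_of_real[OF assms(3)])
  then have "((\<lambda>q. vf u q $ k) has_derivative (\<lambda>w. of_real (D w))) (at p)"
    by (rule has_derivative_transform_within_open[OF _ open_M assms(1)])
       (simp add: assms(2) on_region_def cvec_nth)
  then show ?thesis
    by (rule frechet_derivative_at[symmetric])
qed

text \<open>The components of the translation are constant, and those of \<open>v\<close> are
  constant along the time lines, which stay in \<open>M\<close>; both directional derivatives
  vanish.\<close>

lemma time_translation_commute:
  assumes p0: "vf p0 = on_region M (\<lambda>p. cvec (axis 0 1))" and v: "vf v = on_region M (\<lambda>p. cvec (y p))"
    and invariant: "\<And>p s. p \<in> M \<Longrightarrow> p + s *\<^sub>R axis 0 1 \<in> M"
      "\<And>p s. p \<in> M \<Longrightarrow> y (p + s *\<^sub>R axis 0 1) = y p"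
  shows "lie p0 v = 0"
proof (rule bracket_eq_0I[OF p0 v])
  fix p k assume p: "p \<in> M"
  have "frechet_derivative (\<lambda>q. vf p0 q $ k) (at p) (y p) = 0"
    by (simp add: frechet_derivative_on_region[OF p p0 has_derivative_const])
  moreover have "frechet_derivative (\<lambda>q. vf v q $ k) (at p) (axis 0 1) = 0"
  proof (rule frechet_derivative_along_curve[OF vf_differentiable[OF p]])
    show "((\<lambda>s. p + s *\<^sub>R axis 0 1) has_vector_derivative axis 0 1) (at 0)"
      by (auto intro!: derivative_eq_intros)
    have "(\<lambda>s. vf v (p + s *\<^sub>R axis 0 1) $ k) = (\<lambda>s. vf v p $ k)"
      using invariant[OF p] p by (simp add: v on_region_def)
    then show "((\<lambda>s. vf v (p + s *\<^sub>R axis 0 1) $ k) has_vector_derivative 0) (at 0)"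
      by simp
  qed simp
  ultimately show "frechet_derivative (\<lambda>q. vf v q $ k) (at p) (axis 0 1) =
      frechet_derivative (\<lambda>q. vf p0 q $ k) (at p) (y p)" by simp
qed

text \<open>Along a rotation curve the radius is constant, so a spatial component varies only
  through its factor \<open>p $ k\<close>, and its derivative is f times that of the rotation.
  Conversely the rotation is linear, hence its own derivative, and applied to the field it gives the
  same vector.\<close>

lemma rotation_commute:
  assumes i: "i \<in> {1, 2, 3}" and M: "M = {p. radius p \<in> J}"
    and L: "vf L = on_region M (\<lambda>p. cvec (rot i p))"
    and v: "vf v = on_region M (\<lambda>p. cvec (\<chi> k. if k = 0 then c (radius p) else f (radius p) * p $ k))"
  shows "lie L v = 0"
proof (rule bracket_eq_0I[OF L v])
  fix p k assume p: "p \<in> M"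
  let ?y = "\<chi> k. if k = 0 then c (radius p) else f (radius p) * p $ k"
  let ?d = "complex_of_real (f (radius p) * rot i p $ k)"
  have "frechet_derivative (\<lambda>q. vf v q $ k) (at p) (rot i p) = ?d"
  proof (rule frechet_derivative_along_curve[OF vf_differentiable[OF p]])
    let ?\<gamma> = "rotation_curve i p"
    show "?\<gamma> 0 = p" by (simp add: rotation_curve_def)
    show "(?\<gamma> has_vector_derivative rot i p) (at 0)"
      unfolding rotation_curve_def[abs_def] by (auto intro!: derivative_eq_intros)
    have M\<gamma>: "?\<gamma> s \<in> M" for s
      using p by (simp add: M radius_rotation_curve[OF i])
    show "((\<lambda>s. vf v (?\<gamma> s) $ k) has_vector_derivative ?d) (at 0)"
    proof (cases "k = 0")
      case True
      then show ?thesis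
        using M\<gamma> by (simp add: v on_region_def cvec_nth radius_rotation_curve[OF i] rot_nth_0)
    next
      case False
      have "((\<lambda>s. f (radius p) * (p $ k + (1 - cos s) * rot i (rot i p) $ k + sin s * rot i p $ k))
          has_vector_derivative f (radius p) * rot i p $ k) (at 0)"
        unfolding has_real_derivative_iff_has_vector_derivative[symmetric]
        by (auto intro!: derivative_eq_intros)
      then have "((\<lambda>s. complex_of_real (f (radius p) * (p $ k + (1 - cos s) * rot i (rot i p) $ k + sin s * rot i p $ k)))
          has_vector_derivative ?d) (at 0)"
        by (rule bounded_linear.has_vector_derivative[OF bounded_linear_of_real])
      moreover have "vf v (?\<gamma> s) $ k =
          of_real (f (radius p) * (p $ k + (1 - cos s) * rot i (rot i p) $ k + sin s * rot i p $ k))" for s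
        using M\<gamma> False
        by (simp add: v on_region_def cvec_nth radius_rotation_curve[OF i]) (simp add: rotation_curve_def)
      ultimately show ?thesis by simp
    qed
  qed
  moreover have "frechet_derivative (\<lambda>q. vf L q $ k) (at p) ?y = of_real (rot i ?y $ k)"
  proof -
    have "bounded_linear (\<lambda>q. rot i q $ k)"
      by (rule bounded_linear_compose[OF bounded_linear_vec_nth linear_conv_bounded_linear[THEN iffD1, OF linear_rot]])
    then have "((\<lambda>q. rot i q $ k) has_derivative (\<lambda>q. rot i q $ k)) (at p)"
      by (rule bounded_linear_imp_has_derivative)
    from frechet_derivative_on_region[OF p L this] show ?thesis by simp
  qed
  \<comment> \<open>The sum in \<open>rot\<close> runs over spatial indices, so the time component
    \<open>c\<close> of the field drops out.\<close>
  moreover have "rot i ?y $ k = f (radius p) * rot i p $ k"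
    by (simp add: rot_def sum_distrib_left algebra_simps)
  ultimately show "frechet_derivative (\<lambda>q. vf v q $ k) (at p) (rot i p) =
      frechet_derivative (\<lambda>q. vf L q $ k) (at p) ?y" by simp
qed

end

lemma lie_swap_zero:
  assumes "lie u v = (0 :: 'x::complex_lie_algebra)"
  shows "lie v u = 0"
  using lie_self[of "u + v"] unfolding lie_add_left lie_add_right by (simp add: lie_self assms)

lemma subspace_lie_kernel: "complex_space.subspace {u. lie u v = (0 :: 'x::complex_lie_algebra)}"
  unfolding complex_space.subspace_def
  using lie_scaleC_left[of 0 0 v] by (auto simp: lie_add_left lie_scaleC_left)

theorem mainTheorem10:
  fixes vf :: "'x::complex_lie_algebra \<Rightarrow> vector_field"
    and M :: "(real ^ 4) set" and J :: "real set"
    and c1 :: real and c2 f2 :: "real \<Rightarrow> real"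
    and p0 V1 V2 :: 'x and L :: "4 \<Rightarrow> 'x" and \<gg> :: "'x set"
  assumes "J \<subseteq> {0..}" and "M = {p. radius p \<in> J}" and "open M"
    and "vector_field_isomorphism M vf"
    and "vf p0 = on_region M (coord_field 0)"
    and "\<And>i. i \<in> {1, 2, 3} \<Longrightarrow> vf (L i) = on_region M (rotation_field i)"
    and "\<gg> = complex_space.span {p0, L 1, L 2, L 3}"
    and "vf V1 = on_region M (\<lambda>p. of_real c1 *s coord_field 0 p)"
    and "vf V2 = on_region M (\<lambda>p. of_real (c2 (radius p)) *s coord_field 0 p
           + of_real (f2 (radius p)) *s (\<Sum>i\<in>{1, 2, 3}. of_real (p $ i) *s coord_field i p))"
    and "\<exists>s\<in>J. f2 s \<noteq> 0"
  shows "invariant_deformation V1 V2 \<gg>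
    \<and> star_hopf_subalgebra (twist V1 V2) (enveloping_star (twist V1 V2) \<gg>)
    \<and> star_hopf_algebra (twist V1 V2) (enveloping_star (twist V1 V2) \<gg>)"
proof -
  interpret spacetime_region M vf
    by standard (rule assms)+
  define y where "y p = (\<chi> k. if k = 0 then c2 (radius p) else f2 (radius p) * p $ k)" for p :: "real ^ 4"
  have vf_p0: "vf p0 = on_region M (\<lambda>p. cvec (axis 0 1))"
    unfolding assms(5) by (simp add: on_region_def coord_field_def fun_eq_iff cvec_def vec_eq_iff axis_def)
  have vf_L: "vf (L i) = on_region M (\<lambda>p. cvec (rot i p))" if "i \<in> {1, 2, 3}" for i
    unfolding assms(6)[OF that] by (simp add: rotation_field_cvec[abs_def])
  have "of_real (c2 (radius p)) *s coord_field 0 p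
      + of_real (f2 (radius p)) *s (\<Sum>i\<in>{1, 2, 3}. of_real (p $ i) *s coord_field i p) = cvec (y p)" for p
    unfolding vec_eq_iff forall_spacetime by (simp add: y_def cvec_def coord_field_def axis_def)
  then have vf_V2: "vf V2 = on_region M (\<lambda>p. cvec (y p))"
    by (simp add: assms(9))
  \<comment> \<open>V1 is a multiple of the time translation, so its brackets follow from those of
    \<open>p0\<close>.\<close>
  have V1: "V1 = of_real c1 *\<^sub>C p0"
    by (rule vf_inj) (auto simp: vf_scale assms(5,8) on_region_def fun_eq_iff vec_eq_iff)
  have shift: "radius (p + s *\<^sub>R axis 0 1) = radius p" for p s
    by (rule radius_cong) (auto simp: axis_def)
  then have M_shift: "p + s *\<^sub>R axis 0 1 \<in> M" if "p \<in> M" for p s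
    using that by (simp add: assms(2))
  have y_shift: "y (p + s *\<^sub>R axis 0 1) = y p" for p s
    unfolding y_def shift by (simp add: vec_eq_iff axis_def)
  have p0_V2: "lie p0 V2 = 0"
    by (rule time_translation_commute[OF vf_p0 vf_V2 M_shift y_shift])
  have p0_L: "lie p0 (L i) = 0" if "i \<in> {1, 2, 3}" for i
    by (rule time_translation_commute[OF vf_p0 vf_L[OF that] M_shift])
       (auto simp: rot_def vec_eq_iff axis_def)
  have L_V2: "lie (L i) V2 = 0" if "i \<in> {1, 2, 3}" for i
    by (rule rotation_commute[OF that assms(2) vf_L[OF that] vf_V2[unfolded y_def]])
  \<comment> \<open>The fields whose bracket with a fixed field vanishes form a subspace, so the
    four spanning fields of \<gg> suffice.\<close>
  have "{p0, L 1, L 2, L 3} \<subseteq> {u. lie u V1 = 0}"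
    using lie_swap_zero[OF p0_L] by (auto simp: V1 lie_scaleC_right lie_self)
  then have "\<gg> \<subseteq> {u. lie u V1 = 0}"
    unfolding assms(7) by (rule complex_space.span_minimal[OF _ subspace_lie_kernel])
  moreover have "{p0, L 1, L 2, L 3} \<subseteq> {u. lie u V2 = 0}"
    using p0_V2 L_V2 by auto
  then have "\<gg> \<subseteq> {u. lie u V2 = 0}"
    unfolding assms(7) by (rule complex_space.span_minimal[OF _ subspace_lie_kernel])
  moreover have "lie V1 V2 = 0"
    by (simp add: V1 lie_scaleC_left p0_V2)
  ultimately interpret twist_symmetry V1 V2 \<gg>
    by unfold_locales auto
  show ?thesis
    using invariant hopf_subalgebra hopf_algebra by blast
qed

end
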